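(* Let $\phi(x)=\pi^{-d/4}e^{-|x|^2/2}$, $x\in\mathbf R^d$, let $\chi\in\mathcal R^\infty(\mathbf C^d)$, $\sigma\in(\frac12,1)$, $\sigma_0=\frac{\sigma}{2\sigma-1}$, and let $f\in\mathscr S'(\mathbf R^d)$. Then the following conditions are equivalent: (1) $f\in\mathcal H_{\flat_\sigma}(\mathbf R^d)$ (respectively $f\in\mathcal H_{0,\flat_\sigma}(\mathbf R^d)$); (2) $f=V_\phi^*F$ for some $F\in\mathscr E'(\mathbf R^{2d})\cap L^\infty(\mathbf R^{2d})$ which satisfies $$F(x,\xi)=F_0(x-i\xi)\,e^{-i\langle x,\xi\rangle}\chi(x,\xi)$$ for some $F_0\in\mathcal A_{0,\flat_{\sigma_0}}'(\mathbf C^d)$ (respectively $F_0\in\mathcal A_{\flat_{\sigma_0}}'(\mathbf C^d)$).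
   Context: Notation: $\mathbf R_+=(0,\infty)$, $\mathbf N=\{0,1,2,\dots\}$. Inequalities between vectors are coordinatewise. $D_r(0)=\{z\in\mathbf C^d: |z_j|<r_j,\ j=1,\dots,d\}$; functions on $\mathbf C^d$ are regarded as functions on $\mathbf R^{2d}$ via $z=x+i\xi$. $\langle x,\xi\rangle=\sum_jx_j\xi_j$. $g\lesssim h$ means $g\le Ch$ with $C>0$ independent of the variable. $\mathscr E'$ denotes compactly supported distributions. Hermite functions: $h_\alpha(x)=\pi^{-d/4}(-1)^{|\alpha|}(2^{|\alpha|}\alpha!)^{-1/2}e^{|x|^2/2}\partial^\alpha e^{-|x|^2}$, $\alpha\in\mathbf N^d$; $c_h(f,\alpha)=(f,h_\alpha)_{L^2}$. For $\sigma>0$, $\mathcal H_{\flat_\sigma}(\mathbf R^d)$ (respectively $\mathcal H_{0,\flat_\sigma}(\mathbf R^d)$) is the set of $f\in L^2(\mathbf R^d)$ with $|c_h(f,\alpha)|\lesssim r^\alpha\alpha!^{-1/(2\sigma)}$ for some (respectively every) $r\in\mathbf R_+^d$. Power series are written $G(z)=\sum_{\alpha\in\mathbf N^d}c(G,\alpha)z^\alpha/\sqrt{\alpha!}$. $\mathcal A'_{\flat_{\sigma_0}}(\mathbf C^d)$ (respectively $\mathcal A'_{0,\flat_{\sigma_0}}(\mathbf C^d)$) is the set of $G$ with $|c(G,\alpha)|\lesssim r^\alpha\alpha!^{1/(2\sigma_0)}$ for every (respectively some) $r\in\mathbf R_+^d$; since $\sigma_0>1$ these are entire functions. For $t_1\le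 t_2$ in $\mathbf R_+^d$, $\mathcal R^\infty_{t_1,t_2}(\mathbf C^d)$ is the set of non-negative $\chi\in L^\infty(\mathbf C^d)$ with support in $\overline{D_{t_2}(0)}$, of the form $\chi(z)=\chi_0(|z_1|,\dots,|z_d|)$ for some function $\chi_0$, and such that $\chi\ge c$ on $D_{t_1}(0)$ for some constant $c>0$. $\mathcal R^\infty(\mathbf C^d)=\bigcup_{t_1\le t_2}\mathcal R^\infty_{t_1,t_2}(\mathbf C^d)$. $V_\phi^*$ is the adjoint of the short-time Fourier transform $V_\phi f(x,\xi)=\langle f,\overline{\phi(\cdot-x)}e^{-i\langle\cdot,\xi\rangle}\rangle$; for $F\in L^\infty\cap\mathscr E'$, $(V_\phi^*F)(x)=\iint F(y,\eta)\phi(x-y)e^{i\langle x,\eta\rangle}\,dy\,d\eta$ (constant normalising factors are immaterial here). *)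

theory Defs
  imports "HOL-Analysis.Analysis"
begin

section \<open>Multi-indices\<close>

definition mi_size :: "nat ^ 'n \<Rightarrow> nat" where
  "mi_size \<alpha> = (\<Sum>i\<in>UNIV. \<alpha> $ i)"

definition mi_fact :: "nat ^ 'n \<Rightarrow> real" where
  "mi_fact \<alpha> = (\<Prod>i\<in>UNIV. fact (\<alpha> $ i))"

definition mi_power :: "'a::comm_semiring_1 ^ 'n \<Rightarrow> nat ^ 'n \<Rightarrow> 'a" where
  "mi_power x \<alpha> = (\<Prod>i\<in>UNIV. (x $ i) ^ (\<alpha> $ i))"

definition positive_radius :: "real ^ 'n \<Rightarrow> bool" where
  "positive_radius r \<longleftrightarrow> (\<forall>i. 0 < r $ i)"


section \<open>Partial derivatives, Schwartz functions, tempered distributions\<close>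

definition partial_deriv ::
    "'n \<Rightarrow> (real ^ 'n \<Rightarrow> 'b::real_normed_vector) \<Rightarrow> real ^ 'n \<Rightarrow> 'b" where
  "partial_deriv i f x = vector_derivative (\<lambda>t. f (x + t *\<^sub>R axis i 1)) (at 0)"

definition iter_partial ::
    "'n list \<Rightarrow> (real ^ 'n \<Rightarrow> 'b::real_normed_vector) \<Rightarrow> real ^ 'n \<Rightarrow> 'b" where
  "iter_partial js f = foldr partial_deriv js f"

definition smooth :: "(real ^ 'n \<Rightarrow> 'b::real_normed_vector) \<Rightarrow> bool" where
  "smooth f \<longleftrightarrow> (\<forall>js x. iter_partial js f differentiable (at x))"

text \<open>The index type carries no order, so the order in which the partial derivatives of
  \<open>\<partial>\<^sup>\<alpha>\<close> are taken is left unspecified. It is immaterial for smooth functions, the only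
  ones to which the operator is applied below.\<close>

definition mi_deriv ::
    "nat ^ 'n \<Rightarrow> (real ^ 'n \<Rightarrow> 'b::real_normed_vector) \<Rightarrow> real ^ 'n \<Rightarrow> 'b" where
  "mi_deriv \<alpha> f = iter_partial (SOME js. \<forall>i. count_list js i = \<alpha> $ i) f"

lemma ex_list_of_multi_index: "\<exists>js. \<forall>i. count_list js i = (\<alpha> :: nat ^ 'n) $ i"
proof -
  obtain js where js: "mset js = (\<Sum>i\<in>UNIV. replicate_mset (\<alpha> $ i) i)"
    using ex_mset by blast
  have "count_list js i = \<alpha> $ i" for i
    unfolding count_mset[symmetric] js by (simp add: count_sum sum.delta)
  then show ?thesis by blast
qed

definition schwartz_seminorm ::
    "nat ^ 'n \<Rightarrow> nat ^ 'n \<Rightarrow> (real ^ 'n \<Rightarrow> complex) \<Rightarrow> real" where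
  "schwartz_seminorm \<alpha> \<beta> \<psi> = (SUP x. norm (mi_power x \<alpha> *\<^sub>R mi_deriv \<beta> \<psi> x))"

definition schwartz :: "(real ^ 'n \<Rightarrow> complex) set" where
  "schwartz = {\<psi>. smooth \<psi> \<and>
     (\<forall>\<alpha> \<beta>. bounded (range (\<lambda>x. mi_power x \<alpha> *\<^sub>R mi_deriv \<beta> \<psi> x)))}"

text \<open>Distributions are functionals on all functions of which only the values on Schwartz
  functions matter; equality of distributions is equality on \<^const>\<open>schwartz\<close>.\<close>

definition tempered_distribution :: "((real ^ 'n \<Rightarrow> complex) \<Rightarrow> complex) \<Rightarrow> bool" where
  "tempered_distribution f \<longleftrightarrow>
     (\<forall>\<psi>\<in>schwartz. \<forall>\<psi>'\<in>schwartz. \<forall>a b. f (\<lambda>x. a * \<psi> x + b * \<psi>' x) = a * f \<psi> + b * f \<psi>') \<and>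
     (\<exists>C N. \<forall>\<psi>\<in>schwartz. norm (f \<psi>) \<le>
        C * (\<Sum>\<alpha> | mi_size \<alpha> \<le> N. \<Sum>\<beta> | mi_size \<beta> \<le> N. schwartz_seminorm \<alpha> \<beta> \<psi>))"

definition represented_by ::
    "((real ^ 'n \<Rightarrow> complex) \<Rightarrow> complex) \<Rightarrow> (real ^ 'n \<Rightarrow> complex) \<Rightarrow> bool" where
  "represented_by f g \<longleftrightarrow>
     (\<forall>\<psi>\<in>schwartz. integrable lebesgue (\<lambda>x. g x * \<psi> x) \<and>
        f \<psi> = (LINT x|lebesgue. g x * \<psi> x))"


section \<open>Hermite functions and the spaces \<open>\<H>\<close>\<close>

definition hermite_fun :: "nat ^ 'n \<Rightarrow> real ^ 'n \<Rightarrow> real" where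
  "hermite_fun \<alpha> x =
     pi powr (- real CARD('n) / 4) * (-1) ^ mi_size \<alpha> *
     (2 ^ mi_size \<alpha> * mi_fact \<alpha>) powr (- 1 / 2) * exp ((norm x)\<^sup>2 / 2) *
     mi_deriv \<alpha> (\<lambda>y. exp (- (norm y)\<^sup>2)) x"

definition square_integrable :: "(real ^ 'n \<Rightarrow> complex) \<Rightarrow> bool" where
  "square_integrable g \<longleftrightarrow>
     g \<in> borel_measurable lebesgue \<and> integrable lebesgue (\<lambda>x. (norm (g x))\<^sup>2)"

definition hermite_coeff :: "(real ^ 'n \<Rightarrow> complex) \<Rightarrow> nat ^ 'n \<Rightarrow> complex" where
  "hermite_coeff g \<alpha> = (LINT x|lebesgue. g x * cnj (complex_of_real (hermite_fun \<alpha> x)))"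

definition H_flat :: "real \<Rightarrow> (real ^ 'n \<Rightarrow> complex) set" where
  "H_flat \<sigma> = {g. square_integrable g \<and>
     (\<exists>r. positive_radius r \<and> (\<exists>C>0. \<forall>\<alpha>. norm (hermite_coeff g \<alpha>) \<le>
        C * (mi_power r \<alpha> * mi_fact \<alpha> powr (- 1 / (2 * \<sigma>)))))}"

definition H_0_flat :: "real \<Rightarrow> (real ^ 'n \<Rightarrow> complex) set" where
  "H_0_flat \<sigma> = {g. square_integrable g \<and>
     (\<forall>r. positive_radius r \<longrightarrow> (\<exists>C>0. \<forall>\<alpha>. norm (hermite_coeff g \<alpha>) \<le>
        C * (mi_power r \<alpha> * mi_fact \<alpha> powr (- 1 / (2 * \<sigma>)))))}"


section \<open>The spaces \<open>\<A>'\<close> of power series\<close>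

text \<open>For \<open>\<sigma> > 1\<close> the coefficient bounds make the series converge absolutely everywhere, so
  the elements are identified with the entire functions they define (for \<open>\<sigma> \<le> 1\<close> they
  would have to be kept as formal power series).\<close>

definition has_power_series :: "(complex ^ 'n \<Rightarrow> complex) \<Rightarrow> (nat ^ 'n \<Rightarrow> complex) \<Rightarrow> bool" where
  "has_power_series G c \<longleftrightarrow>
     (\<forall>z. ((\<lambda>\<alpha>. c \<alpha> * mi_power z \<alpha> / complex_of_real (sqrt (mi_fact \<alpha>))) has_sum G z) UNIV)"

definition A'_flat :: "real \<Rightarrow> (complex ^ 'n \<Rightarrow> complex) set" where
  "A'_flat \<sigma> = {G. \<exists>c. has_power_series G c \<and>
     (\<forall>r. positive_radius r \<longrightarrow> (\<exists>C>0. \<forall>\<alpha>. norm (c \<alpha>) \<le>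
        C * (mi_power r \<alpha> * mi_fact \<alpha> powr (1 / (2 * \<sigma>)))))}"

definition A'_0_flat :: "real \<Rightarrow> (complex ^ 'n \<Rightarrow> complex) set" where
  "A'_0_flat \<sigma> = {G. \<exists>c. has_power_series G c \<and>
     (\<exists>r. positive_radius r \<and> (\<exists>C>0. \<forall>\<alpha>. norm (c \<alpha>) \<le>
        C * (mi_power r \<alpha> * mi_fact \<alpha> powr (1 / (2 * \<sigma>)))))}"


section \<open>Essentially bounded functions, compact support, and the class \<open>\<R>\<^sup>\<infinity>\<close>\<close>

text \<open>Elements of \<open>L\<^sup>\<infinity>\<close> are classes modulo null sets, so every condition on a
  representative is imposed almost everywhere. In particular an \<open>L\<^sup>\<infinity>\<close> function has
  (distributional) support in a closed set iff it vanishes almost everywhere outside it.\<close>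

definition Linfty :: "('a::euclidean_space \<Rightarrow> 'b::euclidean_space) \<Rightarrow> bool" where
  "Linfty F \<longleftrightarrow> F \<in> borel_measurable lebesgue \<and> (\<exists>M. AE p in lebesgue. norm (F p) \<le> M)"

definition supported_in ::
    "('a::euclidean_space \<Rightarrow> 'b::euclidean_space) \<Rightarrow> 'a set \<Rightarrow> bool" where
  "supported_in F K \<longleftrightarrow> closed K \<and> (AE p in lebesgue. p \<notin> K \<longrightarrow> F p = 0)"

definition compactly_supported :: "('a::euclidean_space \<Rightarrow> 'b::euclidean_space) \<Rightarrow> bool" where
  "compactly_supported F \<longleftrightarrow> (\<exists>K. compact K \<and> supported_in F K)"

definition polydisc :: "real ^ 'n \<Rightarrow> (complex ^ 'n) set" where
  "polydisc r = {z. \<forall>j. cmod (z $ j) < r $ j}"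

definition R_infty_between :: "real ^ 'n \<Rightarrow> real ^ 'n \<Rightarrow> (complex ^ 'n \<Rightarrow> real) set" where
  "R_infty_between t1 t2 = {\<kappa>. Linfty \<kappa> \<and>
     (AE z in lebesgue. 0 \<le> \<kappa> z) \<and>
     supported_in \<kappa> (closure (polydisc t2)) \<and>
     (\<exists>\<kappa>0 :: real ^ 'n \<Rightarrow> real. AE z in lebesgue. \<kappa> z = \<kappa>0 (\<chi> j. cmod (z $ j))) \<and>
     (\<exists>c>0. AE z in lebesgue. z \<in> polydisc t1 \<longrightarrow> c \<le> \<kappa> z)}"

definition R_infty :: "(complex ^ 'n \<Rightarrow> real) set" where
  "R_infty = (\<Union>{R_infty_between t1 t2 | t1 t2.
     positive_radius t1 \<and> positive_radius t2 \<and> (\<forall>j. t1 $ j \<le> t2 $ j)})"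


section \<open>The adjoint of the short-time Fourier transform\<close>

definition cvec :: "real ^ 'n \<Rightarrow> real ^ 'n \<Rightarrow> complex ^ 'n" where
  "cvec x \<xi> = (\<chi> j. Complex (x $ j) (\<xi> $ j))"

definition STFT_adjoint ::
    "(real ^ 'n \<Rightarrow> complex) \<Rightarrow> ((real ^ 'n) \<times> (real ^ 'n) \<Rightarrow> complex) \<Rightarrow> real ^ 'n \<Rightarrow> complex" where
  "STFT_adjoint \<phi> F x =
     (LINT p|lebesgue. F p * \<phi> (x - fst p) * exp (\<i> * complex_of_real (x \<bullet> snd p)))"

text \<open>Here \<open>(x, \<xi>)\<close> is identified with \<open>z = x + i\<xi>\<close>, so \<open>F\<^sub>0\<close> is evaluated at the conjugate point;
  \<open>A\<close> is the space of power series from which \<open>F\<^sub>0\<close> is taken.\<close>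

definition STFT_adjoint_representation ::
    "(real ^ 'n \<Rightarrow> complex) \<Rightarrow> (complex ^ 'n \<Rightarrow> real) \<Rightarrow> (complex ^ 'n \<Rightarrow> complex) set \<Rightarrow>
     ((real ^ 'n \<Rightarrow> complex) \<Rightarrow> complex) \<Rightarrow> bool" where
  "STFT_adjoint_representation \<phi> \<kappa> A f \<longleftrightarrow>
     (\<exists>F. Linfty F \<and> compactly_supported F \<and>
        (\<exists>F0\<in>A. AE p in lebesgue. F p =
           F0 (cvec (fst p) (- snd p)) * exp (- \<i> * complex_of_real (fst p \<bullet> snd p)) *
           complex_of_real (\<kappa> (cvec (fst p) (snd p)))) \<and>
        represented_by f (STFT_adjoint \<phi> F))"

end

theory Submission
  imports Defs "HOL-Probability.Characteristic_Functions"
begin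

text \<open>The Bargmann transform of \<open>h\<^sub>\<beta>\<close> is a monomial, so by Fubini the Hermite coefficient
  \<open>c\<^sub>h(V*F, \<beta>)\<close> is, up to the factor \<open>1 / sqrt (2^|\<beta>| \<beta>!)\<close>, the integral of
  \<open>F\<^sub>1(zbar) exp(- z\<^sup>2/8) z\<^sup>\<beta>\<close> against the radial weight \<open>\<chi>(z) exp(- |z|\<^sup>2/4)\<close>, where
  \<open>F\<^sub>1(w) = F\<^sub>0(w) exp(w\<^sup>2/8)\<close>. Distinct monomials are orthogonal for a radial weight, and the
  moments of the weight lie between two geometric sequences, because \<open>\<chi>\<close> has compact support
  and is bounded below near 0. So, apart from the exponential factors, passing from the Taylor
  coefficients of \<open>F\<^sub>0\<close> to Hermite coefficients is a diagonal map that only changes radii.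
  Multiplication by \<open>exp(w\<^sup>2/8)\<close> preserves the spaces of power series, whose order \<open>2\<sigma>/(1 - \<sigma>)\<close>
  exceeds 2, and \<open>exp(- z\<^sup>2/8)\<close> acts on coefficients by an invertible operator that preserves
  every bound. Conversely, \<open>F\<^sub>0\<close> is read off from the Hermite coefficients of \<open>f\<close>, and
  completeness of the Hermite functions gives \<open>f = V*F\<close>.\<close>

section \<open>Gaussian integrals\<close>

text \<open>One exponent, tau = (1 - sigma) / (2 sigma), governs everything. Hermite coefficients
  carry an extra factor 1 / sqrt(alpha!), and series in A' are written with the same divisor; so
  1/(2 sigma) = tau + 1/2 and 1/(2 sigma0) = 1/2 - tau, which is where sigma0 comes from. The
  estimates concern plain coefficients bounded by r^alpha alpha!^(-tau): sigma < 1 means tau > 0,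
  and sigma > 1/2 means tau < 1/2, the condition under which exp(w^2/8) can be multiplied in. The
  obstacle is exp(- z^2/8). It depends on z while F_0 is evaluated at zbar, so it cannot be absorbed
  into the series, and it destroys orthogonality. Moved onto z^beta it raises the index, which gives
  an infinite sum of later coefficients; these grow at most geometrically along the ray, so the
  exponential series converges, and the opposite sign inverts it. Completeness is obtained without
  Fourier inversion: orthogonality to all polynomials times exp(- |x|^2/2) passes to ever narrower
  Gaussians and to their translates, which form an approximate identity.\<close>

lemma measurable_vec_nth [measurable]: "(\<lambda>x::'a::{real_normed_vector}^'n. x $ i) \<in> borel_measurable borel"
  by (intro borel_measurable_continuous_onI continuous_intros)

text \<open>By \<open>lborel_eq\<close> the measure is the image of a product measure indexed by
  \<open>Basis\<close> instead of the index type; the bijection \<open>e\<close> carries coordinates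
  to basis vectors, and Fubini for product measures does the rest.\<close>

lemma
  fixes f :: "'n::finite \<Rightarrow> real \<Rightarrow> 'b::{real_normed_field,banach,second_countable_topology}"
  assumes f: "\<And>i. integrable lborel (f i)"
  shows integrable_prod_vec: "integrable lborel (\<lambda>x::real^'n. \<Prod>i\<in>UNIV. f i (x $ i))"
    and integral_prod_vec: "(LINT x|lborel. (\<Prod>i\<in>UNIV. f i ((x::real^'n) $ i))) = (\<Prod>i\<in>UNIV. (LINT t|lborel. f i t))"
proof -
  define e where "e = (\<lambda>i::'n. axis i (1::real))"
  have inj: "inj e" by (auto simp: e_def inj_def axis_eq_axis)
  have Basis: "Basis = range e" by (auto simp: e_def Basis_vec_def)
  define g where "g b = f (inv e b)" for b
  have ge: "g (e i) = f i" for i using inj by (simp add: g_def)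
  interpret product_sigma_finite "\<lambda>_::real^'n. lborel :: real measure" by standard
  define S where "S = (\<lambda>h. \<Sum>b\<in>(Basis::(real^'n) set). h b *\<^sub>R b :: real^'n)"
  have S: "S \<in> measurable (\<Pi>\<^sub>M b\<in>(Basis::(real^'n) set). lborel) borel" unfolding S_def by measurable
  have lb: "(lborel :: (real^'n) measure) = distr (\<Pi>\<^sub>M b\<in>(Basis::(real^'n) set). lborel) borel S"
    unfolding S_def by (rule lborel_eq)
  have SB: "S h $ i = h (e i)" for h i
    unfolding S_def Basis by (simp add: sum.reindex[OF inj])
      (simp add: e_def axis_def if_distrib[of "\<lambda>u. _ * u"] cong: if_cong)
  have meas: "(\<lambda>x::real^'n. \<Prod>i\<in>UNIV. f i (x $ i)) \<in> borel_measurable borel"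
    using f by (intro borel_measurable_prod measurable_compose[OF measurable_vec_nth]) (auto dest: borel_measurable_integrable)
  have pr: "(\<Prod>i\<in>UNIV. f i (S h $ i)) = (\<Prod>b\<in>Basis. g b (h b))" for h
    unfolding SB Basis by (simp add: prod.reindex[OF inj] ge)
  have gi: "integrable lborel (g b)" for b using f by (simp add: g_def)
  show "integrable lborel (\<lambda>x::real^'n. \<Prod>i\<in>UNIV. f i (x $ i))"
    unfolding lb by (subst integrable_distr_eq[OF S meas]) (use gi in \<open>simp add: pr product_integrable_prod\<close>)
  have "(LINT x|lborel. (\<Prod>i\<in>UNIV. f i ((x::real^'n) $ i))) = (\<Prod>b\<in>Basis. (LINT t|lborel. g b t))"
    unfolding lb by (subst integral_distr[OF S meas]) (use gi in \<open>simp add: pr product_integral_prod\<close>)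
  also have "\<dots> = (\<Prod>i\<in>UNIV. (LINT t|lborel. f i t))"
    unfolding Basis by (simp add: prod.reindex[OF inj] ge)
  finally show "(LINT x|lborel. (\<Prod>i\<in>UNIV. f i ((x::real^'n) $ i))) = (\<Prod>i\<in>UNIV. (LINT t|lborel. f i t))" .
qed

abbreviation (input) gauss :: "real \<Rightarrow> 'a::real_normed_vector \<Rightarrow> real" where
  "gauss a x \<equiv> exp (- a * (norm x)\<^sup>2)"

abbreviation (input) cpx :: "real \<Rightarrow> complex" where
  "cpx \<equiv> complex_of_real"

text \<open>The induction needs the claim for every \<epsilon>: a product spends half of \<epsilon>
  on each factor.\<close>

lemma real_polynomial_function_exp_bound:
  fixes p :: "'a::real_normed_vector \<Rightarrow> real"
  assumes "real_polynomial_function p" "0 < \<epsilon>"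
  shows "\<exists>C>0. \<forall>x. \<bar>p x\<bar> \<le> C * exp (\<epsilon> * (norm x)\<^sup>2)"
  using assms
proof (induction arbitrary: \<epsilon> rule: real_polynomial_function.induct)
  case (linear f)
  then obtain K where K: "\<And>x. norm (f x) \<le> norm x * K" "K > 0"
    using bounded_linear.pos_bounded by blast
  have "\<bar>f x\<bar> \<le> K * (1 + 1 / \<epsilon>) * exp (\<epsilon> * (norm x)\<^sup>2)" for x
  proof -
    have 0: "0 \<le> (norm x - 1)\<^sup>2" by simp
    have "norm x \<le> 1 + (norm x)\<^sup>2" using 0 norm_ge_zero[of x]
      unfolding power2_diff by (simp; linarith)
    also have "\<dots> \<le> (1 + 1/\<epsilon>) * (1 + \<epsilon> * (norm x)\<^sup>2)" using linear by (simp add: field_simps)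
    also have "\<dots> \<le> (1 + 1/\<epsilon>) * exp (\<epsilon> * (norm x)\<^sup>2)" using linear by (intro mult_left_mono exp_ge_add_one_self) auto
    finally have "norm x * K \<le> (1 + 1/\<epsilon>) * exp (\<epsilon> * (norm x)\<^sup>2) * K" using K(2) by (intro mult_right_mono) auto
    with K(1)[of x] show ?thesis by (simp add: mult_ac)
  qed
  moreover have "K * (1 + 1 / \<epsilon>) > 0" using K linear by (simp add: add_pos_pos)
  ultimately show ?case by blast
next
  case (const c)
  have "\<bar>c\<bar> \<le> (\<bar>c\<bar> + 1) * exp (\<epsilon> * (norm x)\<^sup>2)" for x :: 'a
  proof -
    have "(\<bar>c\<bar> + 1) * 1 \<le> (\<bar>c\<bar> + 1) * exp (\<epsilon> * (norm x)\<^sup>2)"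
      using const by (intro mult_left_mono) auto
    then have "\<bar>c\<bar> + 1 \<le> (\<bar>c\<bar> + 1) * exp (\<epsilon> * (norm x)\<^sup>2)" by simp
    then show ?thesis by (rule order_trans[rotated]) simp
  qed
  then show ?case by (intro exI[of _ "\<bar>c\<bar> + 1"]) auto
next
  case (add f g)
  obtain C D where *: "C > 0" "D > 0" "\<And>x. \<bar>f x\<bar> \<le> C * exp (\<epsilon> * (norm x)\<^sup>2)" "\<And>x. \<bar>g x\<bar> \<le> D * exp (\<epsilon> * (norm x)\<^sup>2)"
    using add.IH[OF add.prems] by blast
  have "\<bar>f x + g x\<bar> \<le> (C + D) * exp (\<epsilon> * (norm x)\<^sup>2)" for x
    using *(3,4)[of x] by (simp add: distrib_right)
  then show ?case using *(1,2) by (intro exI[of _ "C + D"]) auto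
next
  case (mult f g)
  obtain C D where *: "C > 0" "D > 0" "\<And>x. \<bar>f x\<bar> \<le> C * exp (\<epsilon>/2 * (norm x)\<^sup>2)" "\<And>x. \<bar>g x\<bar> \<le> D * exp (\<epsilon>/2 * (norm x)\<^sup>2)"
    using mult.IH[of "\<epsilon>/2"] mult.prems by fastforce
  have "\<bar>f x * g x\<bar> \<le> (C * D) * exp (\<epsilon> * (norm x)\<^sup>2)" for x
  proof -
    have "\<bar>f x * g x\<bar> \<le> (C * exp (\<epsilon>/2 * (norm x)\<^sup>2)) * (D * exp (\<epsilon>/2 * (norm x)\<^sup>2))"
      unfolding abs_mult by (intro mult_mono *) (use * in auto)
    also have "\<dots> = (C * D) * (exp (\<epsilon>/2 * (norm x)\<^sup>2 + \<epsilon>/2 * (norm x)\<^sup>2))"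
      by (simp only: exp_add mult_ac)
    finally show ?thesis by simp
  qed
  then show ?case using *(1,2) by (intro exI[of _ "C * D"]) auto
qed

lemma integrable_gaussian_real:
  assumes "0 < a" shows "integrable lborel (\<lambda>t::real. exp (- a * t\<^sup>2))"
proof -
  have "integrable lborel (\<lambda>t. sqrt (pi / a) * normal_density 0 (sqrt (1 / (2 * a))) t)"
    using assms by (intro integrable_mult_right integrable_normal_density) simp
  also have "(\<lambda>t. sqrt (pi / a) * normal_density 0 (sqrt (1 / (2 * a))) t) = (\<lambda>t. exp (- a * t\<^sup>2))"
    using assms by (auto simp: normal_density_def fun_eq_iff real_sqrt_divide power_divide)
  finally show ?thesis .
qed

lemma norm_vec_sq: "(norm (x :: real^'n))\<^sup>2 = (\<Sum>i\<in>UNIV. (x $ i)\<^sup>2)"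
  by (simp add: norm_vec_def L2_set_def sum_nonneg)

lemma integrable_gaussian:
  assumes "0 < a" shows "integrable lborel (\<lambda>x::real^'n. gauss a x)"
  using integrable_prod_vec[of "\<lambda>_ t. exp (- a * t\<^sup>2)"] integrable_gaussian_real[OF assms]
  by (simp add: norm_vec_sq sum_distrib_left exp_sum flip: sum_negf)

section \<open>Hermite functions\<close>

text \<open>The physicists' Hermite polynomials. Starting from the recurrence makes polynomiality
  evident; the link with derivatives of exp(- t^2) is \<open>herm_gauss_deriv\<close>.\<close>

fun herm :: "nat \<Rightarrow> real \<Rightarrow> real" where
  "herm 0 t = 1"
| "herm (Suc 0) t = 2 * t"
| "herm (Suc (Suc n)) t = 2 * t * herm (Suc n) t - 2 * real (Suc n) * herm n t"

text \<open>At n = 0 the truncated index \<open>n - 1\<close> does no harm, since its term carries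
  the factor \<open>real n\<close>.\<close>

lemma herm_Suc: "herm (Suc n) t = 2 * t * herm n t - 2 * real n * herm (n - 1) t"
  by (cases n) auto

text \<open>Differentiating the recurrence leaves 2 H_(n+1) plus 2 (n + 1) times the right-hand side
  of the recurrence one step lower, which \<open>herm_Suc\<close> folds back into H_(n+1).\<close>

lemma herm_deriv: "(herm n has_real_derivative 2 * real n * herm (n - 1) t) (at t)"
proof (induction n t rule: herm.induct)
  case (1 t)
  have "herm 0 = (\<lambda>_. 1)" by auto
  then show ?case by simp
next
  case (2 t)
  have "herm (Suc 0) = (\<lambda>t. 2 * t)" by auto
  then show ?case by (auto intro!: derivative_eq_intros)
next
  case (3 n t)
  have eq: "herm (Suc (Suc n)) = (\<lambda>t. 2 * t * herm (Suc n) t - 2 * real (Suc n) * herm n t)" by auto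
  have "((\<lambda>t. 2 * t * herm (Suc n) t - 2 * real (Suc n) * herm n t) has_real_derivative
     2 * herm (Suc n) t + (2 * real (Suc n) * herm n t) * (2 * t) - 2 * real (Suc n) * (2 * real n * herm (n - 1) t)) (at t)"
    using 3 by (auto intro!: derivative_eq_intros)
  moreover have "2 * herm (Suc n) t + (2 * real (Suc n) * herm n t) * (2 * t) - 2 * real (Suc n) * (2 * real n * herm (n - 1) t)
    = 2 * real (Suc (Suc n)) * herm (Suc (Suc n) - 1) t"
  proof -
    have "2 * herm (Suc n) t + (2 * real (Suc n) * herm n t) * (2 * t) - 2 * real (Suc n) * (2 * real n * herm (n - 1) t)
      = 2 * herm (Suc n) t + 2 * real (Suc n) * (2 * t * herm n t - 2 * real n * herm (n - 1) t)"
      by (simp add: algebra_simps)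
    also have "2 * t * herm n t - 2 * real n * herm (n - 1) t = herm (Suc n) t" by (rule herm_Suc[symmetric])
    finally show ?thesis by (simp add: algebra_simps)
  qed
  ultimately show ?case unfolding eq by simp
qed

lemma herm_gauss_deriv:
  "((\<lambda>t. herm n t * exp (- t\<^sup>2)) has_real_derivative - (herm (Suc n) t * exp (- t\<^sup>2))) (at t)"
proof -
  have "((\<lambda>t. herm n t * exp (- t\<^sup>2)) has_real_derivative
      - ((2 * t * herm n t - 2 * real n * herm (n - 1) t) * exp (- t\<^sup>2))) (at t)"
    by (auto intro!: derivative_eq_intros herm_deriv simp: algebra_simps)
  then show ?thesis by (simp only: herm_Suc)
qed

lemma continuous_herm [continuous_intros]:
  "continuous_on S f \<Longrightarrow> continuous_on S (\<lambda>x. herm n (f x))"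
proof -
  have "continuous_on UNIV (herm n)"
    using herm_deriv by (meson DERIV_continuous continuous_at_imp_continuous_on)
  then show "continuous_on S f \<Longrightarrow> continuous_on S (\<lambda>x. herm n (f x))"
    by (rule continuous_on_compose2) auto
qed

lemma measurable_herm [measurable]: "herm n \<in> borel_measurable borel"
  by (intro borel_measurable_continuous_onI continuous_intros)

lemma real_polynomial_function_herm:
  "real_polynomial_function f \<Longrightarrow> real_polynomial_function (\<lambda>x. herm n (f x))"
proof (induction n "0::real" rule: herm.induct)
  case (3 n)
  then have "real_polynomial_function (\<lambda>x. 2 * f x * herm (Suc n) (f x) - 2 * real (Suc n) * herm n (f x))"
    by (intro real_polynomial_function_diff real_polynomial_function.intros(4) real_polynomial_function.intros(2)) auto
  then show ?case by simp
next
  case 2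
  then have "real_polynomial_function (\<lambda>x. 2 * f x)"
    by (intro real_polynomial_function.intros(4) real_polynomial_function.intros(2))
  then show ?case by simp
qed (simp add: real_polynomial_function.intros(2))

lemma length_eq_sum_count: "length (js::'n::finite list) = (\<Sum>i\<in>UNIV. count_list js i)"
proof (induction js)
  case (Cons a js)
  have "(\<Sum>i\<in>UNIV. count_list (a # js) i) = (\<Sum>i\<in>UNIV. (if a = i then 1 else 0) + count_list js i)"
    by (intro sum.cong) auto
  also have "\<dots> = length (a # js)" using Cons by (simp add: sum.distrib)
  finally show ?case by simp
qed simp

text \<open>Each derivative hits a single factor of the product of one-dimensional Gaussians, so
  only the number of occurrences of an index matters. The arbitrary list inside
  \<open>mi_deriv\<close> is thus handled without commuting partial derivatives.\<close>

lemma iter_partial_gauss: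
  "iter_partial js (\<lambda>y::real^'n. exp (- (norm y)\<^sup>2)) =
    (\<lambda>x. (-1) ^ length js * (\<Prod>i\<in>UNIV. herm (count_list js i) (x $ i) * exp (- (x $ i)\<^sup>2)))"
proof (induction js)
  case Nil
  show ?case by (simp add: iter_partial_def norm_vec_sq exp_sum flip: sum_negf)
next
  case (Cons j js)
  define g where "g i t = herm (count_list js i) t * exp (- t\<^sup>2)" for i t
  define g' where "g' i t = herm (count_list (j # js) i) t * exp (- t\<^sup>2)" for i t
  have gj: "(g j has_real_derivative - g' j t) (at t)" for t
    using herm_gauss_deriv[of "count_list js j" t] unfolding g_def g'_def by simp
  have gi: "g' i = g i" if "i \<noteq> j" for i using that by (auto simp: g_def g'_def fun_eq_iff)
  have rem: "(\<Prod>i\<in>UNIV. h i) = h j * (\<Prod>i\<in>UNIV - {j}. h i)" for h :: "'n \<Rightarrow> real"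
    by (simp add: prod.remove)
  have "partial_deriv j (\<lambda>x. (-1) ^ length js * (\<Prod>i\<in>UNIV. g i (x $ i))) x =
      (-1) ^ length (j # js) * (\<Prod>i\<in>UNIV. g' i (x $ i))" for x :: "real^'n"
    unfolding partial_deriv_def
  proof (rule vector_derivative_at)
    define P where "P = (\<Prod>i\<in>UNIV - {j}. g i (x $ i))"
    have "(\<Prod>i\<in>UNIV - {j}. g i ((x + t *\<^sub>R axis j 1) $ i)) = P" for t
      unfolding P_def by (intro prod.cong) (auto simp: axis_def)
    then have 1: "(\<Prod>i\<in>UNIV. g i ((x + t *\<^sub>R axis j 1) $ i)) = g j (x $ j + t) * P" for t
      by (subst rem) (simp add: axis_def)
    have 2: "(\<Prod>i\<in>UNIV. g' i (x $ i)) = g' j (x $ j) * P"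
      unfolding rem[of "\<lambda>i. g' i (x $ i)"] P_def using gi by simp
    have "((\<lambda>t. g j (x $ j + t)) has_real_derivative - g' j (x $ j)) (at 0)"
      using gj[of "x $ j"] DERIV_shift[of "g j" "- g' j (x $ j)" 0 "x $ j"] by (simp add: add.commute)
    then have "((\<lambda>t. (-1) ^ length js * (g j (x $ j + t) * P)) has_real_derivative
        (-1) ^ length js * (- g' j (x $ j) * P)) (at 0)"
      by (intro DERIV_cmult DERIV_cmult_right)
    then show "((\<lambda>t. (-1) ^ length js * (\<Prod>i\<in>UNIV. g i ((x + t *\<^sub>R axis j 1) $ i))) has_vector_derivative
        (-1) ^ length (j # js) * (\<Prod>i\<in>UNIV. g' i (x $ i))) (at 0)"
      unfolding 1 2 has_real_derivative_iff_has_vector_derivative[symmetric] by simp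
  qed
  then have "partial_deriv j (iter_partial js (\<lambda>y::real^'n. exp (- (norm y)\<^sup>2))) x =
      (-1) ^ length (j # js) * (\<Prod>i\<in>UNIV. g' i (x $ i))" for x
    unfolding Cons.IH g_def .
  then show ?case by (simp add: iter_partial_def g'_def fun_eq_iff)
qed

definition hermite_norm :: "nat ^ 'n \<Rightarrow> real" where
  "hermite_norm \<alpha> = pi powr (- real CARD('n) / 4) * (2 ^ mi_size \<alpha> * mi_fact \<alpha>) powr (- 1 / 2)"

definition hermite_prod :: "nat ^ 'n \<Rightarrow> real ^ 'n \<Rightarrow> real" where
  "hermite_prod \<alpha> x = (\<Prod>i\<in>UNIV. herm (\<alpha> $ i) (x $ i))"

text \<open>The sign (-1)^|\<alpha>| of the definition cancels the one produced by
  differentiation.\<close>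

lemma hermite_fun_eq:
  fixes x :: "real^'n"
  shows "hermite_fun \<alpha> x = hermite_norm \<alpha> * hermite_prod \<alpha> x * exp (- (norm x)\<^sup>2 / 2)"
proof -
  define js where "js = (SOME js. \<forall>i. count_list js i = \<alpha> $ i)"
  have js: "count_list js i = \<alpha> $ i" for i
    using someI_ex[OF ex_list_of_multi_index[of \<alpha>]] unfolding js_def by blast
  then have len: "length js = mi_size \<alpha>" by (simp add: length_eq_sum_count mi_size_def)
  have "mi_deriv \<alpha> (\<lambda>y. exp (- (norm y)\<^sup>2)) x = (-1) ^ mi_size \<alpha> * (hermite_prod \<alpha> x * exp (- (norm x)\<^sup>2))"
    unfolding mi_deriv_def js_def[symmetric] iter_partial_gauss len js hermite_prod_def
    by (simp add: prod.distrib norm_vec_sq exp_sum flip: sum_negf)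
  then have "hermite_fun \<alpha> x = hermite_norm \<alpha> * ((-1) ^ mi_size \<alpha> * (-1) ^ mi_size \<alpha>) * hermite_prod \<alpha> x * (exp ((norm x)\<^sup>2 / 2) * exp (- (norm x)\<^sup>2))"
    unfolding hermite_fun_def hermite_norm_def by (simp only: mult_ac)
  also have "exp ((norm x)\<^sup>2 / 2) * exp (- (norm x)\<^sup>2) = exp (- (norm x)\<^sup>2 / 2)"
    by (simp add: exp_add[symmetric])
  also have "(-1) ^ mi_size \<alpha> * (-1) ^ mi_size \<alpha> = (1::real)" by (simp add: power_mult_distrib[symmetric])
  finally show ?thesis by simp
qed

lemma real_polynomial_function_vec_nth: "real_polynomial_function (\<lambda>x::real^'n. x $ i)"
  by (intro real_polynomial_function.intros(1) bounded_linear_vec_nth)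

lemma real_polynomial_function_hermite_prod: "real_polynomial_function (hermite_prod \<alpha>)"
  unfolding hermite_prod_def
  by (intro real_polynomial_function_prod real_polynomial_function_herm real_polynomial_function_vec_nth) auto

lemma norm_exp_mult_real_le: "norm (exp (z * cpx t)) \<le> exp ((Re z)\<^sup>2 + t\<^sup>2 / 4)"
proof -
  have "0 \<le> (Re z - t / 2)\<^sup>2" by simp
  then have "Re z * t \<le> (Re z)\<^sup>2 + t\<^sup>2 / 4" by (simp add: power2_diff power_divide)
  then show ?thesis by (simp add: norm_exp_eq_Re)
qed

text \<open>The substitution t = Re z / 2 + u / sqrt 2 completes the square in the real part of z.
  What remains is the Fourier transform of a Gaussian, known as the characteristic function of the
  normal distribution, so no contour has to be shifted.\<close>

lemma gauss_fourier_laplace: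
  "(LINT t|lborel. cpx (exp (- t\<^sup>2)) * exp (z * cpx t)) = cpx (sqrt pi) * exp (z\<^sup>2 / 4)"
proof -
  let ?E = "\<lambda>s u. cpx (exp (- u\<^sup>2 / 2)) * exp (\<i> * cpx (s * u))"
  define a b where "a = Re z" and "b = Im z"
  have z: "z = Complex a b" by (simp add: a_def b_def)
  have c: "(LINT u|lborel. ?E s u) = cpx (sqrt (2 * pi) * exp (- s\<^sup>2 / 2))" for s
  proof -
    have "cpx (exp (- (s^2) / 2)) = char std_normal_distribution s"
      by (simp add: char_std_normal_distribution)
    also have "\<dots> = (LINT u|lborel. std_normal_density u *\<^sub>R exp (\<i> * cpx (s * u)))"
      unfolding char_def by (subst integral_density) (auto simp: )
    also have "\<dots> = (LINT u|lborel. cpx (1 / sqrt (2 * pi)) * (?E s u))"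
      by (intro Bochner_Integration.integral_cong) (auto simp: std_normal_density_def scaleR_conv_of_real)
    also have "\<dots> = cpx (1 / sqrt (2 * pi)) * (LINT u|lborel. (?E s u))"
      by (rule integral_mult_right_zero)
    finally have "cpx (sqrt (2 * pi)) * cpx (exp (- (s^2) / 2)) = (cpx (sqrt (2 * pi)) * cpx (1 / sqrt (2 * pi))) * (LINT u|lborel. (?E s u))"
      by (simp only: mult_ac)
    also have "cpx (sqrt (2 * pi)) * cpx (1 / sqrt (2 * pi)) = 1"
      unfolding of_real_mult[symmetric] by simp
    finally show ?thesis by simp
  qed
  have "(LINT t|lborel. cpx (exp (- t\<^sup>2)) * exp (z * cpx t)) =
     \<bar>1 / sqrt 2\<bar> *\<^sub>R (LINT u|lborel. cpx (exp (- (a/2 + 1/sqrt 2 * u)\<^sup>2)) * exp (z * cpx (a/2 + 1/sqrt 2 * u)))"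
    by (rule lborel_integral_real_affine) simp
  also have "(\<lambda>u. cpx (exp (- (a/2 + 1/sqrt 2 * u)\<^sup>2)) * exp (z * cpx (a/2 + 1/sqrt 2 * u))) =
     (\<lambda>u. exp (Complex (a\<^sup>2/4) (a * b / 2)) * (cpx (exp (- u\<^sup>2 / 2)) * exp (\<i> * cpx (b / sqrt 2 * u))))"
  proof
    fix u :: real
    have "cpx (- (a/2 + 1/sqrt 2 * u)\<^sup>2) + z * cpx (a/2 + 1/sqrt 2 * u) = 
      Complex (a\<^sup>2/4) (a * b / 2) + (cpx (- u\<^sup>2 / 2) + \<i> * cpx (b / sqrt 2 * u))"
      by (simp add: z complex_eq_iff power2_eq_square field_simps)
    then show "cpx (exp (- (a/2 + 1/sqrt 2 * u)\<^sup>2)) * exp (z * cpx (a/2 + 1/sqrt 2 * u)) =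
       exp (Complex (a\<^sup>2/4) (a * b / 2)) * (cpx (exp (- u\<^sup>2 / 2)) * exp (\<i> * cpx (b / sqrt 2 * u)))"
      unfolding exp_of_real[symmetric] exp_add[symmetric] by simp
  qed
  also have "\<bar>1 / sqrt 2\<bar> *\<^sub>R (LINT u|lborel. exp (Complex (a\<^sup>2/4) (a * b / 2)) * (cpx (exp (- u\<^sup>2 / 2)) * exp (\<i> * cpx (b / sqrt 2 * u))))
     = cpx (1 / sqrt 2) * (exp (Complex (a\<^sup>2/4) (a * b / 2)) * cpx (sqrt (2 * pi) * exp (- (b / sqrt 2)\<^sup>2 / 2)))"
    unfolding integral_mult_right_zero c by (simp add: scaleR_conv_of_real)
  also have "\<dots> = cpx (1 / sqrt 2 * sqrt (2 * pi)) * (exp (Complex (a\<^sup>2/4) (a * b / 2)) * exp (cpx (- (b / sqrt 2)\<^sup>2 / 2)))"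
    by (simp only: exp_of_real of_real_mult mult_ac)
  also have "\<dots> = cpx (sqrt pi) * exp (z\<^sup>2 / 4)"
  proof -
    have "1 / sqrt 2 * sqrt (2 * pi) = sqrt pi" by (simp add: real_sqrt_mult)
    moreover have "Complex (a\<^sup>2/4) (a * b / 2) + cpx (- (b / sqrt 2)\<^sup>2 / 2) = z\<^sup>2 / 4"
      by (simp add: z complex_eq_iff power2_eq_square field_simps)
    ultimately show ?thesis by (simp only: exp_add[symmetric])
  qed
  finally show ?thesis .
qed

lemma herm_gauss_exp_bound:
  "\<exists>C. \<forall>t. norm (cpx (herm n t * exp (- t\<^sup>2)) * exp (z * cpx t)) \<le> C * exp (- (1/2) * t\<^sup>2)"
proof -
  \<comment> \<open>A quarter of the decay exp(- t^2) pays for the polynomial and another quarter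
    for the exponential; exp(- t^2/2) is left.\<close>
  obtain C where C: "C > 0" "\<And>t. \<bar>herm n t\<bar> \<le> C * exp (1/4 * t\<^sup>2)"
    using real_polynomial_function_exp_bound[OF real_polynomial_function_herm[OF real_polynomial_function.intros(1)[OF bounded_linear_ident]], of "1/4" n]
    by auto
  have "norm (cpx (herm n t * exp (- t\<^sup>2)) * exp (z * cpx t)) \<le> (C * exp ((Re z)\<^sup>2)) * exp (- (1/2) * t\<^sup>2)" for t
  proof -
    have "norm (cpx (herm n t * exp (- t\<^sup>2)) * exp (z * cpx t)) \<le>
       (C * exp (1/4 * t\<^sup>2) * exp (- t\<^sup>2)) * exp ((Re z)\<^sup>2 + t\<^sup>2 / 4)"
      unfolding norm_mult norm_of_real abs_mult
      by (intro mult_mono norm_exp_mult_real_le C) (use C in auto)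
    also have "\<dots> = C * (exp (1/4 * t\<^sup>2 + (- t\<^sup>2) + ((Re z)\<^sup>2 + t\<^sup>2 / 4)))"
      by (simp only: exp_add mult_ac)
    also have "\<dots> = C * exp ((Re z)\<^sup>2 + (- (1/2) * t\<^sup>2))" by simp
    finally show ?thesis by (simp only: exp_add mult_ac)
  qed
  then show ?thesis by blast
qed

lemma integrable_herm_gauss_exp:
  "integrable lborel (\<lambda>t. cpx (herm n t * exp (- t\<^sup>2)) * exp (z * cpx t))"
proof -
  obtain C where C: "\<And>t. norm (cpx (herm n t * exp (- t\<^sup>2)) * exp (z * cpx t)) \<le> C * exp (- (1/2) * t\<^sup>2)"
    using herm_gauss_exp_bound by blast
  have "integrable lborel (\<lambda>t::real. C * exp (- (1/2) * t\<^sup>2))"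
    by (intro integrable_mult_right integrable_gaussian_real) simp
  then show ?thesis
  proof (rule Bochner_Integration.integrable_bound, goal_cases)
    case 1 show ?case by measurable
  next
    case 2 
    have "norm (cpx (herm n t * exp (- t\<^sup>2)) * exp (z * cpx t)) \<le> norm (C * exp (- (1/2) * t\<^sup>2))" for t
      using C[of t] unfolding real_norm_def by (rule order_trans[OF _ abs_ge_self])
    then show ?case by simp
  qed
qed

text \<open>Integration by parts: \<open>F n\<close> has derivative z * \<open>F n\<close> -
  \<open>F (Suc n)\<close> and vanishes at both ends of the line, so raising the degree multiplies
  the integral by z.\<close>

lemma herm_bargmann:
  "(LINT t|lborel. cpx (herm n t * exp (- t\<^sup>2)) * exp (z * cpx t)) =
    z ^ n * (cpx (sqrt pi) * exp (z\<^sup>2 / 4))"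
proof (induction n)
  case 0
  show ?case using gauss_fourier_laplace[of z] by simp
next
  case (Suc n)
  define F where "F n t = cpx (herm n t * exp (- t\<^sup>2)) * exp (z * cpx t)" for n t
  have int: "integrable lborel (F n)" for n unfolding F_def[abs_def] by (rule integrable_herm_gauss_exp)
  define f where "f t = z * F n t - F (Suc n) t" for t
  have intf: "integrable lborel f" unfolding f_def[abs_def] using int by auto
  have der: "(F n has_vector_derivative f t) (at t)" for t
  proof -
    have 1: "((\<lambda>t. cpx (herm n t * exp (- t\<^sup>2))) has_vector_derivative cpx (- (herm (Suc n) t * exp (- t\<^sup>2)))) (at t)"
      using herm_gauss_deriv[of n t] by (rule has_vector_derivative_of_real[unfolded has_real_derivative_iff_has_vector_derivative[symmetric]])
    have 2: "((\<lambda>t. exp (z * cpx t)) has_vector_derivative z * exp (z * cpx t)) (at t)"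
    proof -
      have "((\<lambda>w. exp (z * w)) has_field_derivative z * exp (z * cpx t)) (at (cpx t))"
        by (auto intro!: derivative_eq_intros)
      from has_vector_derivative_real_field[OF this] show ?thesis .
    qed
    from has_vector_derivative_mult[OF 1 2] show ?thesis
      unfolding F_def[abs_def] f_def by (simp add: F_def algebra_simps)
  qed
  \<comment> \<open>Both ends of the line are treated at once, because the decay only uses that t^2
    tends to infinity.\<close>
  have lim0: "(F n \<longlongrightarrow> 0) G" if G: "filterlim (\<lambda>t::real. t\<^sup>2) at_top G" for G
  proof -
    obtain C where C: "\<And>t. norm (F n t) \<le> C * exp (- (1/2) * t\<^sup>2)"
      using herm_gauss_exp_bound unfolding F_def by blast
    have "filterlim (\<lambda>t::real. - ((1/2) * t\<^sup>2)) at_bot G"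
      unfolding filterlim_uminus_at_bot minus_minus using G by (intro filterlim_tendsto_pos_mult_at_top[OF tendsto_const]) auto
    then have "((\<lambda>t. exp (- ((1/2) * t\<^sup>2))) \<longlongrightarrow> 0) G"
      by (rule filterlim_compose[OF exp_at_bot])
    then have "((\<lambda>t. C * exp (- (1/2) * t\<^sup>2)) \<longlongrightarrow> 0) G"
      using tendsto_mult_right_zero by fastforce
    then show ?thesis by (rule Lim_null_comparison[rotated]) (use C in auto)
  qed
  have top: "(F n \<longlongrightarrow> 0) at_top" by (rule lim0) (simp add: filterlim_pow_at_top filterlim_ident)
  have bot: "(F n \<longlongrightarrow> 0) at_bot"
    by (rule lim0) (auto intro!: filterlim_pow_at_bot_even filterlim_ident)
  have "(LBINT t=-\<infinity>..\<infinity>. f t) = 0 - 0"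
  proof (rule interval_integral_FTC_integrable)
    show "(F n has_vector_derivative f x) (at x)" for x by (rule der)
    show "isCont f x" for x unfolding f_def F_def
      by (rule continuous_on_interior[of UNIV]) (auto intro!: continuous_intros)
    show "set_integrable lborel (einterval (- \<infinity>) \<infinity>) f"
      using intf by (simp add: set_integrable_def einterval_def)
    show "((F n \<circ> real_of_ereal) \<longlongrightarrow> 0) (at_right (- \<infinity>))" using bot by (simp add: ereal_tendsto_simps)
    show "((F n \<circ> real_of_ereal) \<longlongrightarrow> 0) (at_left \<infinity>)" using top by (simp add: ereal_tendsto_simps)
  qed simp
  then have "(LINT t|lborel. f t) = 0"
    by (simp add: interval_lebesgue_integral_def einterval_def set_lebesgue_integral_def)
  then have "(LINT t|lborel. F (Suc n) t) = z * (LINT t|lborel. F n t)"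
    unfolding f_def using int by simp
  then show ?case using Suc unfolding F_def by simp
qed

text \<open>Integrand of the Bargmann transform of a Hermite function, up to scaling of z and
  factors that depend on z alone.\<close>

definition hermite_gauss :: "nat ^ 'n \<Rightarrow> complex ^ 'n \<Rightarrow> real ^ 'n \<Rightarrow> complex" where
  "hermite_gauss \<alpha> z x = cpx (hermite_prod \<alpha> x * exp (- (norm x)\<^sup>2)) * exp (\<Sum>i\<in>UNIV. z $ i * cpx (x $ i))"

lemma
  fixes z :: "complex ^ 'n"
  shows integrable_hermite_gauss: "integrable lborel (hermite_gauss \<alpha> z)"
    and integral_hermite_gauss: "(LINT x|lborel. hermite_gauss \<alpha> z x) =
       mi_power z \<alpha> * cpx (pi powr (real CARD('n) / 2)) * exp ((\<Sum>i\<in>UNIV. (z $ i)\<^sup>2) / 4)"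
proof -
  define f where "f i t = cpx (herm (\<alpha> $ i) t * exp (- t\<^sup>2)) * exp (z $ i * cpx t)" for i t
  have eq: "hermite_gauss \<alpha> z = (\<lambda>x. \<Prod>i\<in>UNIV. f i (x $ i))"
    unfolding hermite_gauss_def f_def hermite_prod_def
    by (simp add: prod.distrib norm_vec_sq exp_sum fun_eq_iff flip: sum_negf)
  have int: "integrable lborel (f i)" for i unfolding f_def by (rule integrable_herm_gauss_exp)
  show "integrable lborel (hermite_gauss \<alpha> z)" unfolding eq using int by (rule integrable_prod_vec)
  have "sqrt pi = pi powr (1/2)" by (simp add: powr_half_sqrt)
  then have "sqrt pi ^ CARD('n) = pi powr (real CARD('n) / 2)"
    by (simp add: powr_power)
  then show "(LINT x|lborel. hermite_gauss \<alpha> z x) =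
       mi_power z \<alpha> * cpx (pi powr (real CARD('n) / 2)) * exp ((\<Sum>i\<in>UNIV. (z $ i)\<^sup>2) / 4)"
    unfolding eq integral_prod_vec[OF int] 
    unfolding f_def herm_bargmann mi_power_def
    by (simp add: prod.distrib sum_divide_distrib exp_sum flip: of_real_power)
qed

section \<open>Completeness of the Hermite functions\<close>

lemma integrable_norm_le:
  fixes f :: "'a \<Rightarrow> 'b::{banach, second_countable_topology}" and g :: "'a \<Rightarrow> real"
  assumes "integrable M g" "f \<in> borel_measurable M" "\<And>x. norm (f x) \<le> g x"
  shows "integrable M f"
  using assms(1,2)
  by (rule Bochner_Integration.integrable_bound) (use assms(3) in \<open>auto intro!: AE_I2 intro: order_trans[OF _ abs_ge_self]\<close>)

lemma measurable_hermite_prod [measurable]: "hermite_prod \<alpha> \<in> borel_measurable borel"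
  unfolding hermite_prod_def by measurable

lemma measurable_real_polynomial_function:
  "real_polynomial_function (p :: 'a::euclidean_space \<Rightarrow> real) \<Longrightarrow> p \<in> borel_measurable borel"
  using continuous_polymonial_function[of p] 
  by (intro borel_measurable_continuous_onI continuous_at_imp_continuous_on) (simp add: real_polynomial_function_eq)

text \<open>The inequality 2ab \<le> a^2 + b^2 takes the place of Cauchy-Schwarz and yields an
  explicit integrable majorant.\<close>

lemma integrable_L2_mult_gauss:
  fixes D :: "real^'n \<Rightarrow> complex" and h :: "real^'n \<Rightarrow> complex"
  assumes [measurable]: "D \<in> borel_measurable lborel" "h \<in> borel_measurable lborel"
    and D: "integrable lborel (\<lambda>x. (norm (D x))\<^sup>2)"
    and a: "0 < a" and h: "\<And>x. norm (h x) \<le> C * gauss a x"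
  shows "integrable lborel (\<lambda>x. D x * h x)"
proof -
  have int: "integrable lborel (\<lambda>x. (norm (D x))\<^sup>2 + C\<^sup>2 * gauss (2 * a) x)"
    using D a by (intro Bochner_Integration.integrable_add integrable_mult_right integrable_gaussian) auto
  show ?thesis
  proof (rule integrable_norm_le[OF int])
    fix x
    have "(norm (h x))\<^sup>2 \<le> (C * gauss a x)\<^sup>2" using h[of x] by (intro power_mono) auto
    also have "\<dots> = C\<^sup>2 * gauss (2 * a) x" by (simp add: power_mult_distrib exp_double[symmetric])
    finally have 1: "(norm (h x))\<^sup>2 \<le> C\<^sup>2 * gauss (2 * a) x" .
    have 0: "norm (D x) * norm (h x) \<ge> 0" by simp
    have "0 \<le> (norm (D x) - norm (h x))\<^sup>2" by simp
    then have "norm (D x) * norm (h x) * 2 \<le> (norm (D x))\<^sup>2 + (norm (h x))\<^sup>2" by (simp add: power2_diff)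
    with 0 1 show "norm (D x * h x) \<le> (norm (D x))\<^sup>2 + C\<^sup>2 * gauss (2 * a) x"
      unfolding norm_mult by linarith
  qed measurable
qed

lemma real_polynomial_gauss_bound:
  fixes p :: "'a::real_normed_vector \<Rightarrow> real"
  assumes "real_polynomial_function p" "\<epsilon> < a"
  shows "\<exists>C. \<forall>x. norm (cpx (p x * gauss a x)) \<le> C * gauss \<epsilon> x"
proof -
  obtain C where C: "\<And>x. \<bar>p x\<bar> \<le> C * exp ((a - \<epsilon>) * (norm x)\<^sup>2)"
    using real_polynomial_function_exp_bound[OF assms(1), of "a - \<epsilon>"] assms(2) by auto
  have "norm (cpx (p x * gauss a x)) \<le> C * gauss \<epsilon> x" for x
  proof -
    have "norm (cpx (p x * gauss a x)) \<le> C * exp ((a - \<epsilon>) * (norm x)\<^sup>2) * gauss a x"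
      unfolding norm_of_real abs_mult abs_exp_cancel by (intro mult_right_mono C) simp
    also have "\<dots> = C * gauss \<epsilon> x" by (simp add: exp_add[symmetric] algebra_simps)
    finally show ?thesis .
  qed
  then show ?thesis by blast
qed

text \<open>The linear span as an inductive predicate on functions, so that the vanishing of
  integrals propagates by rule induction.\<close>

inductive hermite_span :: "(real^'n \<Rightarrow> real) \<Rightarrow> bool" where
  base: "hermite_span (hermite_prod \<alpha>)"
| scale: "hermite_span q \<Longrightarrow> hermite_span (\<lambda>x. c * q x)"
| plus: "hermite_span q \<Longrightarrow> hermite_span r \<Longrightarrow> hermite_span (\<lambda>x. q x + r x)"

text \<open>The three-term recurrence in the i-th variable, solved for the product with that
  variable. If \<open>\<alpha> $ i = 0\<close>, the truncated \<open>\<alpha> - axis i 1\<close> is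
  multiplied by 0.\<close>

lemma hermite_prod_recurrence:
  "x $ i * hermite_prod \<alpha> x = 1/2 * hermite_prod (\<alpha> + axis i 1) x + real (\<alpha> $ i) * hermite_prod (\<alpha> - axis i 1) x"
proof -
  define P where "P = (\<Prod>j\<in>UNIV - {i}. herm (\<alpha> $ j) (x $ j))"
  have rem: "hermite_prod \<beta> x = herm (\<beta> $ i) (x $ i) * P" if "\<And>j. j \<noteq> i \<Longrightarrow> \<beta> $ j = \<alpha> $ j" for \<beta>
    unfolding hermite_prod_def P_def using that by (subst prod.remove[of _ i]) auto
  have 1: "hermite_prod \<alpha> x = herm (\<alpha> $ i) (x $ i) * P" by (rule rem) simp
  have 2: "hermite_prod (\<alpha> + axis i 1) x = herm (Suc (\<alpha> $ i)) (x $ i) * P"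
    by (subst rem) (auto simp: axis_def)
  have 3: "hermite_prod (\<alpha> - axis i 1) x = herm (\<alpha> $ i - 1) (x $ i) * P"
    by (subst rem) (auto simp: axis_def)
  show ?thesis unfolding 1 2 3 herm_Suc by (simp add: algebra_simps)
qed

lemma hermite_span_vec_nth: "hermite_span q \<Longrightarrow> hermite_span (\<lambda>x. x $ i * q x)"
proof (induction rule: hermite_span.induct)
  case (base \<alpha>)
  show ?case unfolding hermite_prod_recurrence by (intro hermite_span.intros)
next
  case (scale q c)
  then have "hermite_span (\<lambda>x. c * (x $ i * q x))" by (intro hermite_span.intros)
  then show ?case by (simp only: mult_ac)
next
  case (plus q r)
  then show ?case unfolding distrib_left by (intro hermite_span.intros)
qed

lemma hermite_span_zero: "hermite_span (\<lambda>x. 0)"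
  using hermite_span.scale[OF hermite_span.base, of 0] by simp

lemma hermite_span_sum:
  "finite I \<Longrightarrow> (\<And>i. i \<in> I \<Longrightarrow> hermite_span (q i)) \<Longrightarrow> hermite_span (\<lambda>x. \<Sum>i\<in>I. q i x)"
  by (induction I rule: finite_induct) (auto intro: hermite_span_zero hermite_span.plus)

text \<open>With an arbitrary member q of the span as second factor, the multiplicative case is the
  composition of two induction hypotheses. A linear functional reduces to multiplications by
  coordinates.\<close>

lemma hermite_span_polynomial_mult:
  fixes p :: "real^'n \<Rightarrow> real"
  shows "real_polynomial_function p \<Longrightarrow> hermite_span q \<Longrightarrow> hermite_span (\<lambda>x. p x * q x)"
proof (induction arbitrary: q rule: real_polynomial_function.induct)
  case (linear f)
  interpret f: bounded_linear f by (rule linear)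
  have f: "f x = (\<Sum>i\<in>UNIV. x $ i * f (axis i 1))" for x
  proof -
    have "x = (\<Sum>i\<in>UNIV. (x $ i) *\<^sub>R axis i 1)"
      using basis_expansion[of x] by (simp only: scalar_mult_eq_scaleR)
    then have "f x = f (\<Sum>i\<in>UNIV. (x $ i) *\<^sub>R axis i 1)" by (rule arg_cong)
    also have "\<dots> = (\<Sum>i\<in>UNIV. x $ i * f (axis i 1))" by (simp add: f.sum f.scaleR)
    finally show ?thesis .
  qed
  have "f x * q x = (\<Sum>i\<in>UNIV. f (axis i 1) * (x $ i * q x))" for x
    unfolding f[of x] sum_distrib_right by (simp only: mult_ac)
  then show ?case using linear
    by (auto intro!: hermite_span_sum hermite_span.scale hermite_span_vec_nth)
next
  case (const c)
  then show ?case by (intro hermite_span.scale)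
next
  case (add f g)
  then show ?case unfolding distrib_right by (intro hermite_span.plus)
next
  case (mult f g)
  then have "hermite_span (\<lambda>x. f x * (g x * q x))" by blast
  then show ?case by (simp only: mult_ac)
qed

lemma hermite_span_polynomial:
  fixes p :: "real^'n \<Rightarrow> real"
  assumes "real_polynomial_function p" shows "hermite_span p"
proof -
  have "hermite_prod (0::nat^'n) = (\<lambda>x. 1)" by (auto simp: hermite_prod_def fun_eq_iff)
  then show ?thesis using hermite_span_polynomial_mult[OF assms hermite_span.base[of 0]] by simp
qed

lemma real_polynomial_hermite_span: "hermite_span q \<Longrightarrow> real_polynomial_function q"
proof (induction rule: hermite_span.induct)
  case (base \<alpha>) show ?case by (rule real_polynomial_function_hermite_prod)
next
  case (scale q c) then show ?case by (intro real_polynomial_function.intros(2,4))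
next
  case (plus q r) then show ?case by (intro real_polynomial_function.intros(3))
qed

text \<open>Quantifying over all polynomials p allows Taylor polynomials of an exponential to be
  absorbed into p.\<close>

definition vanish :: "(real^'n \<Rightarrow> complex) \<Rightarrow> real \<Rightarrow> bool" where
  "vanish D a \<longleftrightarrow> (\<forall>p. real_polynomial_function p \<longrightarrow>
     (LINT x|lborel. D x * cpx (p x * gauss a x)) = 0)"

lemma integrable_L2_polynomial_gauss:
  fixes D :: "real^'n \<Rightarrow> complex"
  assumes "D \<in> borel_measurable lborel" "integrable lborel (\<lambda>x. (norm (D x))\<^sup>2)"
    and "0 < a" "real_polynomial_function p"
  shows "integrable lborel (\<lambda>x. D x * cpx (p x * gauss a x))"
proof -
  have [measurable]: "p \<in> borel_measurable borel" using assms by (simp add: measurable_real_polynomial_function)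
  obtain C where "\<forall>x. norm (cpx (p x * gauss a x)) \<le> C * gauss (a/2) x"
    using real_polynomial_gauss_bound[OF assms(4), of "a/2" a] assms(3) by auto
  then show ?thesis using assms(1,2,3) by (intro integrable_L2_mult_gauss[of _ _ "a/2" C]) auto
qed

text \<open>The parameter 1/2 is that of the Gaussian inside the Hermite functions; the claim
  spreads from the Hermite polynomials to their span, which contains every polynomial.\<close>

lemma vanish_half:
  fixes D :: "real^'n \<Rightarrow> complex"
  assumes D: "D \<in> borel_measurable lborel" "integrable lborel (\<lambda>x. (norm (D x))\<^sup>2)"
    and h: "\<And>\<alpha>. (LINT x|lborel. D x * cpx (hermite_fun \<alpha> x)) = 0"
  shows "vanish D (1/2)"
  unfolding vanish_def
proof (intro allI impI)
  fix p :: "real^'n \<Rightarrow> real" assume "real_polynomial_function p"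
  then have "hermite_span p" by (rule hermite_span_polynomial)
  then show "(LINT x|lborel. D x * cpx (p x * gauss (1/2) x)) = 0"
  proof (induction rule: hermite_span.induct)
    case (base \<alpha>)
    have pos: "hermite_norm \<alpha> \<noteq> 0" by (auto simp: hermite_norm_def mi_fact_def)
    have "(LINT x|lborel. D x * cpx (hermite_fun \<alpha> x)) = (LINT x|lborel. cpx (hermite_norm \<alpha>) * (D x * cpx (hermite_prod \<alpha> x * gauss (1/2) x)))"
      by (intro Bochner_Integration.integral_cong) (simp_all add: hermite_fun_eq)
    also have "\<dots> = cpx (hermite_norm \<alpha>) * (LINT x|lborel. D x * cpx (hermite_prod \<alpha> x * gauss (1/2) x))"
      by (rule integral_mult_right_zero)
    finally show ?case using h pos by simp
  next
    case (scale q c)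
    have "(LINT x|lborel. D x * cpx (c * q x * gauss (1/2) x)) =
       (LINT x|lborel. cpx c * (D x * cpx (q x * gauss (1/2) x)))"
      by (intro Bochner_Integration.integral_cong) simp_all
    also have "\<dots> = 0" unfolding integral_mult_right_zero scale by simp
    finally show ?case .
  next
    case (plus q r)
    have 1: "integrable lborel (\<lambda>x. D x * cpx (q x * gauss (1/2) x))"
      by (intro integrable_L2_polynomial_gauss D real_polynomial_hermite_span plus) simp
    have 2: "integrable lborel (\<lambda>x. D x * cpx (r x * gauss (1/2) x))"
      by (intro integrable_L2_polynomial_gauss D real_polynomial_hermite_span plus) simp
    have "(LINT x|lborel. D x * cpx ((q x + r x) * gauss (1/2) x)) =
       (LINT x|lborel. D x * cpx (q x * gauss (1/2) x) + D x * cpx (r x * gauss (1/2) x))"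
      by (intro Bochner_Integration.integral_cong) (simp_all add: algebra_simps)
    also have "\<dots> = 0" using 1 2 plus by (subst Bochner_Integration.integral_add) auto
    finally show ?case .
  qed
qed

text \<open>Expand \<open>exp q\<close> and integrate term by term. Iterated with \<open>q x = - (a / 2) * |x|\<^sup>2\<close>, this
  makes the Gaussian factor as narrow as desired without ever leaving the range where the
  exponential series is dominated by an integrable function.\<close>

lemma vanish_exp:
  fixes D :: "real^'n \<Rightarrow> complex"
  assumes D: "D \<in> borel_measurable lborel" "integrable lborel (\<lambda>x. (norm (D x))\<^sup>2)"
    and v: "vanish D a" and \<delta>: "0 \<le> \<delta>" "\<delta> < a"
    and p: "real_polynomial_function p" and q: "real_polynomial_function q"
    and qb: "\<And>x. \<bar>q x\<bar> \<le> \<delta> * (norm x)\<^sup>2 + C"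
  shows "(LINT x|lborel. D x * cpx (p x * exp (- a * (norm x)\<^sup>2 + q x))) = 0"
proof -
  note [measurable] = D(1) measurable_real_polynomial_function[OF p] measurable_real_polynomial_function[OF q]
  define s where "s n x = (\<Sum>k<n. q x ^ k / fact k)" for n :: nat and x
  have sp: "real_polynomial_function (s n)" for n
    unfolding s_def[abs_def] using q by (auto intro!: real_polynomial_function_sum real_polynomial_function_divide real_polynomial_function_power)
  have sums: "(\<lambda>k. y ^ k / fact k) sums exp y" for y :: real
    using exp_converges[of y] by (simp add: field_simps)
  have lim: "(\<lambda>n. s n x) \<longlonglongrightarrow> exp (q x)" for x
    using sums[of "q x"] unfolding s_def sums_def .
  have sb: "\<bar>s n x\<bar> \<le> exp (\<delta> * (norm x)\<^sup>2 + C)" for n x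
  proof -
    have "\<bar>s n x\<bar> \<le> (\<Sum>k<n. \<bar>q x\<bar> ^ k / fact k)" unfolding s_def
      by (rule order_trans[OF sum_abs]) (simp add: power_abs)
    also have "\<dots> \<le> exp \<bar>q x\<bar>"
      using sums[of "\<bar>q x\<bar>"] by (intro sum_le_suminf[of "\<lambda>k. \<bar>q x\<bar> ^ k / fact k" "{..<n}", unfolded sums_unique[OF sums[of "\<bar>q x\<bar>"], symmetric]]) (auto simp: sums_iff)
    also have "\<dots> \<le> exp (\<delta> * (norm x)\<^sup>2 + C)" using qb[of x] by simp
    finally show ?thesis .
  qed
  \<comment> \<open>Half of the remaining decay a - \<delta> absorbs the polynomial p; the other
    half stays as a Gaussian that makes the majorant \<open>w\<close> integrable.\<close>
  define b where "b = (a - \<delta>) / 2"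
  have b: "0 < b" using \<delta> by (simp add: b_def)
  obtain K where K: "\<And>x. norm (cpx (p x * gauss (a - \<delta>) x)) \<le> K * gauss b x"
    using real_polynomial_gauss_bound[OF p, of b "a - \<delta>"] \<delta> by (auto simp: b_def)
  define w where "w x = norm (D x * cpx (p x * gauss (a - \<delta>) x)) * exp C" for x
  have iw: "integrable lborel w" unfolding w_def
    using integrable_L2_mult_gauss[of D "\<lambda>x. cpx (p x * gauss (a - \<delta>) x)" b K] D b K
    by (intro integrable_mult_left integrable_norm) auto
  have "(\<lambda>n. (LINT x|lborel. D x * cpx ((p x * s n x) * gauss a x))) \<longlonglongrightarrow>
     (LINT x|lborel. D x * cpx (p x * exp (- a * (norm x)\<^sup>2 + q x)))"
  proof (rule integral_dominated_convergence[OF _ _ iw])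
    have "(\<lambda>n. D x * cpx ((p x * s n x) * gauss a x)) \<longlonglongrightarrow> D x * cpx ((p x * exp (q x)) * gauss a x)" for x
      by (intro tendsto_intros lim)
    then have lim2: "\<And>x. (\<lambda>n. D x * cpx ((p x * s n x) * gauss a x)) \<longlonglongrightarrow> D x * cpx ((p x * exp (q x)) * gauss a x)" .
    have eqx: "p x * exp (- a * (norm x)\<^sup>2 + q x) = (p x * exp (q x)) * gauss a x" for x
      unfolding exp_add by (rule trans[OF mult.commute]) (simp only: mult_ac)
    show "AE x in lborel. (\<lambda>n. D x * cpx ((p x * s n x) * gauss a x)) \<longlonglongrightarrow> D x * cpx (p x * exp (- a * (norm x)\<^sup>2 + q x))"
      unfolding eqx by (rule AE_I2) (rule lim2)
    have "norm (D x * cpx (p x * s n x * gauss a x)) \<le> w x" for x n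
    proof -
      have "norm (D x * cpx (p x * s n x * gauss a x)) = (norm (D x) * \<bar>p x\<bar> * gauss a x) * \<bar>s n x\<bar>"
        by (simp add: norm_mult abs_mult mult_ac)
      also have "\<dots> \<le> (norm (D x) * \<bar>p x\<bar> * gauss a x) * exp (\<delta> * (norm x)\<^sup>2 + C)"
        by (intro mult_left_mono sb) auto
      also have "\<dots> = norm (D x) * \<bar>p x\<bar> * (exp (- a * (norm x)\<^sup>2 + \<delta> * (norm x)\<^sup>2) * exp C)"
        by (simp only: exp_add mult_ac)
      also have "\<dots> = w x" by (simp add: w_def norm_mult abs_mult mult_ac algebra_simps)
      finally show ?thesis .
    qed
    then show "AE x in lborel. norm (D x * cpx (p x * s n x * gauss a x)) \<le> w x" for n by simp
    show "(\<lambda>x. D x * cpx (p x * s n x * gauss a x)) \<in> borel_measurable lborel" for n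
      using measurable_real_polynomial_function[OF sp] by measurable
  qed measurable
  moreover have "(LINT x|lborel. D x * cpx ((p x * s n x) * gauss a x)) = 0" for n
    using v real_polynomial_function.intros(4)[OF p sp[of n]] unfolding vanish_def by blast
  ultimately have "(\<lambda>n. 0) \<longlonglongrightarrow> (LINT x|lborel. D x * cpx (p x * exp (- a * (norm x)\<^sup>2 + q x)))"
    by (simp only:)
  from LIMSEQ_unique[OF this tendsto_const] show ?thesis .
qed

lemma real_polynomial_function_norm_sq: "real_polynomial_function (\<lambda>x::real^'n. (norm x)\<^sup>2)"
  unfolding norm_vec_sq 
  by (intro real_polynomial_function_sum real_polynomial_function_power real_polynomial_function_vec_nth) auto

text \<open>The exponent q = - (a/2) |x|^2 is admissible with \<delta> = a/2 < a and turns a into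
  3a/2, hence the ratio 3/2.\<close>

lemma vanish_geometric:
  fixes D :: "real^'n \<Rightarrow> complex"
  assumes D: "D \<in> borel_measurable lborel" "integrable lborel (\<lambda>x. (norm (D x))\<^sup>2)"
    and v: "vanish D (1/2)"
  shows "vanish D ((3/2) ^ k / 2)"
proof (induction k)
  case 0 show ?case using v by simp
next
  case (Suc k)
  define a :: real where "a = (3/2) ^ k / 2"
  have a: "a > 0" by (simp add: a_def)
  have v: "vanish D a" using Suc by (simp add: a_def)
  show ?case unfolding vanish_def
  proof (intro allI impI)
    fix p :: "real^'n \<Rightarrow> real" assume p: "real_polynomial_function p"
    have "(LINT x|lborel. D x * cpx (p x * exp (- a * (norm x)\<^sup>2 + (- (a / 2) * (norm x)\<^sup>2)))) = 0"
    proof (rule vanish_exp[OF D v _ _ p])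
      show "real_polynomial_function (\<lambda>x::real^'n. - (a / 2) * (norm x)\<^sup>2)"
        by (intro real_polynomial_function.intros(2,4) real_polynomial_function_norm_sq)
      show "\<bar>- (a / 2) * (norm x)\<^sup>2\<bar> \<le> (a / 2) * (norm x)\<^sup>2 + 0" for x :: "real^'n" using a by (simp add: abs_mult)
    qed (use a in auto)
    moreover have "- a * (norm x)\<^sup>2 + (- (a / 2) * (norm x)\<^sup>2) = - ((3/2) ^ Suc k / 2) * (norm x)\<^sup>2" for x :: "real^'n"
      by (simp add: a_def algebra_simps)
    ultimately show "(LINT x|lborel. D x * cpx (p x * gauss ((3/2) ^ Suc k / 2) x)) = 0" by (simp only:)
  qed
qed

text \<open>The product of the two Gaussians is exp(- (b + 1/2) |x|^2 + q x) with q affine.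
  Estimating the cross term costs \<delta> = b, and the retained factor exp(- |x|^2/2) keeps b + 1/2
  strictly above it.\<close>

lemma vanish_gauss_translate:
  fixes D :: "real^'n \<Rightarrow> complex"
  assumes D: "D \<in> borel_measurable lborel" "integrable lborel (\<lambda>x. (norm (D x))\<^sup>2)"
    and v: "vanish D (b + 1/2)" and b: "b > 0"
  shows "(LINT x|lborel. D x * cpx (exp (- (norm x)\<^sup>2 / 2) * gauss b (x - u))) = 0"
proof -
  define q where "q x = 2 * b * (x \<bullet> u) - b * (norm u)\<^sup>2" for x :: "real^'n"
  have "(LINT x|lborel. D x * cpx (1 * exp (- (b + 1/2) * (norm x)\<^sup>2 + q x))) = 0"
  proof (rule vanish_exp[OF D v])
    show "real_polynomial_function q" unfolding q_def
      by (intro real_polynomial_function_diff real_polynomial_function.intros(2,4) real_polynomial_function.intros(1)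
         bounded_linear_inner_left)
    show "\<bar>q x\<bar> \<le> b * (norm x)\<^sup>2 + 2 * b * (norm u)\<^sup>2" for x
    proof -
      have 1: "\<bar>x \<bullet> u\<bar> \<le> norm x * norm u" by (rule Cauchy_Schwarz_ineq2)
      have "0 \<le> (norm x - norm u)\<^sup>2" by simp
      then have 2: "2 * (norm x * norm u) \<le> (norm x)\<^sup>2 + (norm u)\<^sup>2" by (simp add: power2_diff)
      have "\<bar>q x\<bar> \<le> b * (2 * \<bar>x \<bullet> u\<bar>) + b * (norm u)\<^sup>2" unfolding q_def
        using b by (intro order_trans[OF abs_triangle_ineq4]) (auto simp: abs_mult)
      also have "\<dots> \<le> b * ((norm x)\<^sup>2 + (norm u)\<^sup>2) + b * (norm u)\<^sup>2"
        using b 1 2 by (intro add_right_mono mult_left_mono) auto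
      finally show ?thesis by (simp add: algebra_simps)
    qed
  qed (use b in \<open>auto intro: real_polynomial_function.intros(2)\<close>)
  moreover have "exp (- (b + 1/2) * (norm x)\<^sup>2 + q x) = exp (- (norm x)\<^sup>2 / 2) * gauss b (x - u)" for x
    unfolding exp_add[symmetric] q_def
    by (simp add: power2_norm_eq_inner inner_diff_left inner_diff_right inner_commute algebra_simps)
  ultimately show ?thesis by simp
qed

section \<open>Narrow Gaussians as an approximate identity\<close>

lemma integral_lborel_affine:
  fixes f :: "real^'n \<Rightarrow> complex"
  assumes [measurable]: "f \<in> borel_measurable borel" and c: "c > 0"
  shows "(LINT u|lborel. f u) = cpx (c ^ CARD('n)) * (LINT v|lborel. f (x + c *\<^sub>R v))"
proof -
  have "(LINT u|lborel. f u) = integral\<^sup>L (density (distr lborel borel (\<lambda>v. x + c *\<^sub>R v)) (\<lambda>_. ennreal (c ^ CARD('n)))) f"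
    using lborel_affine[of c x] c by (simp add: ennreal_power)
  also have "\<dots> = integral\<^sup>L (distr lborel borel (\<lambda>v. x + c *\<^sub>R v)) (\<lambda>u. (c ^ CARD('n)) *\<^sub>R f u)"
    by (rule integral_density) (use c in auto)
  also have "\<dots> = (LINT v|lborel. (c ^ CARD('n)) *\<^sub>R f (x + c *\<^sub>R v))"
    by (rule integral_distr) measurable
  also have "\<dots> = (LINT v|lborel. cpx (c ^ CARD('n)) * f (x + c *\<^sub>R v))"
    unfolding scaleR_conv_of_real[where 'a=complex] ..
  also have "\<dots> = cpx (c ^ CARD('n)) * (LINT v|lborel. f (x + c *\<^sub>R v))"
    by (rule integral_mult_right_zero)
  finally show ?thesis .
qed

lemma integrable_gaussian_translate:
  assumes "0 < b" shows "integrable lborel (\<lambda>u::real^'n. gauss b (x - u))"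
    "(LINT u|lborel. gauss b (x - (u::real^'n))) = (LINT u|lborel. gauss b (u::real^'n))"
proof -
  have l: "(lborel :: (real^'n) measure) = distr lborel borel ((+) x)" by (simp add: lborel_distr_plus)
  have 1: "integrable (distr lborel borel ((+) x)) (\<lambda>u::real^'n. gauss b (x - u))"
    using integrable_gaussian[OF assms] by (subst integrable_distr_eq) auto
  then show "integrable lborel (\<lambda>u::real^'n. gauss b (x - u))" unfolding l[symmetric] .
  have "(LINT u|lborel. gauss b (x - (u::real^'n))) = (LINT u|distr lborel borel ((+) x). gauss b (x - (u::real^'n)))"
    unfolding l[symmetric] ..
  also have "\<dots> = (LINT u|lborel. gauss b (u::real^'n))"
    by (subst integral_distr) auto
  finally show "(LINT u|lborel. gauss b (x - (u::real^'n))) = (LINT u|lborel. gauss b (u::real^'n))" .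
qed

text \<open>Integrate the hypothesis against \<psi>(u) and use Fubini: G is orthogonal to the
  convolution of \<psi> with each Gaussian. After normalisation these convolutions tend to a
  positive multiple of \<psi>, boundedly, so the orthogonality survives the limit.\<close>

lemma integral_gauss_translate_eq_0_imp:
  fixes G \<psi> :: "real^'n \<Rightarrow> complex" and b :: "nat \<Rightarrow> real"
  assumes G: "integrable lborel G" and \<psi>: "continuous_on UNIV \<psi>" "\<And>x. norm (\<psi> x) \<le> M"
    and b: "\<And>k. 0 < b k" "filterlim b at_top sequentially"
    and v: "\<And>k u. (LINT x|lborel. G x * cpx (gauss (b k) (x - u))) = 0"
  shows "(LINT x|lborel. G x * \<psi> x) = 0"
proof -
  let ?P = "\<lambda>k x v. \<psi> (x + (1 / sqrt (b k)) *\<^sub>R v) * cpx (gauss 1 v)"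
  have [measurable]: "G \<in> borel_measurable borel" using G by auto
  have [measurable]: "\<psi> \<in> borel_measurable borel" using \<psi>(1) by (rule borel_measurable_continuous_onI)
  define K where "K = (LINT v|lborel. gauss 1 (v::real^'n))"
  have intK: "integrable lborel (\<lambda>v::real^'n. gauss 1 v)" by (rule integrable_gaussian) simp
  \<comment> \<open>The total mass is a Hermite integral with \<alpha> = 0 and z = 0; its positivity
    lets K be cancelled at the end.\<close>
  have K: "K > 0"
  proof -
    have "hermite_gauss (0::nat^'n) 0 = (\<lambda>x. cpx (gauss 1 x))"
      by (auto simp: hermite_gauss_def hermite_prod_def)
    then have "cpx K = (LINT x|lborel. hermite_gauss (0::nat^'n) 0 x)"
      unfolding K_def by (simp only: integral_complex_of_real)
    also have "\<dots> = cpx (pi powr (real CARD('n) / 2))"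
      unfolding integral_hermite_gauss by (simp add: mi_power_def)
    finally show ?thesis by (simp only: of_real_eq_iff) simp
  qed
  have M: "0 \<le> M" using \<psi>(2)[of 0] norm_ge_zero[of "\<psi> 0"] by linarith
  \<comment> \<open>The convolution after rescaling to a Gaussian of fixed width, so that only the
    argument of \<psi> depends on k.\<close>
  define \<Psi> where "\<Psi> k x = (LINT v|lborel. ?P k x v)" for k x
  have zero: "(LINT x|lborel. G x * \<Psi> k x) = 0" for k
  proof -
    define f where "f x u = G x * (\<psi> u * cpx (gauss (b k) (x - u)))" for x u
    have nf: "norm (f x u) \<le> norm (G x) * M * gauss (b k) (x - u)" for x u
      unfolding f_def norm_mult using \<psi>(2)[of u] by (simp add: mult_left_mono mult_right_mono mult.assoc)
    have mf: "case_prod f \<in> borel_measurable (lborel \<Otimes>\<^sub>M lborel)"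
      unfolding f_def case_prod_beta' by measurable
    have intu: "integrable lborel (f x)" for x
    proof (rule integrable_norm_le)
      show "integrable lborel (\<lambda>u. norm (G x) * M * gauss (b k) (x - u))"
        by (intro integrable_mult_right integrable_gaussian_translate b)
      show "f x \<in> borel_measurable lborel" unfolding f_def by measurable
    qed (rule nf)
    have intf: "integrable (lborel \<Otimes>\<^sub>M lborel) (case_prod f)"
    proof (rule lborel_pair.Fubini_integrable[OF mf])
      show "AE x in lborel. integrable lborel (\<lambda>y. case_prod f (x, y))" using intu by simp
      define C where "C = M * (LINT u|lborel. gauss (b k) (u::real^'n))"
      have "integrable lborel (\<lambda>x. norm (G x) * C)" using G by (intro integrable_mult_left integrable_norm)
      then show "integrable lborel (\<lambda>x. LINT y|lborel. norm (case_prod f (x, y)))"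
      proof (rule integrable_norm_le)
        show "(\<lambda>x. LINT y|lborel. norm (case_prod f (x, y))) \<in> borel_measurable lborel"
          using mf by (intro lborel.borel_measurable_lebesgue_integral) (simp add: case_prod_beta')
        fix x
        have "norm (LINT y|lborel. norm (case_prod f (x, y))) = (LINT y|lborel. norm (f x y))" by simp
        also have "\<dots> \<le> (LINT u|lborel. norm (G x) * M * gauss (b k) (x - u))"
          using nf intu by (intro integral_mono integrable_norm integrable_mult_right integrable_gaussian_translate b) auto
        also have "\<dots> = norm (G x) * C"
          unfolding C_def integrable_gaussian_translate(2)[OF b(1), symmetric, of k x] by simp
        finally show "norm (LINT y|lborel. norm (case_prod f (x, y))) \<le> norm (G x) * C" .
      qed
    qed
    have "(LINT u|lborel. (LINT x|lborel. f x u)) = 0"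
    proof -
      have "(LINT x|lborel. f x u) = \<psi> u * (LINT x|lborel. G x * cpx (gauss (b k) (x - u)))" for u
        unfolding integral_mult_right_zero[symmetric] f_def by (simp add: mult_ac)
      then show ?thesis unfolding v by simp
    qed
    then have "(LINT x|lborel. (LINT u|lborel. f x u)) = 0"
      using lborel_pair.Fubini_integral[OF intf] by simp
    moreover have "(LINT u|lborel. f x u) = cpx ((1 / sqrt (b k)) ^ CARD('n)) * (G x * \<Psi> k x)" for x
    proof -
      have sq: "b k * (norm ((1 / sqrt (b k)) *\<^sub>R v))\<^sup>2 = (norm v)\<^sup>2" for v :: "real^'n"
        using b(1)[of k] by (simp add: power_divide power_mult_distrib)
      have "(LINT u|lborel. f x u) = G x * (LINT u|lborel. \<psi> u * cpx (gauss (b k) (x - u)))"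
        unfolding f_def by (rule integral_mult_right_zero)
      also have "(LINT u|lborel. \<psi> u * cpx (gauss (b k) (x - u))) = 
          cpx ((1 / sqrt (b k)) ^ CARD('n)) * (LINT v|lborel. \<psi> (x + (1 / sqrt (b k)) *\<^sub>R v) * cpx (exp (- b k * (norm (x - (x + (1 / sqrt (b k)) *\<^sub>R v)))\<^sup>2)))"
        using b(1)[of k] by (intro integral_lborel_affine) auto
      also have "(LINT v|lborel. \<psi> (x + (1 / sqrt (b k)) *\<^sub>R v) * cpx (exp (- b k * (norm (x - (x + (1 / sqrt (b k)) *\<^sub>R v)))\<^sup>2))) = \<Psi> k x"
        unfolding \<Psi>_def using sq by (intro Bochner_Integration.integral_cong refl) simp
      finally show ?thesis by (simp only: mult_ac)
    qed
    ultimately have "cpx ((1 / sqrt (b k)) ^ CARD('n)) * (LINT x|lborel. G x * \<Psi> k x) = 0"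
      by (simp only: integral_mult_right_zero)
    then show ?thesis using b(1)[of k] by simp
  qed
  have \<Psi>b: "norm (\<Psi> k x) \<le> M * K" for k x
  proof -
    have 1: "norm (?P k x v) \<le> M * gauss 1 v" for v
      unfolding norm_mult using \<psi>(2) by (simp add: mult_right_mono)
    have "norm (\<Psi> k x) \<le> (LINT v|lborel. M * gauss 1 (v::real^'n))"
      unfolding \<Psi>_def
    proof (rule Bochner_Integration.integral_norm_bound_integral)
      show ig: "integrable lborel (\<lambda>v::real^'n. M * gauss 1 v)"
        by (intro integrable_mult_right intK)
      show "integrable lborel (\<lambda>v. ?P k x v)"
        by (rule integrable_norm_le[OF ig _ 1]) measurable
    qed (rule 1)
    then show ?thesis by (simp add: K_def)
  qed
  have \<Psi>lim: "(\<lambda>k. \<Psi> k x) \<longlonglongrightarrow> \<psi> x * cpx K" for x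
  proof -
    have "(\<lambda>k. \<Psi> k x) \<longlonglongrightarrow> (LINT v|lborel. \<psi> x * cpx (gauss 1 (v::real^'n)))"
      unfolding \<Psi>_def
    proof (rule integral_dominated_convergence[where w="\<lambda>v. M * gauss 1 v"])
      show "integrable lborel (\<lambda>v::real^'n. M * gauss 1 v)" using intK by (intro integrable_mult_right)
      have "(\<lambda>k. ?P k x v) \<longlonglongrightarrow> \<psi> x * cpx (gauss 1 v)" for v
      proof (intro tendsto_mult tendsto_const)
        have "filterlim (\<lambda>k. sqrt (b k)) at_top sequentially"
          using b(2) sqrt_at_top by (rule filterlim_compose[rotated])
        then have "(\<lambda>k. 1 / sqrt (b k)) \<longlonglongrightarrow> 0" by (rule real_tendsto_divide_at_top[OF tendsto_const])
        then have "(\<lambda>k. x + (1 / sqrt (b k)) *\<^sub>R v) \<longlonglongrightarrow> x + 0 *\<^sub>R v" by (intro tendsto_intros)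
        then have "(\<lambda>k. x + (1 / sqrt (b k)) *\<^sub>R v) \<longlonglongrightarrow> x" by simp
        then show "(\<lambda>k. \<psi> (x + (1 / sqrt (b k)) *\<^sub>R v)) \<longlonglongrightarrow> \<psi> x"
          by (rule continuous_on_tendsto_compose[OF \<psi>(1)]) auto
      qed
      then show "AE v in lborel. (\<lambda>k. ?P k x v) \<longlonglongrightarrow> \<psi> x * cpx (gauss 1 v)"
        by (rule AE_I2)
      show "AE v in lborel. norm (?P k x v) \<le> M * gauss 1 v" for k
        unfolding norm_mult using \<psi>(2) by (intro AE_I2) (simp add: mult_right_mono)
    qed measurable
    also have "(LINT v|lborel. \<psi> x * cpx (gauss 1 (v::real^'n))) = \<psi> x * cpx K"
      unfolding K_def integral_mult_right_zero integral_complex_of_real ..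
    finally show ?thesis .
  qed
  have "(\<lambda>k. (LINT x|lborel. G x * \<Psi> k x)) \<longlonglongrightarrow> (LINT x|lborel. G x * (\<psi> x * cpx K))"
  proof (rule integral_dominated_convergence[where w="\<lambda>x. norm (G x) * (M * K)"])
    show "integrable lborel (\<lambda>x. norm (G x) * (M * K))" using G by (intro integrable_mult_left integrable_norm)
    show "AE x in lborel. (\<lambda>k. G x * \<Psi> k x) \<longlonglongrightarrow> G x * (\<psi> x * cpx K)"
      by (intro AE_I2 tendsto_mult tendsto_const \<Psi>lim)
    show "AE x in lborel. norm (G x * \<Psi> k x) \<le> norm (G x) * (M * K)" for k
      unfolding norm_mult by (intro AE_I2 mult_left_mono \<Psi>b) auto
    have "\<Psi> k \<in> borel_measurable borel" for k unfolding \<Psi>_def by measurable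
    then show "(\<lambda>x. G x * \<Psi> k x) \<in> borel_measurable lborel" for k by measurable
  qed measurable
  then have "(LINT x|lborel. cpx K * (G x * \<psi> x)) = 0"
    unfolding zero using LIMSEQ_unique[OF _ tendsto_const] by (simp add: mult_ac)
  then show ?thesis using K unfolding integral_mult_right_zero by simp
qed

text \<open>The function D is square-integrable but possibly not integrable, whereas G = D exp(-
  |x|^2/2) is integrable. Testing D against \<psi> means testing G against \<psi> exp(|x|^2/2),
  which may be unbounded; a cutoff restores boundedness and is removed by dominated
  convergence.\<close>

lemma hermite_complete:
  fixes D \<psi> :: "real^'n \<Rightarrow> complex"
  assumes D: "D \<in> borel_measurable lborel" "integrable lborel (\<lambda>x. (norm (D x))\<^sup>2)"
    and h: "\<And>\<alpha>. (LINT x|lborel. D x * cpx (hermite_fun \<alpha> x)) = 0"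
    and \<psi>: "continuous_on UNIV \<psi>" "\<And>x. norm (\<psi> x) \<le> M" and int: "integrable lborel (\<lambda>x. D x * \<psi> x)"
  shows "(LINT x|lborel. D x * \<psi> x) = 0"
proof -
  let ?e = "\<lambda>x::real^'n. exp ((norm x)\<^sup>2 / 2)"
  let ?d = "\<lambda>x::real^'n. exp (- (norm x)\<^sup>2 / 2)"
  note [measurable] = D(1)
  have [measurable]: "\<psi> \<in> borel_measurable borel" using \<psi>(1) by (rule borel_measurable_continuous_onI)
  have M: "0 \<le> M" using \<psi>(2)[of 0] norm_ge_zero[of "\<psi> 0"] by linarith
  \<comment> \<open>Chosen so that b k + 1/2 is the exponent (3/2)^(k+1) / 2 supplied by
    \<open>vanish_geometric\<close>; starting from the first power keeps b k positive.\<close>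
  define b where "b k = ((3/2::real) ^ Suc k - 1) / 2" for k
  have b: "0 < b k" for k using one_less_power[of "3/2::real" "Suc k"] unfolding b_def by simp
  have blim: "filterlim b at_top sequentially"
  proof -
    have "filterlim (\<lambda>k. (3/2::real) ^ k) at_top sequentially"
      by (intro filterlim_at_infinity_imp_filterlim_at_top filterlim_realpow_sequentially_gt1) auto
    then have "filterlim (\<lambda>k. (3/2::real) ^ Suc k) at_top sequentially" by (rule filterlim_compose) (rule filterlim_Suc)
    then have "filterlim (\<lambda>k. - (1/2) + (1/2) * (3/2::real) ^ Suc k) at_top sequentially"
      by (intro filterlim_tendsto_add_at_top[OF tendsto_const] filterlim_tendsto_pos_mult_at_top[OF tendsto_const]) auto
    then show ?thesis by (rule filterlim_cong[THEN iffD1, rotated 3]) (auto simp: b_def field_simps)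
  qed
  define G where "G x = D x * cpx (?d x)" for x
  have iG: "integrable lborel G" unfolding G_def
    using D by (intro integrable_L2_mult_gauss[where a="1/2" and C=1]) auto
  have v: "(LINT x|lborel. G x * cpx (gauss (b k) (x - u))) = 0" for k u
  proof -
    have "vanish D ((3/2) ^ Suc k / 2)" by (rule vanish_geometric[OF D vanish_half[OF D h]])
    then have "vanish D (b k + 1/2)" by (simp add: b_def diff_divide_distrib)
    from vanish_gauss_translate[OF D this b] show ?thesis by (simp add: G_def mult.assoc)
  qed
  \<comment> \<open>A continuous cutoff tailored to the growth: exp(|x|^2/2) times
    \<open>\<theta> n\<close> is at most n, and at each point \<open>\<theta> n\<close> equals 1 for
    all large n.\<close>
  define \<theta> where "\<theta> n x = min 1 (real n * ?d x)" for n and x :: "real^'n"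
  define \<psi>' where "\<psi>' n x = \<psi> x * cpx (?e x * \<theta> n x)" for n x
  have \<theta>: "0 \<le> \<theta> n x" "\<theta> n x \<le> 1" for n x by (auto simp: \<theta>_def)
  have eq: "G x * \<psi>' n x = (D x * \<psi> x) * cpx (\<theta> n x)" for n x
  proof -
    have "?d x * ?e x = 1" by (simp add: exp_add[symmetric])
    then have "cpx (?d x) * cpx (?e x) = 1"
      by (metis of_real_mult of_real_1)
    moreover have "G x * \<psi>' n x = (D x * \<psi> x) * cpx (\<theta> n x) * (cpx (?d x) * cpx (?e x))"
      unfolding G_def \<psi>'_def of_real_mult by (simp only: mult_ac)
    ultimately show ?thesis by simp
  qed
  have z: "(LINT x|lborel. (D x * \<psi> x) * cpx (\<theta> n x)) = 0" for n
    unfolding eq[symmetric]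
  proof (rule integral_gauss_translate_eq_0_imp[OF iG _ _ b blim v])
    show "continuous_on UNIV (\<psi>' n)" unfolding \<psi>'_def \<theta>_def
      by (intro continuous_intros \<psi>) auto
    show "norm (\<psi>' n x) \<le> M * real n" for x
    proof -
      have "?e x * \<theta> n x \<le> ?e x * (real n * ?d x)"
        unfolding \<theta>_def by (intro mult_left_mono) auto
      also have "\<dots> = real n" by (simp add: exp_minus)
      finally have "norm (\<psi> x) * (?e x * \<theta> n x) \<le> M * real n"
        using \<psi>(2)[of x] M \<theta>[of n x] by (intro mult_mono) auto
      then show ?thesis unfolding \<psi>'_def norm_mult norm_of_real using \<theta>(1)[of n x] by (simp add: abs_mult)
    qed
  qed
  have "(\<lambda>n. (LINT x|lborel. (D x * \<psi> x) * cpx (\<theta> n x))) \<longlonglongrightarrow> (LINT x|lborel. D x * \<psi> x)"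
  proof (rule integral_dominated_convergence[OF _ _ integrable_norm[OF int]])
    show "AE x in lborel. norm (D x * \<psi> x * cpx (\<theta> n x)) \<le> norm (D x * \<psi> x)" for n
      unfolding norm_mult[of "D _ * \<psi> _" "cpx _"] using \<theta> by (intro AE_I2 mult_left_le) auto
    have "(\<lambda>n. D x * \<psi> x * cpx (\<theta> n x)) \<longlonglongrightarrow> D x * \<psi> x" for x
    proof -
      obtain N where N: "?e x \<le> real N" using real_arch_simple by blast
      have "\<theta> n x = 1" if "n \<ge> N" for n
      proof -
        have "1 = ?e x * ?d x" by (simp add: exp_minus)
        also have "\<dots> \<le> real n * ?d x" using N that by (intro mult_right_mono) auto
        finally show ?thesis by (simp add: \<theta>_def)
      qed
      then have "\<forall>\<^sub>F n in sequentially. D x * \<psi> x * cpx (\<theta> n x) = D x * \<psi> x"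
        unfolding eventually_sequentially by (intro exI[of _ N]) simp
      then show ?thesis by (rule tendsto_eventually)
    qed
    then show "AE x in lborel. (\<lambda>n. D x * \<psi> x * cpx (\<theta> n x)) \<longlonglongrightarrow> D x * \<psi> x" by (rule AE_I2)
    show "(\<lambda>x. D x * \<psi> x * cpx (\<theta> n x)) \<in> borel_measurable lborel" for n
      unfolding \<theta>_def by measurable
  qed measurable
  then have "(\<lambda>n. 0) \<longlonglongrightarrow> (LINT x|lborel. D x * \<psi> x)" by (simp only: z)
  from LIMSEQ_unique[OF this tendsto_const] show ?thesis .
qed

section \<open>Radial weights on phase space\<close>

type_synonym 'n phase = "(real^'n) \<times> (real^'n)"

abbreviation zvec :: "'n::finite phase \<Rightarrow> complex ^ 'n" where
  "zvec p \<equiv> cvec (fst p) (snd p)"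

abbreviation zbar :: "'n::finite phase \<Rightarrow> complex ^ 'n" where
  "zbar p \<equiv> cvec (fst p) (- snd p)"

lemma cvec_nth [simp]: "cvec x \<xi> $ j = Complex (x $ j) (\<xi> $ j)"
  by (simp add: cvec_def)

text \<open>The linear map \<open>g\<close> inverts \<open>zvec\<close>, and linear maps between
  spaces of equal dimension send null sets to null sets. This relates the two Lebesgue measures
  without a Jacobian.\<close>

lemma AE_phase_of_AE_complex:
  assumes "AE z in lebesgue. P (z :: complex^'n)"
  shows "AE p in lborel. P (zvec (p :: 'n phase))"
proof -
  define g :: "complex^'n \<Rightarrow> 'n phase" where "g w = ((\<chi> j. Re (w $ j)), (\<chi> j. Im (w $ j)))" for w
  have lin: "linear g" by (rule linearI) (auto simp: g_def vec_eq_iff)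
  obtain N where N: "N \<in> null_sets lebesgue" "{z. \<not> P z} \<subseteq> N"
    using assms unfolding eventually_ae_filter by auto
  have "negligible (g ` N)"
  proof (rule negligible_differentiable_image_negligible)
    show "negligible N" using N by (simp add: negligible_iff_null_sets)
    show "g differentiable_on N" using lin by (rule linear_imp_differentiable_on)
  qed simp
  then have "g ` N \<in> null_sets lebesgue" by (simp add: negligible_iff_null_sets)
  moreover have "{p. \<not> P (zvec p)} \<subseteq> g ` N"
  proof
    fix p :: "'n phase" assume "p \<in> {p. \<not> P (zvec p)}"
    then have "zvec p \<in> N" using N by auto
    moreover have "g (zvec p) = p" by (cases p) (auto simp: g_def vec_eq_iff)
    ultimately show "p \<in> g ` N" by (metis image_eqI)
  qed
  ultimately have "AE p in lebesgue. P (zvec (p :: 'n phase))" unfolding eventually_ae_filter by auto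
  then show ?thesis by (simp add: AE_completion_iff)
qed

section \<open>Measure-preserving maps of phase space\<close>

definition preserves_lborel :: "('a::euclidean_space \<Rightarrow> 'a) \<Rightarrow> bool" where
  "preserves_lborel T \<longleftrightarrow> T \<in> borel \<rightarrow>\<^sub>M borel \<and> distr lborel borel T = lborel"

lemma preserves_lborel_comp:
  assumes "preserves_lborel S" "preserves_lborel T"
  shows "preserves_lborel (\<lambda>x. S (T x))"
proof -
  have [measurable]: "S \<in> borel \<rightarrow>\<^sub>M borel" "T \<in> borel \<rightarrow>\<^sub>M borel" using assms by (auto simp: preserves_lborel_def)
  have "distr lborel borel (\<lambda>x. S (T x)) = distr (distr lborel borel T) borel S"
    by (subst distr_distr) (auto simp: comp_def)
  then show ?thesis using assms unfolding preserves_lborel_def by auto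
qed

text \<open>Tonelli produces identities between nonnegative integrals; indicators turn these into an
  equality of measures.\<close>

lemma preserves_lborelI:
  assumes [measurable]: "T \<in> borel \<rightarrow>\<^sub>M borel"
    and "\<And>f :: 'a::euclidean_space \<Rightarrow> ennreal. f \<in> borel_measurable borel \<Longrightarrow> (\<integral>\<^sup>+p. f (T p) \<partial>lborel) = (\<integral>\<^sup>+p. f p \<partial>lborel)"
  shows "preserves_lborel T"
proof -
  have "distr lborel borel T = lborel"
  proof (rule measure_eqI)
    fix A assume "A \<in> sets (distr lborel borel T)"
    then have [measurable]: "A \<in> sets borel" by simp
    have "emeasure (distr lborel borel T) A = (\<integral>\<^sup>+p. indicator A p \<partial>distr lborel borel T)" by simp
    also have "\<dots> = (\<integral>\<^sup>+p. indicator A (T p) \<partial>lborel)" by (subst nn_integral_distr) auto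
    also have "\<dots> = (\<integral>\<^sup>+p. indicator A p \<partial>lborel)" by (rule assms(2)) simp
    also have "\<dots> = emeasure lborel A" by simp
    finally show "emeasure (distr lborel borel T) A = emeasure lborel A" .
  qed simp
  then show ?thesis by (simp add: preserves_lborel_def)
qed

lemma nn_integral_lborel_translate:
  fixes f :: "'a::euclidean_space \<Rightarrow> ennreal"
  assumes "f \<in> borel_measurable borel"
  shows "(\<integral>\<^sup>+x. f (x + c) \<partial>lborel) = (\<integral>\<^sup>+x. f x \<partial>lborel)"
proof -
  have "(\<integral>\<^sup>+x. f x \<partial>lborel) = (\<integral>\<^sup>+x. f x \<partial>distr lborel borel ((+) c))" by (simp add: lborel_distr_plus)
  also have "\<dots> = (\<integral>\<^sup>+x. f (c + x) \<partial>lborel)" using assms by (subst nn_integral_distr) auto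
  finally show ?thesis by (simp add: add.commute)
qed

text \<open>For a fixed second component the map is a translation, so Tonelli with the first
  variable innermost reduces the claim to translation invariance.\<close>

lemma preserves_lborel_shear_fst:
  fixes \<tau> :: "'b::euclidean_space \<Rightarrow> 'a::euclidean_space"
  assumes [measurable]: "\<tau> \<in> borel \<rightarrow>\<^sub>M borel"
  shows "preserves_lborel (\<lambda>p. (fst p + \<tau> (snd p), snd p))"
proof (rule preserves_lborelI)
  show T: "(\<lambda>p. (fst p + \<tau> (snd p), snd p)) \<in> borel \<rightarrow>\<^sub>M borel" unfolding borel_prod[symmetric] by measurable
  fix f :: "'a \<times> 'b \<Rightarrow> ennreal" assume f: "f \<in> borel_measurable borel"
  then have f': "f \<in> borel_measurable (lborel \<Otimes>\<^sub>M lborel)" by (simp add: lborel_prod)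
  have [measurable]: "f \<in> borel_measurable (borel \<Otimes>\<^sub>M borel)" using f by (simp add: borel_prod)
  have Tf: "(\<lambda>p. f (fst p + \<tau> (snd p), snd p)) \<in> borel_measurable (lborel \<Otimes>\<^sub>M lborel)"
    by measurable
  have "(\<integral>\<^sup>+p. f (fst p + \<tau> (snd p), snd p) \<partial>lborel) = (\<integral>\<^sup>+y. \<integral>\<^sup>+x. f (x + \<tau> y, y) \<partial>lborel \<partial>lborel)"
    unfolding lborel_prod[symmetric] lborel_pair.nn_integral_snd[OF Tf, symmetric] by simp
  also have "\<dots> = (\<integral>\<^sup>+y. \<integral>\<^sup>+x. f (x, y) \<partial>lborel \<partial>lborel)"
    by (intro nn_integral_cong nn_integral_lborel_translate) measurable
  also have "\<dots> = (\<integral>\<^sup>+p. f p \<partial>lborel)"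
    unfolding lborel_pair.nn_integral_snd[OF f'] lborel_prod ..
  finally show "(\<integral>\<^sup>+p. f (fst p + \<tau> (snd p), snd p) \<partial>lborel) = (\<integral>\<^sup>+p. f p \<partial>lborel)" .
qed

lemma preserves_lborel_shear_snd:
  fixes \<tau> :: "'a::euclidean_space \<Rightarrow> 'b::euclidean_space"
  assumes [measurable]: "\<tau> \<in> borel \<rightarrow>\<^sub>M borel"
  shows "preserves_lborel (\<lambda>p. (fst p, snd p + \<tau> (fst p)))"
proof (rule preserves_lborelI)
  show T: "(\<lambda>p. (fst p, snd p + \<tau> (fst p))) \<in> borel \<rightarrow>\<^sub>M borel" unfolding borel_prod[symmetric] by measurable
  fix f :: "'a \<times> 'b \<Rightarrow> ennreal" assume "f \<in> borel_measurable borel"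
  then have [measurable]: "f \<in> borel_measurable (borel \<Otimes>\<^sub>M borel)" by (simp add: borel_prod)
  have "(\<integral>\<^sup>+x. \<integral>\<^sup>+y. f (x, y + \<tau> x) \<partial>lborel \<partial>lborel) = (\<integral>\<^sup>+x. \<integral>\<^sup>+y. f (x, y) \<partial>lborel \<partial>lborel)"
    by (intro nn_integral_cong nn_integral_lborel_translate) measurable
  then show "(\<integral>\<^sup>+p. f (fst p, snd p + \<tau> (fst p)) \<partial>lborel) = (\<integral>\<^sup>+p. f p \<partial>lborel)"
    by (simp add: lborel.nn_integral_fst[symmetric] flip: lborel_prod)
qed

definition rotate_coord :: "'n \<Rightarrow> complex \<Rightarrow> 'n::finite phase \<Rightarrow> 'n phase" where
  "rotate_coord j \<omega> p =
     (\<chi> i. if i = j then Re (\<omega> * zvec p $ j) else fst p $ i, \<chi> i. if i = j then Im (\<omega> * zvec p $ j) else snd p $ i)"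

lemma zvec_rotate_coord: "zvec (rotate_coord j \<omega> p) $ i = (if i = j then \<omega> * zvec p $ i else zvec p $ i)"
  by (simp add: rotate_coord_def complex_eq_iff)

text \<open>A plane rotation is a product of three shears, and each shear is a translation on the fibres.\<close>

lemma preserves_lborel_rotate_coord:
  fixes j :: "'n::finite"
  assumes "0 < \<theta>" "\<theta> < pi"
  shows "preserves_lborel (rotate_coord j (cis \<theta>))"
proof -
  \<comment> \<open>The three-shear factorisation has slopes - tan(\<theta>/2), sin \<theta>, -
    tan(\<theta>/2). The facts \<open>us\<close> and \<open>uc\<close> make the matrix entries
    agree, and \<theta> < pi keeps cos(\<theta>/2) positive.\<close>
  define u where "u = - tan (\<theta> / 2)"
  define S where "S = (\<lambda>p :: 'n phase. (fst p + axis j (u * snd p $ j), snd p))"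
  define R where "R = (\<lambda>p :: 'n phase. (fst p, snd p + axis j (sin \<theta> * fst p $ j)))"
  have axis: "axis j t = t *\<^sub>R (axis j 1 :: real^'n)" for t by (simp add: vec_eq_iff axis_def)
  have m: "(\<lambda>y::real^'n. axis j (c * y $ j)) \<in> borel \<rightarrow>\<^sub>M borel" for c :: real
    by (subst axis) measurable
  have S: "preserves_lborel S" unfolding S_def
    by (rule preserves_lborel_shear_fst[of "\<lambda>y. axis j (u * y $ j)"]) (rule m)
  have R: "preserves_lborel R" unfolding R_def
    by (rule preserves_lborel_shear_snd[of "\<lambda>y. axis j (sin \<theta> * y $ j)"]) (rule m)
  have c0: "cos (\<theta> / 2) > 0" using assms by (intro cos_gt_zero_pi) auto
  have sin2: "sin \<theta> = 2 * sin (\<theta>/2) * cos (\<theta>/2)" using sin_double[of "\<theta>/2"] by simp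
  have us: "1 + u * sin \<theta> = cos \<theta>"
  proof -
    have "1 + u * sin \<theta> = 1 - 2 * (sin (\<theta>/2))\<^sup>2"
      unfolding sin2 u_def tan_def using c0 by (simp add: power2_eq_square)
    then show ?thesis using cos_double_sin[of "\<theta>/2"] by simp
  qed
  have uc: "u + u * cos \<theta> = - sin \<theta>"
  proof -
    have "u + u * cos \<theta> = u * (1 + cos \<theta>)" by (simp add: algebra_simps)
    also have "1 + cos \<theta> = 2 * (cos (\<theta>/2))\<^sup>2" using cos_double_cos[of "\<theta>/2"] by simp
    also have "u * (2 * (cos (\<theta>/2))\<^sup>2) = - sin \<theta>"
      unfolding sin2 u_def tan_def using c0 by (simp add: power2_eq_square)
    finally show ?thesis .
  qed
  have "rotate_coord j (cis \<theta>) = (\<lambda>p. S (R (S p)))"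
  proof
    fix p :: "'n phase"
    obtain x y where p: "p = (x, y)" by (cases p)
    have e1: "cos \<theta> * x $ j - sin \<theta> * y $ j = x $ j + u * y $ j + u * (y $ j + sin \<theta> * (x $ j + u * y $ j))"
    proof -
      have "x $ j + u * y $ j + u * (y $ j + sin \<theta> * (x $ j + u * y $ j)) =
         (1 + u * sin \<theta>) * x $ j + (u + u * (1 + u * sin \<theta>)) * y $ j" by (simp add: algebra_simps)
      then show ?thesis unfolding us uc by simp
    qed
    have e2: "sin \<theta> * x $ j + cos \<theta> * y $ j = y $ j + sin \<theta> * (x $ j + u * y $ j)"
    proof -
      have "y $ j + sin \<theta> * (x $ j + u * y $ j) = sin \<theta> * x $ j + (1 + u * sin \<theta>) * y $ j" by (simp add: algebra_simps)
      then show ?thesis unfolding us by simp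
    qed
    show "rotate_coord j (cis \<theta>) p = S (R (S p))"
      using e1 e2 by (auto simp: p rotate_coord_def S_def R_def vec_eq_iff axis_def)
  qed
  then show ?thesis using preserves_lborel_comp[OF S preserves_lborel_comp[OF R S]] by simp
qed

text \<open>A Borel representative of \<chi> on phase space. Sign, upper bound and support hold at
  every point, which simplifies domination. Radiality is recorded as invariance under rotations of
  one coordinate, in the almost-everywhere form that integrals require.\<close>

locale radial_weight =
  fixes k :: "'n::finite phase \<Rightarrow> real" and M c :: real and t T :: "real^'n"
  assumes k_measurable [measurable]: "k \<in> borel_measurable borel"
    and k_nonneg: "\<And>p. 0 \<le> k p" and k_le: "\<And>p. k p \<le> M"
    and k_support: "\<And>p j. k p \<noteq> 0 \<Longrightarrow> cmod (zvec p $ j) \<le> T $ j"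
    and t_pos: "\<And>j. 0 < t $ j" and T_pos: "\<And>j. 0 < T $ j" and c_pos: "0 < c"
    and k_lower: "AE p in lborel. (\<forall>j. cmod (zvec p $ j) < t $ j) \<longrightarrow> c \<le> k p"
    and k_rotate: "\<And>j \<theta>. 0 < \<theta> \<Longrightarrow> \<theta> < pi \<Longrightarrow> AE p in lborel. k (rotate_coord j (cis \<theta>) p) = k p"

text \<open>The given class is changed on a null set only: a Borel version is clamped to [0, M] and
  cut off outside the closed polydisc. Dependence on the moduli becomes rotation invariance.\<close>

lemma R_infty_radial_weight:
  assumes "\<kappa> \<in> (R_infty :: (complex^'n \<Rightarrow> real) set)"
  obtains k M c t T where "radial_weight k M c t T" "AE p in lborel. k p = \<kappa> (zvec p)"
proof -
  from assms obtain t T where tT: "positive_radius t" "positive_radius T" "\<kappa> \<in> R_infty_between t T"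
    unfolding R_infty_def by blast
  then have L: "Linfty \<kappa>" and nn: "AE z in lebesgue. 0 \<le> \<kappa> z"
    and supp: "AE z in lebesgue. z \<notin> closure (polydisc T) \<longrightarrow> \<kappa> z = 0"
    unfolding R_infty_between_def supported_in_def by auto
  from tT obtain \<kappa>0 c where rad: "AE z in lebesgue. \<kappa> z = \<kappa>0 (\<chi> j. cmod (z $ j))"
    and c: "c > 0" "AE z in lebesgue. z \<in> polydisc t \<longrightarrow> c \<le> \<kappa> z"
    unfolding R_infty_between_def by auto
  from L obtain M0 where M0: "AE z in lebesgue. norm (\<kappa> z) \<le> M0" and meas: "\<kappa> \<in> borel_measurable lebesgue"
    unfolding Linfty_def by auto
  from completion_ex_borel_measurable_real[OF meas] obtain \<kappa>1 where
    \<kappa>1[measurable]: "\<kappa>1 \<in> borel_measurable lborel" and ae1: "AE z in lborel. \<kappa> z = \<kappa>1 z" by auto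
  define M where "M = max 0 M0"
  define S where "S = {p :: 'n phase. \<forall>j. cmod (zvec p $ j) \<le> T $ j}"
  have cont: "continuous_on UNIV (\<lambda>p :: 'n phase. cmod (zvec p $ j))" for j
    unfolding cvec_nth complex_norm by (intro continuous_intros)
  have "closed S" unfolding S_def by (intro closed_Collect_all closed_Collect_le cont continuous_intros)
  then have S [measurable]: "S \<in> sets borel" by (rule borel_closed)
  have zm [measurable]: "(\<lambda>p :: 'n phase. zvec p) \<in> borel \<rightarrow>\<^sub>M borel"
  proof (intro borel_measurable_continuous_onI)
    have "continuous_on UNIV (\<lambda>p::'n phase. \<chi> j. cpx (fst p $ j) + \<i> * cpx (snd p $ j))"
      by (intro continuous_on_vec_lambda continuous_intros)
    then show "continuous_on UNIV (\<lambda>p::'n phase. zvec p)" unfolding cvec_def Complex_eq .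
  qed
  define k where "k p = (if p \<in> S then max 0 (min M (\<kappa>1 (zvec p))) else 0)" for p
  have km: "k \<in> borel_measurable borel" unfolding k_def[abs_def] by measurable
  have clos: "closure (polydisc T) \<subseteq> {z. \<forall>j. cmod (z $ j) \<le> T $ j}"
  proof (rule closure_minimal)
    show "closed {z. \<forall>j. cmod (z $ j) \<le> T $ j}"
      by (intro closed_Collect_all closed_Collect_le continuous_intros)
  qed (auto simp: polydisc_def less_imp_le)
  have keq: "AE p in lborel. k p = \<kappa> (zvec p)"
  proof -
    have "AE z in lebesgue. \<kappa> z = \<kappa>1 z" using ae1 by (simp add: AE_completion_iff)
    note a = AE_phase_of_AE_complex[OF this] AE_phase_of_AE_complex[OF M0] AE_phase_of_AE_complex[OF nn] AE_phase_of_AE_complex[OF supp]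
    from a show ?thesis
    proof eventually_elim
      case (elim p)
      show ?case
      proof (cases "p \<in> S")
        case True
        then show ?thesis using elim by (auto simp: k_def M_def)
      next
        case False
        then have "zvec p \<notin> closure (polydisc T)" using clos by (auto simp: S_def)
        then show ?thesis using elim False by (simp add: k_def)
      qed
    qed
  qed
  have "radial_weight k M c t T"
  proof
    show "k \<in> borel_measurable borel" by (rule km)
    show "0 \<le> k p" "k p \<le> M" for p by (auto simp: k_def M_def)
    show "cmod (zvec p $ j) \<le> T $ j" if "k p \<noteq> 0" for p j using that by (auto simp: k_def S_def split: if_splits)
    show "0 < t $ j" "0 < T $ j" for j using tT by (auto simp: positive_radius_def)
    show "0 < c" by (rule c)
    show "AE p in lborel. (\<forall>j. cmod (zvec p $ j) < t $ j) \<longrightarrow> c \<le> k p"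
      using keq AE_phase_of_AE_complex[OF c(2)] by eventually_elim (auto simp: polydisc_def)
    fix j :: 'n and \<theta> :: real assume \<theta>: "0 < \<theta>" "\<theta> < pi"
    define R where "R = rotate_coord j (cis \<theta>)"
    have R: "preserves_lborel R" unfolding R_def using \<theta> by (rule preserves_lborel_rotate_coord)
    have "AE p in lborel. k p = \<kappa>0 (\<chi> j. cmod (zvec p $ j))"
      using keq AE_phase_of_AE_complex[OF rad] by eventually_elim auto
    \<comment> \<open>The profile \<open>\<kappa>0\<close> is an arbitrary function, so its
      exceptional null set is pulled back along the measure-preserving R, with no measurability of
      \<open>\<kappa>0\<close> involved.\<close>
    moreover from this have "AE p in lborel. k (R p) = \<kappa>0 (\<chi> j. cmod (zvec (R p) $ j))"
    proof -
      assume a: "AE p in lborel. k p = \<kappa>0 (\<chi> j. cmod (zvec p $ j))"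
      have "AE p in distr lborel borel R. k p = \<kappa>0 (\<chi> j. cmod (zvec p $ j))"
        using a R[unfolded preserves_lborel_def, THEN conjunct2] by (simp only:)
      then show ?thesis using R unfolding preserves_lborel_def by (intro AE_distrD[of R lborel borel]) auto
    qed
    ultimately show "AE p in lborel. k (R p) = k p"
    proof eventually_elim
      case (elim p)
      have "(\<chi> i. cmod (zvec (R p) $ i)) = (\<chi> i. cmod (zvec p $ i))"
        unfolding R_def vec_eq_iff zvec_rotate_coord by (auto simp: norm_mult)
      then show ?case using elim by simp
    qed
  qed
  then show ?thesis using keq that by blast
qed

context radial_weight
begin

definition phase_box :: "'n phase set" where
  "phase_box = cbox (- T, - T) (T, T)"

lemma in_phase_box: "(\<And>j. cmod (zvec p $ j) \<le> T $ j) \<Longrightarrow> p \<in> phase_box"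
proof -
  assume *: "\<And>j. cmod (zvec p $ j) \<le> T $ j"
  have "- T $ j \<le> fst p $ j" "fst p $ j \<le> T $ j" "- T $ j \<le> snd p $ j" "snd p $ j \<le> T $ j" for j
    using *[of j] abs_Re_le_cmod[of "zvec p $ j"] abs_Im_le_cmod[of "zvec p $ j"] by (auto simp: abs_le_iff)
  then have "fst p \<in> cbox (- T) T" "snd p \<in> cbox (- T) T"
    unfolding mem_box_cart by auto
  then show ?thesis unfolding phase_box_def cbox_Pair_eq by (cases p) auto
qed

lemma k_outside: "p \<notin> phase_box \<Longrightarrow> k p = 0"
  using in_phase_box k_support by blast

lemma compact_phase_box: "compact phase_box" by (simp add: phase_box_def compact_cbox)

definition phase_vol :: real where "phase_vol = measure lborel phase_box"

lemma M_nonneg: "0 \<le> M" using k_nonneg[of 0] k_le[of 0] by linarith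

lemma integrable_indicator_phase_box: "integrable lborel (\<lambda>p. C * indicator phase_box p :: real)"
  unfolding phase_box_def
  by (intro integrable_mult_right integrable_real_indicator emeasure_lborel_cbox_finite) simp

text \<open>The bound on g is asked for only where k is nonzero, that is, on the support, where
  |z_j| is controlled by \<open>T $ j\<close>.\<close>

lemma
  fixes g :: "'n phase \<Rightarrow> complex"
  assumes g: "g \<in> borel_measurable borel" and B: "\<And>p. p \<in> phase_box \<Longrightarrow> k p \<noteq> 0 \<Longrightarrow> norm (g p) \<le> B" "0 \<le> B"
  shows integrable_weight: "integrable lborel (\<lambda>p. cpx (k p) * g p)"
    and integral_weight_le: "norm (LINT p|lborel. cpx (k p) * g p) \<le> M * B * phase_vol"
proof -
  have b: "norm (cpx (k p) * g p) \<le> (M * B) * indicator phase_box p" for p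
  proof (cases "k p = 0")
    case False
    then have "p \<in> phase_box" using k_outside by blast
    then show ?thesis using B False k_nonneg[of p] k_le[of p] M_nonneg mult_mono[of "k p" M "norm (g p)" B] by (simp add: norm_mult)
  qed (simp add: M_nonneg B)
  show i: "integrable lborel (\<lambda>p. cpx (k p) * g p)"
    using g by (intro integrable_norm_le[OF integrable_indicator_phase_box _ b]) measurable
  have "norm (LINT p|lborel. cpx (k p) * g p) \<le> (LINT p|lborel. (M * B) * indicator phase_box p)"
    by (rule Bochner_Integration.integral_norm_bound_integral[OF i integrable_indicator_phase_box b])
  also have "\<dots> = M * B * phase_vol" unfolding phase_vol_def by simp
  finally show "norm (LINT p|lborel. cpx (k p) * g p) \<le> M * B * phase_vol" .
qed

lemma continuous_bounded_phase_box:
  fixes g :: "'n phase \<Rightarrow> complex"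
  assumes "continuous_on UNIV g" obtains B where "0 \<le> B" "\<And>p. p \<in> phase_box \<Longrightarrow> norm (g p) \<le> B"
proof -
  have "compact (g ` phase_box)"
    by (rule compact_continuous_image[OF continuous_on_subset[OF assms] compact_phase_box]) simp
  then have "bounded (g ` phase_box)" by (rule compact_imp_bounded)
  then obtain B where "B > 0" "\<forall>y\<in>g ` phase_box. norm y \<le> B"
    unfolding bounded_pos by blast
  then show ?thesis by (intro that[of B]) auto
qed

end

section \<open>Monomials and moments of a radial weight\<close>

definition sq_phase :: "'n::finite phase \<Rightarrow> real" where
  "sq_phase p = (\<Sum>j\<in>UNIV. (cmod (zvec p $ j))\<^sup>2)"

lemma continuous_zvec [continuous_intros]: "continuous_on S (\<lambda>p::'n::finite phase. Complex (fst p $ j) (snd p $ j))"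
  unfolding Complex_eq by (intro continuous_intros)

lemma continuous_zbar [continuous_intros]: "continuous_on S (\<lambda>p::'n::finite phase. Complex (fst p $ j) (- snd p $ j))"
  unfolding Complex_eq by (intro continuous_intros)

lemma continuous_sq_phase [continuous_intros]: "continuous_on S (sq_phase :: 'n::finite phase \<Rightarrow> real)"
  unfolding sq_phase_def[abs_def] cvec_nth by (intro continuous_intros)

lemma continuous_mi_power_zvec [continuous_intros]: "continuous_on S (\<lambda>p::'n::finite phase. mi_power (zvec p) \<alpha>)"
  unfolding mi_power_def cvec_nth by (intro continuous_intros)

lemma continuous_mi_power_zbar [continuous_intros]: "continuous_on S (\<lambda>p::'n::finite phase. mi_power (zbar p) \<alpha>)"
  unfolding mi_power_def cvec_nth by (intro continuous_intros)

lemma zbar_nth: "zbar p $ j = cnj (zvec p $ j)"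
  by (simp add: complex_eq_iff)

lemma norm_mi_power: "norm (mi_power z \<alpha>) = mi_power (\<chi> j. norm (z $ j)) \<alpha>" for z :: "complex ^ 'n"
  by (simp add: mi_power_def prod_norm[symmetric] norm_power)

lemma mi_power_mono: "(\<And>j. 0 \<le> r $ j) \<Longrightarrow> (\<And>j. r $ j \<le> s $ j) \<Longrightarrow> mi_power r \<alpha> \<le> mi_power s \<alpha>" for r s :: "real ^ 'n"
  unfolding mi_power_def by (intro prod_mono conjI power_mono zero_le_power) auto

lemma mi_power_nonneg: "(\<And>j. 0 \<le> r $ j) \<Longrightarrow> 0 \<le> mi_power r \<alpha>" for r :: "real ^ 'n"
  unfolding mi_power_def by (intro prod_nonneg) auto

lemma mi_power_pos: "(\<And>j. 0 < r $ j) \<Longrightarrow> 0 < mi_power r \<alpha>" for r :: "real ^ 'n"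
  unfolding mi_power_def by (intro prod_pos) auto

lemma sq_phase_nonneg: "0 \<le> sq_phase p" by (auto simp: sq_phase_def intro: sum_nonneg)

context radial_weight
begin

text \<open>The squared norm of the monomial of index \<alpha> for the weight k exp(-
  |z|^2/4).\<close>

definition moment :: "nat^'n \<Rightarrow> complex" where
  "moment \<alpha> = (LINT p|lborel. cpx (k p) *
     (cpx (exp (- sq_phase p / 4)) * mi_power (zbar p) \<alpha> * mi_power (zvec p) \<alpha>))"

text \<open>Rotating one coordinate multiplies the integral by a number different from 1.\<close>

lemma moment_orthogonal:
  assumes "\<alpha> \<noteq> \<beta>"
  shows "(LINT p|lborel. cpx (k p) *
     (cpx (exp (- sq_phase p / 4)) * mi_power (zbar p) \<alpha> * mi_power (zvec p) \<beta>)) = 0"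
proof -
  obtain j where j: "\<alpha> $ j \<noteq> \<beta> $ j" using assms by (auto simp: vec_eq_iff)
  define m where "m = (if \<alpha> $ j < \<beta> $ j then \<beta> $ j - \<alpha> $ j else \<alpha> $ j - \<beta> $ j)"
  have m: "m > 0" using j by (auto simp: m_def)
  \<comment> \<open>With m the distance between the two exponents of z_j, this choice puts m *
    \<theta> strictly between 0 and pi. The factor \<open>\<rho>\<close>, a power of \<omega> or of
    its conjugate with exponent m, then has nonzero imaginary part and differs from 1.\<close>
  define \<theta> where "\<theta> = pi / (real m + 1)"
  have \<theta>: "0 < \<theta>" "\<theta> < pi" using m by (auto simp: \<theta>_def field_simps)
  define \<omega> where "\<omega> = cis \<theta>"
  have un: "cnj \<omega> * \<omega> = 1" by (simp add: \<omega>_def cis_cnj cis_mult)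
  have sinm: "sin (real m * \<theta>) \<noteq> 0"
  proof -
    have "0 < real m * \<theta>" "real m * \<theta> < pi" using m by (auto simp: \<theta>_def field_simps)
    then show ?thesis using sin_gt_zero by fastforce
  qed
  define \<rho> where "\<rho> = cnj \<omega> ^ (\<alpha> $ j) * \<omega> ^ (\<beta> $ j)"
  have \<rho>: "\<rho> \<noteq> 1"
  proof
    assume r: "\<rho> = 1"
    have "Im \<rho> = (if \<alpha> $ j < \<beta> $ j then 1 else -1) * sin (real m * \<theta>)"
    proof (cases "\<alpha> $ j < \<beta> $ j")
      case True
      then have "\<omega> ^ (\<beta> $ j) = \<omega> ^ (\<alpha> $ j) * \<omega> ^ m" unfolding m_def by (simp add: power_add[symmetric])
      then have "\<rho> = (cnj \<omega> * \<omega>) ^ (\<alpha> $ j) * \<omega> ^ m" by (simp add: \<rho>_def power_mult_distrib)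
      then show ?thesis using True by (simp add: un) (simp add: \<omega>_def Complex.DeMoivre)
    next
      case False
      then have "cnj \<omega> ^ (\<alpha> $ j) = cnj \<omega> ^ (\<beta> $ j) * cnj \<omega> ^ m" unfolding m_def by (simp add: power_add[symmetric])
      then have "\<rho> = (cnj \<omega> * \<omega>) ^ (\<beta> $ j) * cnj \<omega> ^ m" by (simp add: \<rho>_def power_mult_distrib)
      then show ?thesis using False by (simp add: un) (simp add: \<omega>_def Complex.DeMoivre cis_cnj)
    qed
    with r sinm show False by (auto split: if_splits)
  qed
  define f where "f p = cpx (exp (- sq_phase p / 4)) * mi_power (zbar p) \<alpha> * mi_power (zvec p) \<beta>" for p :: "'n phase"
  have fm [measurable]: "f \<in> borel_measurable borel" unfolding f_def[abs_def]
    by (intro borel_measurable_continuous_onI continuous_intros) auto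
  define R where "R = (rotate_coord j \<omega> :: 'n phase \<Rightarrow> 'n phase)"
  have R: "preserves_lborel R" unfolding R_def \<omega>_def using \<theta> by (rule preserves_lborel_rotate_coord)
  then have Rm [measurable]: "R \<in> borel \<rightarrow>\<^sub>M borel" and Rd: "distr lborel borel R = lborel"
    by (auto simp: preserves_lborel_def)
  have pw: "mi_power (\<chi> i. if i = j then w * y $ i else y $ i) \<gamma> = w ^ (\<gamma> $ j) * mi_power y \<gamma>" for w :: complex and y :: "complex^'n" and \<gamma>
    unfolding mi_power_def by (subst (1 2) prod.remove[of _ j]) (auto simp: power_mult_distrib intro!: prod.cong)
  have fR: "f (R p) = \<rho> * f p" for p
  proof -
    have "zvec (R p) = (\<chi> i. if i = j then \<omega> * zvec p $ i else zvec p $ i)"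
      by (simp add: R_def vec_eq_iff zvec_rotate_coord del: cvec_nth)
    moreover have "zbar (R p) = (\<chi> i. if i = j then cnj \<omega> * zbar p $ i else zbar p $ i)"
      by (simp add: R_def vec_eq_iff zvec_rotate_coord zbar_nth del: cvec_nth)
    moreover have "sq_phase (R p) = sq_phase p"
      unfolding sq_phase_def R_def zvec_rotate_coord by (intro sum.cong) (auto simp: norm_mult \<omega>_def)
    ultimately show ?thesis unfolding f_def pw \<rho>_def by (simp only: pw mult_ac)
  qed
  have "(LINT p|lborel. cpx (k p) * f p) = (LINT p|distr lborel borel R. cpx (k p) * f p)"
    by (simp add: Rd)
  also have "\<dots> = (LINT p|lborel. cpx (k (R p)) * f (R p))"
    by (rule integral_distr) measurable
  also have "\<dots> = (LINT p|lborel. \<rho> * (cpx (k p) * f p))"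
  proof (rule integral_cong_AE)
    show "AE p in lborel. cpx (k (R p)) * f (R p) = \<rho> * (cpx (k p) * f p)"
      using k_rotate[OF \<theta>, of j] unfolding R_def[symmetric] \<omega>_def[symmetric] by eventually_elim (simp add: fR)
  qed measurable
  also have "\<dots> = \<rho> * (LINT p|lborel. cpx (k p) * f p)" by (rule integral_mult_right_zero)
  finally have "(1 - \<rho>) * (LINT p|lborel. cpx (k p) * f p) = 0" by (simp add: algebra_simps)
  then show ?thesis using \<rho> unfolding f_def by simp
qed

text \<open>A monomial times its conjugate is a product of squared moduli, so the moment is the
  integral of a nonnegative function and can be bounded below by restricting the domain.\<close>

lemma moment_eq:
  "moment \<alpha> = cpx (LINT p|lborel. k p * (exp (- sq_phase p / 4) * mi_power (\<chi> j. (cmod (zvec p $ j))\<^sup>2) \<alpha>))"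
proof -
  have "mi_power (zbar p) \<alpha> * mi_power (zvec p) \<alpha> = cpx (mi_power (\<chi> j. (cmod (zvec p $ j))\<^sup>2) \<alpha>)" for p :: "'n phase"
  proof -
    have "mi_power (zbar p) \<alpha> * mi_power (zvec p) \<alpha> = (\<Prod>j\<in>UNIV. (zvec p $ j * cnj (zvec p $ j)) ^ (\<alpha> $ j))"
      unfolding mi_power_def zbar_nth by (simp add: prod.distrib power_mult_distrib mult.commute)
    also have "\<dots> = cpx (mi_power (\<chi> j. (cmod (zvec p $ j))\<^sup>2) \<alpha>)"
      unfolding complex_norm_square[symmetric] mi_power_def by simp
    finally show ?thesis .
  qed
  then show ?thesis unfolding moment_def integral_complex_of_real[symmetric]
    by (intro Bochner_Integration.integral_cong) (simp_all add: mult.assoc del: cvec_nth)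
qed

lemma moment_upper: "norm (moment \<alpha>) \<le> M * phase_vol * mi_power (\<chi> j. (T $ j)\<^sup>2) \<alpha>"
proof -
  have "norm (moment \<alpha>) \<le> M * mi_power (\<chi> j. (T $ j)\<^sup>2) \<alpha> * phase_vol"
    unfolding moment_def
  proof (rule integral_weight_le)
    show "(\<lambda>p. cpx (exp (- sq_phase p / 4)) * mi_power (zbar p) \<alpha> * mi_power (zvec p) \<alpha>) \<in> borel_measurable borel"
      by (intro borel_measurable_continuous_onI continuous_intros) auto
    show "0 \<le> mi_power (\<chi> j. (T $ j)\<^sup>2) \<alpha>" by (intro mi_power_nonneg) auto
    fix p assume "k p \<noteq> 0"
    then have *: "cmod (zvec p $ j) \<le> T $ j" for j by (rule k_support)
    have "norm (cpx (exp (- sq_phase p / 4)) * mi_power (zbar p) \<alpha> * mi_power (zvec p) \<alpha>) =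
       exp (- sq_phase p / 4) * (mi_power (\<chi> j. cmod (zvec p $ j)) \<alpha> * mi_power (\<chi> j. cmod (zvec p $ j)) \<alpha>)"
      unfolding norm_mult norm_mi_power zbar_nth complex_mod_cnj by simp
    also have "\<dots> \<le> 1 * (mi_power T \<alpha> * mi_power T \<alpha>)"
      using * T_pos sq_phase_nonneg[of p] by (intro mult_mono mi_power_mono mult_nonneg_nonneg mi_power_nonneg) (auto simp: less_imp_le simp del: cvec_nth)
    also have "\<dots> = mi_power (\<chi> j. (T $ j)\<^sup>2) \<alpha>"
      by (simp add: mi_power_def prod.distrib[symmetric] power_mult_distrib power2_eq_square)
    finally show "norm (cpx (exp (- sq_phase p / 4)) * mi_power (zbar p) \<alpha> * mi_power (zvec p) \<alpha>) \<le> mi_power (\<chi> j. (T $ j)\<^sup>2) \<alpha>" .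
  qed
  then show ?thesis by (simp only: mult_ac)
qed

text \<open>It suffices to integrate over a fixed box of positive measure inside the region where k
  \<ge> c and every |z_j| is at least t_j/2; the constant C does not depend on \<alpha>.\<close>

lemma moment_lower: "\<exists>C>0. \<forall>\<alpha>. C * mi_power (\<chi> j. (t $ j / 2)\<^sup>2) \<alpha> \<le> norm (moment \<alpha>)"
proof -
  \<comment> \<open>Real parts lie in [t/2, 3t/4] and imaginary parts in [0, t/4]: the modulus is at
    least t/2 and at most sqrt(10)/4 * t, which is below t.\<close>
  define Q :: "'n phase set" where "Q = cbox ((1/2) *\<^sub>R t, 0) ((3/4) *\<^sub>R t, (1/4) *\<^sub>R t)"
  define C where "C = c * exp (- (\<Sum>j\<in>UNIV. (t $ j)\<^sup>2) / 4) * measure lborel Q"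
  have Qnn: "((1/2) *\<^sub>R t, 0) \<bullet> b \<le> ((3/4) *\<^sub>R t, (1/4) *\<^sub>R t) \<bullet> b \<and> ((1/2) *\<^sub>R t, 0) \<bullet> b \<noteq> ((3/4) *\<^sub>R t, (1/4) *\<^sub>R t) \<bullet> b" if "b \<in> Basis" for b :: "'n phase"
  proof -
    have "\<exists>j. b = (axis j 1, 0) \<or> b = (0, axis j 1)" using that by (auto simp: Basis_prod_def Basis_vec_def)
    then show ?thesis using t_pos by (auto simp: inner_axis less_imp_le) (use t_pos less_irrefl in metis)+
  qed
  have "measure lborel Q = (\<Prod>b\<in>Basis. (((3/4) *\<^sub>R t, (1/4) *\<^sub>R t) - ((1/2) *\<^sub>R t, 0)) \<bullet> b)"
    unfolding Q_def using Qnn by (intro measure_lborel_cbox) auto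
  also have "\<dots> > 0" using Qnn by (intro prod_pos) (force simp: inner_diff_left)
  finally have Qpos: "measure lborel Q > 0" .
  have C: "C > 0" unfolding C_def using c_pos Qpos by simp
  have Qz: "t $ j / 2 \<le> cmod (zvec p $ j) \<and> cmod (zvec p $ j) < t $ j" if "p \<in> Q" for p j
  proof -
    from that have *: "t $ j / 2 \<le> fst p $ j" "fst p $ j \<le> 3 / 4 * t $ j" "0 \<le> snd p $ j" "snd p $ j \<le> 1/4 * t $ j"
      unfolding Q_def by (cases p, auto simp: cbox_Pair_eq mem_box_cart)+
    have "t $ j / 2 \<le> cmod (zvec p $ j)" using * complex_Re_le_cmod[of "zvec p $ j"] by simp
    moreover have "(cmod (zvec p $ j))\<^sup>2 < (t $ j)\<^sup>2"
    proof -
      have "(cmod (zvec p $ j))\<^sup>2 = (fst p $ j)\<^sup>2 + (snd p $ j)\<^sup>2" by (simp add: cmod_power2)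
      also have "\<dots> \<le> (3 / 4 * t $ j)\<^sup>2 + (1 / 4 * t $ j)\<^sup>2" using * t_pos[of j] by (intro add_mono power_mono) auto
      also have "\<dots> < (t $ j)\<^sup>2" using t_pos[of j] by (simp add: power2_eq_square)
      finally show ?thesis .
    qed
    ultimately show ?thesis using t_pos[of j] power_less_imp_less_base[of "cmod (zvec p $ j)" 2 "t $ j"] by auto
  qed
  have "C * mi_power (\<chi> j. (t $ j / 2)\<^sup>2) \<alpha> \<le> norm (moment \<alpha>)" for \<alpha>
  proof -
    let ?f = "\<lambda>p. k p * (exp (- sq_phase p / 4) * mi_power (\<chi> j. (cmod (zvec p $ j))\<^sup>2) \<alpha>)"
    let ?A = "c * (exp (- (\<Sum>j\<in>UNIV. (t $ j)\<^sup>2) / 4) * mi_power (\<chi> j. (t $ j / 2)\<^sup>2) \<alpha>)"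
    have cont: "continuous_on UNIV (\<lambda>p::'n phase. mi_power (\<chi> j. (cmod (zvec p $ j))\<^sup>2) \<alpha>)"
      unfolding mi_power_def cvec_nth by (auto intro!: continuous_intros)
    have "integrable lborel (\<lambda>p. cpx (k p) * cpx (exp (- sq_phase p / 4) * mi_power (\<chi> j. (cmod (zvec p $ j))\<^sup>2) \<alpha>))"
    proof -
      have cg: "continuous_on UNIV (\<lambda>p. cpx (exp (- sq_phase p / 4) * mi_power (\<chi> j. (cmod (zvec p $ j))\<^sup>2) \<alpha>))"
        using cont by (intro continuous_intros) auto
      from continuous_bounded_phase_box[OF cg] obtain B where "0 \<le> B" 
        "\<And>p. p \<in> phase_box \<Longrightarrow> norm (cpx (exp (- sq_phase p / 4) * mi_power (\<chi> j. (cmod (zvec p $ j))\<^sup>2) \<alpha>)) \<le> B" by blast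
      then show ?thesis using borel_measurable_continuous_onI[OF cg] by (intro integrable_weight[of _ B]) auto
    qed
    then have intf: "integrable lborel ?f"
      unfolding of_real_mult[symmetric] complex_of_real_integrable_eq .
    have "C * mi_power (\<chi> j. (t $ j / 2)\<^sup>2) \<alpha> = (LINT p|lborel. ?A * indicator Q p)"
      unfolding C_def by simp
    also have "\<dots> \<le> (LINT p|lborel. ?f p)"
    proof (rule integral_mono_AE)
      show "integrable lborel (\<lambda>p. ?A * indicator Q p)"
        unfolding Q_def by (intro integrable_mult_right integrable_real_indicator emeasure_lborel_cbox_finite) simp
      show "AE p in lborel. ?A * indicator Q p \<le> ?f p"
        using k_lower
      proof eventually_elim
        case (elim p)
        have nn: "0 \<le> ?f p" by (intro mult_nonneg_nonneg k_nonneg mi_power_nonneg) auto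
        show ?case
        proof (cases "p \<in> Q")
          case True
          have sq: "sq_phase p \<le> (\<Sum>j\<in>UNIV. (t $ j)\<^sup>2)" unfolding sq_phase_def
            using Qz[OF True] by (intro sum_mono power_mono) (auto simp: less_imp_le simp del: cvec_nth)
          have "?A \<le> ?f p"
            using elim Qz[OF True] c_pos sq t_pos
            by (intro mult_mono mi_power_mono mi_power_nonneg mult_nonneg_nonneg k_nonneg) (auto simp: less_imp_le intro!: power_mono simp del: cvec_nth)
          then show ?thesis using True by simp
        qed (use nn in simp)
      qed
    qed (rule intf)
    also have "\<dots> \<le> norm (moment \<alpha>)" unfolding moment_eq by simp
    finally show ?thesis .
  qed
  then show ?thesis using C by blast
qed

end

section \<open>Coefficient sequences and power series\<close>

text \<open>Unconditional and absolute summability coincide for complex families, so the product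
  family is summable on the rectangle; summing by rows identifies the value.\<close>

lemma has_sum_mult_complex:
  fixes f :: "'a \<Rightarrow> complex" and g :: "'b \<Rightarrow> complex"
  assumes f: "(f has_sum F) A" and g: "(g has_sum G) B"
  shows "((\<lambda>(x, y). f x * g y) has_sum (F * G)) (A \<times> B)"
proof -
  have fa: "(\<lambda>x. norm (f x)) summable_on A" using has_sum_imp_summable[OF f] by (simp add: summable_on_iff_abs_summable_on_complex)
  have ga: "(\<lambda>x. norm (g x)) summable_on B" using has_sum_imp_summable[OF g] by (simp add: summable_on_iff_abs_summable_on_complex)
  have "(\<lambda>p. norm ((\<lambda>(x, y). f x * g y) p)) summable_on A \<times> B"
  proof (subst Infinite_Sum.abs_summable_on_Sigma_iff, intro conjI ballI)
    show "(\<lambda>y. norm ((\<lambda>(x, y). f x * g y) (x, y))) summable_on B" for x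
      using summable_on_cmult_right[OF ga, of "norm (f x)"] by (simp add: norm_mult)
    have "norm (infsum (\<lambda>y. norm ((\<lambda>(x, y). f x * g y) (x, y))) B) = norm (f x) * infsum (\<lambda>y. norm (g y)) B" for x
      by (simp add: norm_mult infsum_cmult_right' infsum_nonneg)
    then show "(\<lambda>x. norm (infsum (\<lambda>y. norm ((\<lambda>(x, y). f x * g y) (x, y))) B)) summable_on A"
      using summable_on_cmult_left[OF fa] by simp
  qed
  then have "(\<lambda>(x, y). f x * g y) summable_on A \<times> B" by (simp only: summable_on_iff_abs_summable_on_complex)
  then obtain S where S: "((\<lambda>(x, y). f x * g y) has_sum S) (A \<times> B)" by (auto simp: summable_on_def)
  have "((\<lambda>x. f x * G) has_sum S) A"
    by (rule has_sum_SigmaD[OF S]) (use has_sum_cmult_right[OF g] in simp)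
  moreover have "((\<lambda>x. f x * G) has_sum (F * G)) A" by (rule has_sum_cmult_left[OF f])
  ultimately have "S = F * G" by (rule has_sum_unique)
  then show ?thesis using S by simp
qed

lemma exp_has_sum: "((\<lambda>k. z ^ k / fact k) has_sum exp z) UNIV" for z :: complex
proof (rule norm_summable_imp_has_sum)
  have "(\<lambda>k. z ^ k / fact k) sums exp z" using exp_converges[of z] by (simp add: scaleR_conv_of_real field_simps)
  then show "(\<lambda>k. z ^ k / fact k) sums exp z" .
  have "summable (\<lambda>k. norm z ^ k / fact k)" using summable_exp[of "norm z"] by (simp add: field_simps)
  then show "summable (\<lambda>k. norm (z ^ k / fact k))" by (simp add: norm_divide norm_power)
qed

lemma exp_sums_real: "(\<lambda>k. x ^ k / fact k) sums exp x" for x :: real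
  using exp_converges[of x] by (simp add: field_simps)

text \<open>This is exp(s) exp(- s) = 1 for shifted sequences. Regrouping by n = k + l, the inner
  sum is (s - s)^n * v n / n! by the binomial theorem, and only n = 0 survives. The geometric bound
  on v justifies the regrouping.\<close>

lemma exp_convolution_inverse:
  fixes v :: "nat \<Rightarrow> complex" and s :: complex
  assumes v: "\<And>n. norm (v n) \<le> D * q ^ n" and q: "0 \<le> q"
  shows "(\<Sum>k. s ^ k / fact k * (\<Sum>l. (- s) ^ l / fact l * v (k + l))) = v 0"
proof -
  let ?w = "\<lambda>k l. (- s) ^ l / fact l * v (k + l)"
  have D: "0 \<le> D" using v[of 0] norm_ge_zero[of "v 0"] by (simp del: norm_ge_zero)
  define f where "f = (\<lambda>(k, l). s ^ k / fact k * (?w k l))"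
  define x where "x = norm s * q"
  have x: "0 \<le> x" using q by (simp add: x_def)
  \<comment> \<open>The double series is dominated by D times the product of two exponential series
    at x.\<close>
  have xs: "((\<lambda>k. cpx x ^ k / fact k) has_sum exp (cpx x)) UNIV" by (rule exp_has_sum)
  have "((\<lambda>(k, l). cpx x ^ k / fact k * (cpx x ^ l / fact l)) has_sum (exp (cpx x) * exp (cpx x))) (UNIV \<times> UNIV)"
    by (rule has_sum_mult_complex[OF xs xs])
  then have "(\<lambda>p. norm ((\<lambda>(k, l). cpx x ^ k / fact k * (cpx x ^ l / fact l)) p)) summable_on (UNIV \<times> UNIV)"
    using has_sum_imp_summable summable_on_iff_abs_summable_on_complex by blast
  then have "(\<lambda>p. D * norm ((\<lambda>(k, l). cpx x ^ k / fact k * (cpx x ^ l / fact l)) p)) summable_on (UNIV \<times> UNIV)"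
    by (rule summable_on_cmult_right)
  moreover have "norm (f p) \<le> D * norm ((\<lambda>(k, l). cpx x ^ k / fact k * (cpx x ^ l / fact l)) p)" for p
  proof -
    obtain k l where p: "p = (k, l)" by (cases p)
    have "norm (f p) = norm s ^ k / fact k * (norm s ^ l / fact l * norm (v (k + l)))"
      by (simp add: p f_def norm_mult norm_divide norm_power)
    also have "\<dots> \<le> norm s ^ k / fact k * (norm s ^ l / fact l * (D * q ^ (k + l)))"
      by (intro mult_left_mono v) auto
    also have "\<dots> = D * norm ((\<lambda>(k, l). cpx x ^ k / fact k * (cpx x ^ l / fact l)) p)"
      using x q by (simp add: p norm_mult norm_divide norm_power x_def power_mult_distrib power_add)
    finally show ?thesis .
  qed
  ultimately have "(\<lambda>p. norm (f p)) summable_on (UNIV \<times> UNIV)"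
    by (rule summable_on_comparison_test) auto
  then have "f summable_on (UNIV \<times> UNIV)" by (simp only: summable_on_iff_abs_summable_on_complex)
  then obtain S where S: "(f has_sum S) (UNIV \<times> UNIV)" by (auto simp: summable_on_def)
  have inner: "((\<lambda>l. ?w k l) has_sum (\<Sum>l. ?w k l)) UNIV" for k
  proof (rule norm_summable_imp_has_sum)
    have "summable (\<lambda>l. D * q ^ k * (x ^ l / fact l))"
      using exp_sums_real[of x] by (intro summable_mult) (auto simp: sums_iff)
    then show sm: "summable (\<lambda>l. norm (?w k l))"
    proof (rule summable_comparison_test'[where N=0])
      fix l :: nat
      have "norm s ^ l / fact l * norm (v (k + l)) \<le> norm s ^ l / fact l * (D * q ^ (k + l))"
        by (intro mult_left_mono v) auto
      then show "norm (norm (?w k l)) \<le> D * q ^ k * (x ^ l / fact l)"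
        by (simp add: norm_mult norm_divide norm_power x_def power_mult_distrib power_add mult_ac)
    qed
    show "(\<lambda>l. ?w k l) sums (\<Sum>l. ?w k l)"
      using summable_norm_cancel[OF sm] by (rule summable_sums)
  qed
  have 1: "((\<lambda>k. s ^ k / fact k * (\<Sum>l. ?w k l)) has_sum S) UNIV"
  proof (rule has_sum_SigmaD[OF S])
    show "((\<lambda>l. f (k, l)) has_sum (s ^ k / fact k * (\<Sum>l. ?w k l))) UNIV" for k
      unfolding f_def case_prod_conv by (rule has_sum_cmult_right[OF inner])
  qed
  \<comment> \<open>The quadrant of pairs (k, l) becomes the triangle k \<le> n with n = k + l, so
    each inner sum is finite.\<close>
  have "((\<lambda>(n, k). s ^ k / fact k * ((- s) ^ (n - k) / fact (n - k) * v n)) has_sum S) (SIGMA n:UNIV. {..n})"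
    using S unfolding f_def
    by (rule has_sum_reindex_bij_witness[of _ "\<lambda>(n, k). (k, n - k)" "\<lambda>(k, l). (k + l, k)", THEN iffD1, rotated 6]) auto
  then have "((\<lambda>n. \<Sum>k\<le>n. s ^ k / fact k * ((- s) ^ (n - k) / fact (n - k) * v n)) has_sum S) UNIV"
    by (rule has_sum_SigmaD) (auto intro: has_sum_finite)
  moreover have "(\<Sum>k\<le>n. s ^ k / fact k * ((- s) ^ (n - k) / fact (n - k) * v n)) = (if n = 0 then v 0 else 0)" for n
  proof -
    have "(\<Sum>k\<le>n. s ^ k / fact k * ((- s) ^ (n - k) / fact (n - k) * v n)) = (\<Sum>k\<le>n. of_nat (n choose k) * s ^ k * (- s) ^ (n - k)) * (v n / fact n)"
      unfolding sum_distrib_right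
      by (intro sum.cong) (simp_all add: binomial_fact field_simps)
    also have "(\<Sum>k\<le>n. of_nat (n choose k) * s ^ k * (- s) ^ (n - k)) = (s + - s) ^ n" by (rule binomial_ring[symmetric])
    finally show ?thesis by simp
  qed
  ultimately have "((\<lambda>n::nat. if n = 0 then v 0 else 0) has_sum S) UNIV" by simp
  moreover have "((\<lambda>n::nat. if n = 0 then v 0 else 0) has_sum v 0) UNIV"
    by (rule has_sum_finite_neutralI[of "{0}"]) auto
  ultimately have "S = v 0" by (rule has_sum_unique)
  then show ?thesis using has_sum_imp_sums[OF 1] by (simp add: sums_iff)
qed

text \<open>The sign of e counts decay as positive. The bounds for H have e = 1/(2 \<sigma>), those
  for A' have e = - 1/(2 \<sigma>0), so one predicate serves both sides.\<close>

definition bnd :: "real \<Rightarrow> real ^ 'n \<Rightarrow> (nat ^ 'n \<Rightarrow> complex) \<Rightarrow> bool" where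
  "bnd e r u \<longleftrightarrow> (\<exists>C>0. \<forall>\<alpha>. norm (u \<alpha>) \<le> C * (mi_power r \<alpha> * mi_fact \<alpha> powr (- e)))"

lemma mi_fact_pos: "0 < mi_fact \<alpha>" by (simp add: mi_fact_def prod_pos)

lemma mi_power_add_axis: "mi_power r (\<alpha> + axis j m) = mi_power r \<alpha> * (r $ j) ^ m"
  unfolding mi_power_def by (subst (1 2) prod.remove[of _ j]) (auto simp: power_add axis_def mult_ac)

lemma mi_fact_le_add_axis: "mi_fact \<alpha> \<le> mi_fact (\<alpha> + axis j m)"
  unfolding mi_fact_def by (intro prod_mono) (auto simp: fact_mono)

text \<open>\<open>shift j s\<close> describes the effect on \<open>\<beta> \<mapsto> \<integral> G(z) z\<^sup>\<beta>\<close> of multiplying \<open>G\<close> by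
  \<open>exp (s * z\<^sub>j\<^sup>2)\<close>, hence \<open>shift j (- s)\<close> is its inverse.\<close>

definition shift :: "'n \<Rightarrow> complex \<Rightarrow> (nat ^ 'n \<Rightarrow> complex) \<Rightarrow> nat ^ 'n \<Rightarrow> complex" where
  "shift j s u \<alpha> = (\<Sum>k. s ^ k / fact k * u (\<alpha> + axis j (2 * k)))"

text \<open>For e \<ge> 0 the larger factorial only helps and is replaced by that of \<alpha>; what
  remains is geometric growth along the ray.\<close>

lemma bnd_add_axis:
  assumes u: "\<And>\<alpha>. norm (u \<alpha>) \<le> C * (mi_power r \<alpha> * mi_fact \<alpha> powr (- e))" and "0 \<le> C" "0 \<le> e" "positive_radius r"
  shows "norm (u (\<alpha> + axis j (2 * k))) \<le> C * (mi_power r \<alpha> * mi_fact \<alpha> powr (- e)) * ((r $ j)\<^sup>2) ^ k"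
proof -
  have r: "0 < r $ i" for i using assms by (auto simp: positive_radius_def)
  have "norm (u (\<alpha> + axis j (2 * k))) \<le> C * (mi_power r (\<alpha> + axis j (2 * k)) * mi_fact (\<alpha> + axis j (2 * k)) powr (- e))" by (rule u)
  also have "\<dots> \<le> C * (mi_power r (\<alpha> + axis j (2 * k)) * mi_fact \<alpha> powr (- e))"
    using assms mi_fact_pos[of \<alpha>] r by (intro mult_left_mono powr_mono2' mi_fact_le_add_axis mi_power_nonneg) (auto simp: less_imp_le)
  finally show ?thesis unfolding mi_power_add_axis power_mult[of "r $ j" 2 k] by (simp only: mult_ac)
qed

text \<open>Geometric growth along the ray sums to the factor exp(|s| r_j^2), independent of
  \<alpha>. Hence only the constant changes and the radius r is kept.\<close>

lemma bnd_shift: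
  assumes "bnd e r u" "0 \<le> e" "positive_radius r"
  shows "bnd e r (shift j s u)"
proof -
  from assms obtain C where C: "C > 0" "\<And>\<alpha>. norm (u \<alpha>) \<le> C * (mi_power r \<alpha> * mi_fact \<alpha> powr (- e))" unfolding bnd_def by blast
  define x where "x = norm s * (r $ j)\<^sup>2"
  have "norm (shift j s u \<alpha>) \<le> (C * exp x) * (mi_power r \<alpha> * mi_fact \<alpha> powr (- e))" for \<alpha>
  proof -
    let ?K = "C * (mi_power r \<alpha> * mi_fact \<alpha> powr (- e))"
    have le: "norm (s ^ k / fact k * u (\<alpha> + axis j (2 * k))) \<le> ?K * (x ^ k / fact k)" for k
    proof -
      have "norm (s ^ k / fact k * u (\<alpha> + axis j (2 * k))) \<le> norm s ^ k / fact k * (?K * ((r $ j)\<^sup>2) ^ k)"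
        unfolding norm_mult norm_divide norm_power norm_fact
        using bnd_add_axis[OF C(2) less_imp_le[OF C(1)] assms(2,3)] by (intro mult_left_mono) auto
      then show ?thesis by (simp add: x_def power_mult_distrib mult_ac)
    qed
    have sm: "(\<lambda>k. ?K * (x ^ k / fact k)) sums (?K * exp x)" by (intro sums_mult exp_sums_real)
    have "norm (shift j s u \<alpha>) \<le> (\<Sum>k. ?K * (x ^ k / fact k))"
      unfolding shift_def using le sm by (intro norm_suminf_le) (auto simp: sums_iff)
    then show ?thesis using sm by (simp add: sums_iff mult_ac)
  qed
  then show ?thesis unfolding bnd_def using C(1) by (intro exI[of _ "C * exp x"]) auto
qed

text \<open>Only the values along the ray \<alpha>, \<alpha> + 2 e_j, \<alpha> + 4 e_j, ... enter,
  which reduces the claim to \<open>exp_convolution_inverse\<close>.\<close>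

lemma shift_inverse:
  assumes "bnd e r u" "0 \<le> e" "positive_radius r"
  shows "shift j s (shift j (- s) u) = u"
proof
  fix \<alpha>
  from assms obtain C where C: "C > 0" "\<And>\<alpha>. norm (u \<alpha>) \<le> C * (mi_power r \<alpha> * mi_fact \<alpha> powr (- e))" unfolding bnd_def by blast
  define v where "v n = u (\<alpha> + axis j (2 * n))" for n
  have ax: "\<alpha> + axis j (2 * k) + axis j (2 * l) = \<alpha> + axis j (2 * (k + l))" for k l
    by (auto simp: vec_eq_iff axis_def)
  have "shift j s (shift j (- s) u) \<alpha> = (\<Sum>k. s ^ k / fact k * (\<Sum>l. (- s) ^ l / fact l * v (k + l)))"
    unfolding shift_def v_def ax ..
  also have "\<dots> = v 0"
    by (rule exp_convolution_inverse[of _ "C * (mi_power r \<alpha> * mi_fact \<alpha> powr (- e))" "(r $ j)\<^sup>2"])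
      (use bnd_add_axis[OF C(2) less_imp_le[OF C(1)] assms(2,3)] in \<open>auto simp: v_def\<close>)
  also have "\<dots> = u \<alpha>"
  proof -
    have "\<alpha> + axis j (2 * 0) = \<alpha>" by (simp add: vec_eq_iff axis_def)
    then show ?thesis by (simp only: v_def)
  qed
  finally show "shift j s (shift j (- s) u) \<alpha> = u \<alpha>" .
qed

text \<open>Plain Taylor coefficients, without the divisor sqrt(\<alpha>!) of
  \<open>has_power_series\<close>, so that products of series have the usual Cauchy
  coefficients.\<close>

definition powser :: "(complex ^ 'n \<Rightarrow> complex) \<Rightarrow> (nat ^ 'n \<Rightarrow> complex) \<Rightarrow> bool" where
  "powser F a \<longleftrightarrow> (\<forall>z. ((\<lambda>\<alpha>. a \<alpha> * mi_power z \<alpha>) has_sum F z) UNIV)"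

text \<open>Cauchy product with the series of exp(s z_j^2). The condition on k makes the truncated
  subtraction of multi-indices a genuine one.\<close>

definition exp_mult_coeff :: "'n \<Rightarrow> complex \<Rightarrow> (nat ^ 'n \<Rightarrow> complex) \<Rightarrow> nat ^ 'n \<Rightarrow> complex" where
  "exp_mult_coeff j s a \<alpha> = (\<Sum>k | 2 * k \<le> \<alpha> $ j. s ^ k / fact k * a (\<alpha> - axis j (2 * k)))"

lemma finite_double_le: "finite {k::nat. 2 * k \<le> n}"
  by (rule finite_subset[of _ "{..n}"]) auto

lemma powser_exp_mult:
  fixes F :: "complex ^ 'n \<Rightarrow> complex"
  assumes "powser F a"
  shows "powser (\<lambda>z. exp (s * (z $ j)\<^sup>2) * F z) (exp_mult_coeff j s a)"
  unfolding powser_def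
proof
  fix z :: "complex ^ 'n"
  have e: "((\<lambda>k. (s * (z $ j)\<^sup>2) ^ k / fact k) has_sum exp (s * (z $ j)\<^sup>2)) UNIV" by (rule exp_has_sum)
  have "((\<lambda>(k, \<beta>). (s * (z $ j)\<^sup>2) ^ k / fact k * (a \<beta> * mi_power z \<beta>)) has_sum (exp (s * (z $ j)\<^sup>2) * F z)) (UNIV \<times> UNIV)"
    using assms unfolding powser_def by (intro has_sum_mult_complex[OF e]) blast
  then have "((\<lambda>(\<alpha>, k). s ^ k / fact k * a (\<alpha> - axis j (2 * k)) * mi_power z \<alpha>) has_sum (exp (s * (z $ j)\<^sup>2) * F z)) (SIGMA \<alpha>:UNIV. {k. 2 * k \<le> \<alpha> $ j})"
  proof (rule has_sum_reindex_bij_witness[of _ "\<lambda>(\<alpha>, k). (k, \<alpha> - axis j (2 * k))" "\<lambda>(k, \<beta>). (\<beta> + axis j (2 * k), k)", THEN iffD1, rotated 6])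
    fix p :: "nat \<times> (nat ^ 'n)"
    obtain k \<beta> where p: "p = (k, \<beta>)" by (cases p)
    have "\<beta> + axis j (2 * k) - axis j (2 * k) = \<beta>" by (simp add: vec_eq_iff)
    then show "(case case p of (k, \<beta>) \<Rightarrow> (\<beta> + axis j (2 * k), k) of (\<alpha>, k) \<Rightarrow> (k, \<alpha> - axis j (2 * k))) = p"
      and "(case case p of (k, \<beta>) \<Rightarrow> (\<beta> + axis j (2 * k), k) of (\<alpha>, k) \<Rightarrow> s ^ k / fact k * a (\<alpha> - axis j (2 * k)) * mi_power z \<alpha>) = (case p of (k, \<beta>) \<Rightarrow> (s * (z $ j)\<^sup>2) ^ k / fact k * (a \<beta> * mi_power z \<beta>))"
      by (simp_all add: p mi_power_add_axis power_mult_distrib power_mult)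
    show "(case p of (k, \<beta>) \<Rightarrow> (\<beta> + axis j (2 * k), k)) \<in> (SIGMA \<alpha>:UNIV. {k. 2 * k \<le> \<alpha> $ j})"
      by (simp add: p axis_def)
  next
    fix q :: "(nat ^ 'n) \<times> nat" assume q: "q \<in> (SIGMA \<alpha>:UNIV. {k. 2 * k \<le> \<alpha> $ j})"
    then show "(case case q of (\<alpha>, k) \<Rightarrow> (k, \<alpha> - axis j (2 * k)) of (k, \<beta>) \<Rightarrow> (\<beta> + axis j (2 * k), k)) = q"
      by (auto simp: vec_eq_iff axis_def)
  qed auto
  then show "((\<lambda>\<alpha>. exp_mult_coeff j s a \<alpha> * mi_power z \<alpha>) has_sum (exp (s * (z $ j)\<^sup>2) * F z)) UNIV"
  proof (rule has_sum_SigmaD)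
    fix \<alpha> :: "nat ^ 'n"
    show "((\<lambda>k. case (\<alpha>, k) of (\<alpha>, k) \<Rightarrow> s ^ k / fact k * a (\<alpha> - axis j (2 * k)) * mi_power z \<alpha>) has_sum exp_mult_coeff j s a \<alpha> * mi_power z \<alpha>) {k. 2 * k \<le> \<alpha> $ j}"
      unfolding exp_mult_coeff_def sum_distrib_right using finite_double_le by (simp add: has_sum_finite)
  qed
qed

section \<open>Factorial estimates for multiplication by exponentials\<close>

lemma choose_le_pow2: "n choose k \<le> 2 ^ n"
proof (cases "k \<le> n")
  case True
  have "n choose k \<le> (\<Sum>i\<le>n. n choose i)" using True by (intro member_le_sum) auto
  then show ?thesis by (simp add: choose_row_sum)
qed (simp add: binomial_eq_0)

text \<open>Write n! = (n - 2k)! (2k)! binom(n, 2k) and (2k)! = binom(2k, k) k!^2, and bound the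
  binomials by powers of 2. The factor k!^2 is the one that matters later.\<close>

lemma fact_le_diff:
  assumes "2 * k \<le> n"
  shows "(fact n :: real) \<le> fact (n - 2 * k) * (2 ^ n * (4 ^ k * (fact k)\<^sup>2))"
proof -
  have c: "real (n choose m) \<le> 2 ^ n" for n m
    using choose_le_pow2[of n m] by (metis of_nat_le_iff of_nat_numeral of_nat_power)
  have 1: "(fact n :: real) = fact (n - 2 * k) * (real (n choose (2 * k)) * fact (2 * k))"
    using assms by (simp add: binomial_fact)
  have "(fact (2 * k) :: real) = real ((2 * k) choose k) * (fact k)\<^sup>2"
    by (simp add: binomial_fact power2_eq_square)
  also have "\<dots> \<le> 2 ^ (2 * k) * (fact k)\<^sup>2" by (intro mult_right_mono c) auto
  finally have 2: "(fact (2 * k) :: real) \<le> 4 ^ k * (fact k)\<^sup>2" by (simp add: power_mult)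
  show ?thesis unfolding 1 by (intro mult_left_mono mult_mono c 2) auto
qed

lemma mi_fact_le_diff:
  assumes "2 * k \<le> \<alpha> $ j"
  shows "mi_fact \<alpha> \<le> mi_fact (\<alpha> - axis j (2 * k)) * (2 ^ (\<alpha> $ j) * (4 ^ k * (fact k)\<^sup>2))"
proof -
  define P where "P = (\<Prod>i\<in>UNIV - {j}. fact (\<alpha> $ i) :: real)"
  have P: "P \<ge> 0" unfolding P_def by (intro prod_nonneg) auto
  have 1: "mi_fact \<alpha> = fact (\<alpha> $ j) * P" unfolding mi_fact_def P_def by (subst prod.remove[of _ j]) auto
  have 2: "mi_fact (\<alpha> - axis j (2 * k)) = fact (\<alpha> $ j - 2 * k) * P" unfolding mi_fact_def P_def
    by (subst prod.remove[of _ j]) (auto simp: axis_def)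
  show ?thesis unfolding 1 2 using mult_right_mono[OF fact_le_diff[OF assms] P] by (simp add: mult_ac)
qed

lemma summable_power_fact_powr:
  assumes "0 < e" "0 \<le> x" shows "summable (\<lambda>k. x ^ k * fact k powr (- e) :: real)"
proof -
  \<comment> \<open>From this index on (n + 1)^e is at least 2 (x + 1), so consecutive terms shrink
    by a factor 1/2.\<close>
  define N where "N = nat \<lceil>(2 * (x + 1)) powr (1 / e)\<rceil>"
  show ?thesis
  proof (rule summable_ratio_test[of "1/2" N])
    fix n :: nat assume n: "n \<ge> N"
    have "(2 * (x + 1)) powr (1 / e) \<le> real n" using n unfolding N_def by linarith
    then have "((2 * (x + 1)) powr (1 / e)) powr e \<le> (real (Suc n)) powr e"
      using assms by (intro powr_mono2) auto
    then have "2 * (x + 1) \<le> real (Suc n) powr e" using assms by (simp add: powr_powr)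
    then have "x \<le> 1/2 * real (Suc n) powr e" by (rule order_trans[rotated, OF mult_left_mono]) auto
    then have xe: "x * real (Suc n) powr (- e) \<le> 1/2"
      by (simp add: powr_minus divide_simps)
    have "x ^ Suc n * fact (Suc n) powr (- e) = (x * real (Suc n) powr (- e)) * (x ^ n * fact n powr (- e))"
      by (simp add: powr_mult mult_ac)
    also have "\<dots> \<le> 1/2 * (x ^ n * fact n powr (- e))"
      using xe assms by (intro mult_right_mono) auto
    finally show "norm (x ^ Suc n * fact (Suc n) powr (- e)) \<le> 1/2 * norm (x ^ n * fact n powr (- e))"
      using assms by simp
  qed simp
qed

text \<open>Lowering the index by 2k costs k!^(2e) in the factorial bound, while the exponential
  series contributes 1/k!. The balance k!^(-(1 - 2e)) is summable against geometric growth precisely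
  because e < 1/2. The remaining factor 2^(\<alpha>_j) goes into the doubled radius.\<close>

lemma bnd_exp_mult_coeff:
  assumes b: "bnd e r a" and e: "0 < e" "e < 1/2" and r: "positive_radius r"
  shows "bnd e (\<chi> i. 2 * r $ i) (exp_mult_coeff j s a)"
proof -
  from b obtain C where C: "C > 0" "\<And>\<alpha>. norm (a \<alpha>) \<le> C * (mi_power r \<alpha> * mi_fact \<alpha> powr (- e))" unfolding bnd_def by blast
  have r': "0 < r $ i" for i using r by (auto simp: positive_radius_def)
  \<comment> \<open>Collects all k-th powers: |s| from the exponential, 4^e from
    \<open>mi_fact_le_diff\<close>, and r_j^(-2) from the lowered power of the radius.\<close>
  define x where "x = norm s * 4 powr e / (r $ j)\<^sup>2"
  have x: "x \<ge> 0" by (simp add: x_def)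
  define w where "w k = x ^ k * fact k powr (- (1 - 2 * e))" for k :: nat
  have sw: "summable w" unfolding w_def[abs_def] using e x by (intro summable_power_fact_powr) auto
  have w0: "0 \<le> w k" for k using x by (simp add: w_def)
  define K where "K = suminf w + 1"
  have K: "K > 0" unfolding K_def using suminf_nonneg[OF sw w0] by simp
  have "norm (exp_mult_coeff j s a \<alpha>) \<le> (C * K) * (mi_power (\<chi> i. 2 * r $ i) \<alpha> * mi_fact \<alpha> powr (- e))" for \<alpha>
  proof -
    let ?A = "mi_power r \<alpha> * 2 ^ (\<alpha> $ j) * mi_fact \<alpha> powr (- e)"
    have A: "0 \<le> ?A" using r' by (intro mult_nonneg_nonneg mi_power_nonneg) (auto simp: less_imp_le)
    have le: "norm (s ^ k / fact k * a (\<alpha> - axis j (2 * k))) \<le> C * ?A * w k" if k: "2 * k \<le> \<alpha> $ j" for k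
    proof -
      define \<beta> where "\<beta> = \<alpha> - axis j (2 * k)"
      have \<alpha>: "\<alpha> = \<beta> + axis j (2 * k)" using k by (auto simp: \<beta>_def vec_eq_iff axis_def)
      have mp: "mi_power r \<beta> = mi_power r \<alpha> / ((r $ j)\<^sup>2) ^ k"
        unfolding \<alpha> mi_power_add_axis using r'[of j] by (simp add: power_mult)
      define Z where "Z = 2 ^ (\<alpha> $ j) * (4 ^ k * (fact k)\<^sup>2 :: real)"
      have Z: "Z > 0" by (simp add: Z_def)
      have "mi_fact \<alpha> / Z \<le> mi_fact \<beta>" using mi_fact_le_diff[OF k] Z unfolding \<beta>_def[symmetric] Z_def[symmetric] by (simp add: divide_simps)
      then have "mi_fact \<beta> powr (- e) \<le> (mi_fact \<alpha> / Z) powr (- e)"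
        using e Z mi_fact_pos[of \<alpha>] by (intro powr_mono2') auto
      also have "\<dots> = mi_fact \<alpha> powr (- e) * Z powr e"
        using Z mi_fact_pos[of \<alpha>] by (simp add: powr_divide powr_minus divide_simps)
      also have "Z powr e = (2 ^ (\<alpha> $ j)) powr e * ((4 powr e) ^ k * fact k powr (2 * e))"
      proof -
        have "((4::real) ^ k) powr e = (4 powr e) ^ k" 
        proof -
          have "((4::real) powr real k) powr e = (4 powr e) powr real k" by (simp only: powr_powr mult.commute)
          then show ?thesis by (simp add: powr_realpow)
        qed
        moreover have "((fact k)\<^sup>2 :: real) powr e = fact k powr (2 * e)" 
        proof -
          have "((fact k :: real) powr 2) powr e = fact k powr (2 * e)" by (simp only: powr_powr)
          then show ?thesis by simp
        qed
        ultimately show ?thesis by (simp add: Z_def powr_mult)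
      qed
      also have "(2 ^ (\<alpha> $ j) :: real) powr e \<le> 2 ^ (\<alpha> $ j)"
        using e powr_mono[of e 1 "2 ^ (\<alpha> $ j) :: real"] by simp
      finally have mf: "mi_fact \<beta> powr (- e) \<le> mi_fact \<alpha> powr (- e) * (2 ^ (\<alpha> $ j) * ((4 powr e) ^ k * fact k powr (2 * e)))"
        by (simp add: mult_left_mono mult_right_mono)
      have "norm (s ^ k / fact k * a \<beta>) = norm s ^ k / fact k * norm (a \<beta>)" by (simp add: norm_mult norm_divide norm_power)
      also have "\<dots> \<le> norm s ^ k / fact k * (C * (mi_power r \<beta> * mi_fact \<beta> powr (- e)))"
        by (intro mult_left_mono C) auto
      also have "\<dots> \<le> norm s ^ k / fact k * (C * (mi_power r \<beta> * (mi_fact \<alpha> powr (- e) * (2 ^ (\<alpha> $ j) * ((4 powr e) ^ k * fact k powr (2 * e))))))"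
        using C r' mf by (intro mult_left_mono mi_power_nonneg) (auto simp: less_imp_le)
      also have "\<dots> = C * ?A * (x ^ k * (fact k powr (2 * e) / fact k))"
        unfolding mp x_def by (simp add: power_mult_distrib power_divide mult_ac)
      also have "fact k powr (2 * e) / fact k = fact k powr (- (1 - 2 * e))"
        by (simp add: powr_diff)
      finally show ?thesis by (simp add: \<beta>_def w_def)
    qed
    have "norm (exp_mult_coeff j s a \<alpha>) \<le> (\<Sum>k | 2 * k \<le> \<alpha> $ j. C * ?A * w k)"
      unfolding exp_mult_coeff_def by (rule sum_norm_le) (use le in auto)
    also have "\<dots> = C * ?A * (\<Sum>k | 2 * k \<le> \<alpha> $ j. w k)" by (simp add: sum_distrib_left)
    also have "\<dots> \<le> C * ?A * K"
      using sum_le_suminf[OF sw finite_double_le] w0 A C unfolding K_def by (intro mult_left_mono) (auto intro: add_increasing2)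
    also have "\<dots> = C * K * (mi_power r \<alpha> * 2 ^ (\<alpha> $ j) * mi_fact \<alpha> powr (- e))" by (simp only: mult_ac)
    also have "\<dots> \<le> C * K * (mi_power (\<chi> i. 2 * r $ i) \<alpha> * mi_fact \<alpha> powr (- e))"
    proof -
      have "2 ^ (\<alpha> $ j) \<le> (\<Prod>i\<in>UNIV. 2 ^ (\<alpha> $ i) :: real)"
        by (subst prod.remove[of _ j]) (auto simp: prod_ge_1)
      then have "mi_power r \<alpha> * 2 ^ (\<alpha> $ j) \<le> mi_power r \<alpha> * (\<Prod>i\<in>UNIV. 2 ^ (\<alpha> $ i))"
        using r' by (intro mult_left_mono mi_power_nonneg) (auto simp: less_imp_le)
      also have "\<dots> = mi_power (\<chi> i. 2 * r $ i) \<alpha>" by (simp add: mi_power_def power_mult_distrib prod.distrib)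
      finally show ?thesis using C K by (intro mult_left_mono mult_right_mono) auto
    qed
    finally show ?thesis .
  qed
  then show ?thesis unfolding bnd_def using C K by (intro exI[of _ "C * K"]) auto
qed

text \<open>Estimate for diagonal maps: multiplication or division by moments and by the square
  roots of factorials.\<close>

lemma bnd_rescale:
  assumes b: "bnd e r u" and w: "positive_radius w" and r: "positive_radius r" and K: "0 < K"
    and u': "\<And>\<alpha>. norm (u' \<alpha>) \<le> K * (mi_power w \<alpha> * mi_fact \<alpha> powr d) * norm (u \<alpha>)"
  shows "bnd (e - d) (\<chi> i. w $ i * r $ i) u'"
proof -
  from b obtain C where C: "C > 0" "\<And>\<alpha>. norm (u \<alpha>) \<le> C * (mi_power r \<alpha> * mi_fact \<alpha> powr (- e))" unfolding bnd_def by blast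
  have "norm (u' \<alpha>) \<le> (K * C) * (mi_power (\<chi> i. w $ i * r $ i) \<alpha> * mi_fact \<alpha> powr (- (e - d)))" for \<alpha>
  proof -
    have "norm (u' \<alpha>) \<le> K * (mi_power w \<alpha> * mi_fact \<alpha> powr d) * norm (u \<alpha>)" by (rule u')
    also have "\<dots> \<le> K * (mi_power w \<alpha> * mi_fact \<alpha> powr d) * (C * (mi_power r \<alpha> * mi_fact \<alpha> powr (- e)))"
      using K w by (intro mult_left_mono C mult_nonneg_nonneg mi_power_nonneg) (auto simp: positive_radius_def less_imp_le)
    also have "\<dots> = (K * C) * ((mi_power w \<alpha> * mi_power r \<alpha>) * (mi_fact \<alpha> powr d * mi_fact \<alpha> powr (- e)))"
      by (simp only: mult_ac)
    also have "mi_power w \<alpha> * mi_power r \<alpha> = mi_power (\<chi> i. w $ i * r $ i) \<alpha>"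
      by (simp add: mi_power_def prod.distrib power_mult_distrib)
    also have "mi_fact \<alpha> powr d * mi_fact \<alpha> powr (- e) = mi_fact \<alpha> powr (- (e - d))"
      by (simp add: powr_add[symmetric])
    finally show ?thesis .
  qed
  then show ?thesis unfolding bnd_def using C K by (intro exI[of _ "K * C"]) auto
qed

section \<open>Weighted integrals of power series\<close>

primrec shifts :: "complex \<Rightarrow> 'n list \<Rightarrow> (nat ^ 'n \<Rightarrow> complex) \<Rightarrow> nat ^ 'n \<Rightarrow> complex" where
  "shifts s [] u = u"
| "shifts s (j # js) u = shift j s (shifts s js u)"

lemma shifts_append: "shifts s (js @ js') u = shifts s js (shifts s js' u)"
  by (induction js) auto

lemma bnd_shifts: "bnd e r u \<Longrightarrow> 0 \<le> e \<Longrightarrow> positive_radius r \<Longrightarrow> bnd e r (shifts s js u)"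
  by (induction js) (auto intro: bnd_shift)

text \<open>Reversing the list makes the shifts cancel from the inside out, so commutation of
  different coordinates is never invoked.\<close>

lemma shifts_inverse:
  "bnd e r u \<Longrightarrow> 0 \<le> e \<Longrightarrow> positive_radius r \<Longrightarrow> shifts s js (shifts (- s) (rev js) u) = u"
proof (induction js arbitrary: u)
  case (Cons j js)
  then show ?case by (simp add: shifts_append bnd_shift shift_inverse)
qed simp

text \<open>An enumeration of the multi-indices turns unordered sums into limits of sequences, the
  form suited to measurability and dominated convergence.\<close>

definition mi_enum :: "nat \<Rightarrow> nat ^ 'n" where
  "mi_enum = from_nat_into UNIV"

lemma bij_mi_enum: "bij_betw (mi_enum :: nat \<Rightarrow> nat ^ 'n) UNIV UNIV"
proof -
  have "inj (\<lambda>k::nat. (\<chi> i. k) :: nat ^ 'n)" by (auto simp: inj_def vec_eq_iff)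
  then have "infinite (UNIV :: (nat ^ 'n) set)"
    using finite_imageD[of "\<lambda>k::nat. (\<chi> i. k) :: nat ^ 'n" UNIV] finite_subset[OF subset_UNIV] by blast
  then show ?thesis unfolding mi_enum_def by (intro bij_betw_from_nat_into) auto
qed

lemma powser_sums:
  assumes "powser F a" shows "(\<lambda>n. a (mi_enum n) * mi_power z (mi_enum n)) sums F z"
proof -
  have "((\<lambda>\<alpha>. a \<alpha> * mi_power z \<alpha>) has_sum F z) UNIV" using assms by (simp add: powser_def)
  then have "((\<lambda>n. a (mi_enum n) * mi_power z (mi_enum n)) has_sum F z) UNIV"
    by (subst has_sum_reindex_bij_betw[OF bij_mi_enum])
  then show ?thesis by (rule has_sum_imp_sums)
qed

text \<open>The absolute series at the corner point with coordinates R_j majorises all partial sums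
  on the whole closed polydisc.\<close>

lemma powser_partial_sum_bound:
  fixes F :: "complex ^ 'n \<Rightarrow> complex"
  assumes F: "powser F a" and R: "\<And>j. 0 \<le> R $ j"
  obtains B where "0 \<le> B" 
    "\<And>N z. (\<And>j. cmod (z $ j) \<le> R $ j) \<Longrightarrow> norm (\<Sum>n<N. a (mi_enum n) * mi_power z (mi_enum n)) \<le> B"
    "\<And>z. (\<And>j. cmod (z $ j) \<le> R $ j) \<Longrightarrow> norm (F z) \<le> B"
proof -
  let ?S = "\<lambda>N z. \<Sum>n<N. a (mi_enum n) * mi_power z (mi_enum n)"
  let ?t = "\<lambda>z n. norm (a (mi_enum n) * mi_power z (mi_enum n))"
  define z0 :: "complex ^ 'n" where "z0 = (\<chi> j. cpx (R $ j))"
  have "(\<lambda>\<alpha>. a \<alpha> * mi_power z0 \<alpha>) summable_on UNIV" using F unfolding powser_def by (meson has_sum_imp_summable)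
  then have "(\<lambda>\<alpha>. norm (a \<alpha> * mi_power z0 \<alpha>)) summable_on UNIV" by (simp add: summable_on_iff_abs_summable_on_complex)
  then have "(\<lambda>n. ?t z0 n) summable_on UNIV"
    by (subst summable_on_reindex_bij_betw[OF bij_mi_enum])
  then have sm: "summable (\<lambda>n. ?t z0 n)" by (rule summable_on_imp_summable)
  define B where "B = suminf (\<lambda>n. ?t z0 n)"
  have B0: "0 \<le> B" unfolding B_def using sm by (intro suminf_nonneg) auto
  have B: "norm (?S N z) \<le> B" if z: "\<And>j. cmod (z $ j) \<le> R $ j" for N z
  proof -
    have "norm (?S N z) \<le> (\<Sum>n<N. ?t z0 n)"
    proof (rule sum_norm_le)
      fix n
      show "norm (a (mi_enum n) * mi_power z (mi_enum n)) \<le> ?t z0 n"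
        unfolding norm_mult norm_mi_power using z R by (intro mult_left_mono mi_power_mono) (auto simp: z0_def)
    qed
    also have "\<dots> \<le> B" unfolding B_def using sm by (intro sum_le_suminf) auto
    finally show ?thesis .
  qed
  have "norm (F z) \<le> B" if z: "\<And>j. cmod (z $ j) \<le> R $ j" for z
  proof (rule Lim_bounded)
    show "(\<lambda>N. norm (?S N z)) \<longlonglongrightarrow> norm (F z)"
      using powser_sums[OF F, of z] unfolding sums_def by (rule tendsto_norm)
    show "\<forall>N\<ge>0. norm (?S N z) \<le> B" using B[OF z] by simp
  qed
  with B0 B that show ?thesis by blast
qed

text \<open>A pointwise limit of polynomials is Borel, so continuity of the sum need not be
  established.\<close>

lemma powser_zbar_measurable:
  fixes F :: "complex ^ 'n \<Rightarrow> complex"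
  assumes F: "powser F a"
  shows "(\<lambda>p :: 'n phase. F (zbar p)) \<in> borel_measurable borel"
proof (rule borel_measurable_LIMSEQ_metric)
  show "(\<lambda>p :: 'n phase. \<Sum>n<N. a (mi_enum n) * mi_power (zbar p) (mi_enum n)) \<in> borel_measurable borel" for N
    by (intro borel_measurable_continuous_onI continuous_intros)
  show "(\<lambda>N. \<Sum>n<N. a (mi_enum n) * mi_power (zbar p) (mi_enum n)) \<longlonglongrightarrow> F (zbar p)" for p :: "'n phase"
    using powser_sums[OF F, of "zbar p"] unfolding sums_def .
qed

context radial_weight
begin

lemma integral_weight_tendsto:
  fixes g :: "nat \<Rightarrow> 'n phase \<Rightarrow> complex"
  assumes [measurable]: "\<And>n. g n \<in> borel_measurable borel" "G \<in> borel_measurable borel"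
    and B: "\<And>n p. k p \<noteq> 0 \<Longrightarrow> norm (g n p) \<le> B" and lim: "\<And>p. k p \<noteq> 0 \<Longrightarrow> (\<lambda>n. g n p) \<longlonglongrightarrow> G p"
    and "0 \<le> B"
  shows "(\<lambda>n. (LINT p|lborel. cpx (k p) * g n p)) \<longlonglongrightarrow> (LINT p|lborel. cpx (k p) * G p)"
proof (rule integral_dominated_convergence[OF _ _ integrable_indicator_phase_box[of "M * B"]])
  show "AE p in lborel. (\<lambda>n. cpx (k p) * g n p) \<longlonglongrightarrow> cpx (k p) * G p"
  proof (rule AE_I2)
    fix p show "(\<lambda>n. cpx (k p) * g n p) \<longlonglongrightarrow> cpx (k p) * G p"
      by (cases "k p = 0") (auto intro!: tendsto_mult lim)
  qed
  show "AE p in lborel. norm (cpx (k p) * g n p) \<le> M * B * indicator phase_box p" for n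
  proof (rule AE_I2)
    fix p show "norm (cpx (k p) * g n p) \<le> M * B * indicator phase_box p"
    proof (cases "k p = 0")
      case False
      then have "p \<in> phase_box" using k_outside by blast
      then show ?thesis using B[OF False, of n] k_nonneg[of p] k_le[of p] M_nonneg mult_mono[of "k p" M "norm (g n p)" B]
        by (simp add: norm_mult)
    qed (simp add: M_nonneg \<open>0 \<le> B\<close>)
  qed
qed measurable

text \<open>The set J records which coordinates already carry their exponential factor, so that the
  factors can be inserted one at a time.\<close>

definition weighted_integral :: "complex \<Rightarrow> (complex ^ 'n \<Rightarrow> complex) \<Rightarrow> 'n set \<Rightarrow> nat ^ 'n \<Rightarrow> complex" where
  "weighted_integral s F J \<beta> = (LINT p|lborel. cpx (k p) *
     (cpx (exp (- sq_phase p / 4)) * F (zbar p) * (\<Prod>j\<in>J. exp (s * (zvec p $ j)\<^sup>2)) * mi_power (zvec p) \<beta>))"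

lemma k_inside: "k p \<noteq> 0 \<Longrightarrow> p \<in> phase_box"
  using k_outside by blast

lemma k_support_zbar: "k p \<noteq> 0 \<Longrightarrow> cmod (zbar p $ j) \<le> T $ j"
  unfolding zbar_nth complex_mod_cnj by (rule k_support)

text \<open>Integrate the series of F term by term; the weight is still radial, so orthogonality
  leaves the single term of index \<beta>.\<close>

lemma weighted_integral_empty:
  assumes F: "powser F a"
  shows "weighted_integral s F {} \<beta> = moment \<beta> * a \<beta>"
proof -
  let ?e = "\<lambda>p. cpx (exp (- sq_phase p / 4)) * mi_power (zvec p) \<beta>"
  obtain B where B: "0 \<le> B" "\<And>N z. (\<And>j. cmod (z $ j) \<le> T $ j) \<Longrightarrow> norm (\<Sum>n<N. a (mi_enum n) * mi_power z (mi_enum n)) \<le> B"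
    using powser_partial_sum_bound[OF F, of T] T_pos by (metis less_imp_le)
  have cont: "continuous_on UNIV (\<lambda>p. ?e p)"
    by (intro continuous_intros) auto
  from continuous_bounded_phase_box[OF cont] obtain B1 where
    B1: "0 \<le> B1" "\<And>p. p \<in> phase_box \<Longrightarrow> norm (?e p) \<le> B1" by blast
  define g where "g N p = (\<Sum>n<N. a (mi_enum n) * mi_power (zbar p) (mi_enum n)) *
     (?e p)" for N p
  define G where "G p = F (zbar p) * (?e p)" for p
  have lim: "(\<lambda>N. (LINT p|lborel. cpx (k p) * g N p)) \<longlonglongrightarrow> (LINT p|lborel. cpx (k p) * G p)"
  proof (rule integral_weight_tendsto)
    show "g N \<in> borel_measurable borel" for N unfolding g_def
      by (intro borel_measurable_continuous_onI continuous_intros) auto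
    show "G \<in> borel_measurable borel" unfolding G_def
      by (intro borel_measurable_times powser_zbar_measurable[OF F] borel_measurable_continuous_onI[OF cont])
    show "norm (g N p) \<le> B * B1" if "k p \<noteq> 0" for N p
      unfolding g_def norm_mult[of "sum _ _"]
      using that B(1) by (intro mult_mono B B1 k_support_zbar k_inside) auto
    show "(\<lambda>N. g N p) \<longlonglongrightarrow> G p" for p unfolding g_def G_def
      using powser_sums[OF F, of "zbar p"] unfolding sums_def by (intro tendsto_mult tendsto_const)
    show "0 \<le> B * B1" using B B1 by simp
  qed
  have gN: "(LINT p|lborel. cpx (k p) * g N p) = (\<Sum>n<N. if mi_enum n = \<beta> then moment \<beta> * a \<beta> else 0)" for N
  proof -
    define h where "h \<alpha> p = cpx (exp (- sq_phase p / 4)) * mi_power (zbar p) \<alpha> * mi_power (zvec p) \<beta>" for \<alpha> :: "nat^'n" and p :: "'n phase"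
    have ih: "integrable lborel (\<lambda>p. cpx (k p) * h \<alpha> p)" for \<alpha>
    proof -
      have c: "continuous_on UNIV (h \<alpha>)" unfolding h_def by (intro continuous_intros) auto
      from continuous_bounded_phase_box[OF c] obtain B where "0 \<le> B" "\<And>p. p \<in> phase_box \<Longrightarrow> norm (h \<alpha> p) \<le> B" by blast
      then show ?thesis using borel_measurable_continuous_onI[OF c] by (intro integrable_weight[of _ B]) auto
    qed
    have "cpx (k p) * g N p = (\<Sum>n<N. a (mi_enum n) * (cpx (k p) * h (mi_enum n) p))" for p
      unfolding g_def h_def sum_distrib_left sum_distrib_right by (intro sum.cong) (simp_all add: mult_ac)
    then have "(LINT p|lborel. cpx (k p) * g N p) = (LINT p|lborel. (\<Sum>n<N. a (mi_enum n) * (cpx (k p) * h (mi_enum n) p)))"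
      by simp
    also have "\<dots> = (\<Sum>n<N. a (mi_enum n) * (LINT p|lborel. cpx (k p) * h (mi_enum n) p))"
      using ih by (subst Bochner_Integration.integral_sum) auto
    also have "\<dots> = (\<Sum>n<N. if mi_enum n = \<beta> then moment \<beta> * a \<beta> else 0)"
    proof (intro sum.cong refl)
      fix n
      show "a (mi_enum n) * (LINT p|lborel. cpx (k p) * h (mi_enum n) p) = (if mi_enum n = \<beta> then moment \<beta> * a \<beta> else 0)"
        using moment_orthogonal[of "mi_enum n" \<beta>] unfolding h_def moment_def by auto
    qed
    finally show ?thesis .
  qed
  \<comment> \<open>The index \<beta> occurs exactly once in the enumeration, at m, so the integrals
    of the partial sums are constant beyond m.\<close>
  obtain m where m: "mi_enum m = \<beta>" using bij_mi_enum by (metis UNIV_I bij_betw_def imageE)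
  have "mi_enum n = \<beta> \<longleftrightarrow> n = m" for n using bij_mi_enum m by (metis bij_betw_imp_inj_on UNIV_I inj_onD)
  then have "(\<Sum>n<N. if mi_enum n = \<beta> then moment \<beta> * a \<beta> else 0) = moment \<beta> * a \<beta>" if "N > m" for N
    using that by (simp add: sum.delta)
  then have "\<forall>\<^sub>F N in sequentially. (LINT p|lborel. cpx (k p) * g N p) = moment \<beta> * a \<beta>"
    unfolding gN eventually_sequentially by (intro exI[of _ "Suc m"]) auto
  then have "(\<lambda>N. (LINT p|lborel. cpx (k p) * g N p)) \<longlonglongrightarrow> moment \<beta> * a \<beta>" by (rule tendsto_eventually)
  with lim have "(LINT p|lborel. cpx (k p) * G p) = moment \<beta> * a \<beta>" by (rule LIMSEQ_unique)
  then show ?thesis unfolding weighted_integral_def G_def by (simp add: mult_ac)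
qed

text \<open>Expand the new exponential: its m-th term multiplies z^\<beta> by z_j^(2m), that is,
  moves \<beta> along the ray of \<open>shift\<close>. On the support of k the partial sums are
  uniformly bounded, so termwise integration is legitimate.\<close>

lemma weighted_integral_insert:
  assumes F: "powser F a" and j: "j \<notin> J"
  shows "weighted_integral s F (insert j J) \<beta> = shift j s (weighted_integral s F J) \<beta>"
proof -
  obtain B where B: "0 \<le> B" "\<And>z. (\<And>j. cmod (z $ j) \<le> T $ j) \<Longrightarrow> norm (F z) \<le> B"
    using powser_partial_sum_bound[OF F, of T] T_pos by (metis less_imp_le)
  define h where "h p = cpx (exp (- sq_phase p / 4)) * (\<Prod>j\<in>J. exp (s * (zvec p $ j)\<^sup>2)) * mi_power (zvec p) \<beta>" for p :: "'n phase"
  have ch: "continuous_on UNIV h" unfolding h_def cvec_nth by (intro continuous_intros) auto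
  from continuous_bounded_phase_box[OF ch] obtain B1 where B1: "0 \<le> B1" "\<And>p. p \<in> phase_box \<Longrightarrow> norm (h p) \<le> B1" by blast
  define S where "S N p = (\<Sum>m<N. (s * (zvec p $ j)\<^sup>2) ^ m / fact m)" for N and p :: "'n phase"
  define B2 where "B2 = exp (norm s * (T $ j)\<^sup>2)"
  have S: "norm (S N p) \<le> B2" if "k p \<noteq> 0" for N p
  proof -
    let ?x = "norm s * (cmod (zvec p $ j))\<^sup>2"
    have x: "?x \<ge> 0" by simp
    have "norm (S N p) \<le> (\<Sum>m<N. ?x ^ m / fact m)" unfolding S_def
      by (rule sum_norm_le) (simp add: norm_mult norm_divide norm_power)
    also have "\<dots> \<le> exp ?x" using exp_sums_real[of ?x] sum_le_suminf[of "\<lambda>m. ?x ^ m / fact m" "{..<N}"] x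
      by (simp add: sums_iff del: cvec_nth)
    also have "\<dots> \<le> B2" unfolding B2_def using k_support[OF that, of j]
      by (auto intro!: mult_left_mono power_mono simp del: cvec_nth)
    finally show ?thesis .
  qed
  define g where "g N p = F (zbar p) * h p * S N p" for N p
  define G where "G p = F (zbar p) * h p * exp (s * (zvec p $ j)\<^sup>2)" for p
  have mFh: "(\<lambda>p. F (zbar p) * h p) \<in> borel_measurable borel"
    by (intro borel_measurable_times powser_zbar_measurable[OF F] borel_measurable_continuous_onI[OF ch])
  have nFh: "norm (F (zbar p) * h p) \<le> B * B1" if "k p \<noteq> 0" for p
    unfolding norm_mult using B(1) by (intro mult_mono B(2) B1(2) k_support_zbar[OF that] k_inside[OF that]) auto
  have lim: "(\<lambda>N. (LINT p|lborel. cpx (k p) * g N p)) \<longlonglongrightarrow> (LINT p|lborel. cpx (k p) * G p)"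
  proof (rule integral_weight_tendsto)
    show "g N \<in> borel_measurable borel" for N unfolding g_def S_def cvec_nth
      by (intro borel_measurable_times[OF mFh] borel_measurable_continuous_onI continuous_intros) auto
    show "G \<in> borel_measurable borel" unfolding G_def cvec_nth
      by (intro borel_measurable_times[OF mFh] borel_measurable_continuous_onI continuous_intros)
    show "norm (g N p) \<le> (B * B1) * B2" if "k p \<noteq> 0" for N p
      unfolding g_def norm_mult[of _ "S _ _"] using that B B1 by (intro mult_mono nFh S) auto
    show "(\<lambda>N. g N p) \<longlonglongrightarrow> G p" for p unfolding g_def G_def S_def
      using has_sum_imp_sums[OF exp_has_sum[of "s * (zvec p $ j)\<^sup>2"]] unfolding sums_def by (intro tendsto_mult tendsto_const)
    show "0 \<le> B * B1 * B2" using B B1 by (simp add: B2_def)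
  qed
  have gN: "(LINT p|lborel. cpx (k p) * g N p) = (\<Sum>m<N. s ^ m / fact m * weighted_integral s F J (\<beta> + axis j (2 * m)))" for N
  proof -
    define f where "f m p = cpx (exp (- sq_phase p / 4)) * F (zbar p) * (\<Prod>j\<in>J. exp (s * (zvec p $ j)\<^sup>2)) * mi_power (zvec p) (\<beta> + axis j (2 * m))" for m p
    have f: "f m p = F (zbar p) * h p * ((zvec p $ j)\<^sup>2) ^ m" for m p
      unfolding f_def h_def mi_power_add_axis power_mult[of _ 2 m] by (simp only: mult_ac)
    have fi: "integrable lborel (\<lambda>p. cpx (k p) * f m p)" for m
    proof (rule integrable_weight)
      show "f m \<in> borel_measurable borel" unfolding f cvec_nth
        by (intro borel_measurable_times[OF mFh] borel_measurable_continuous_onI continuous_intros)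
      show "norm (f m p) \<le> (B * B1) * ((T $ j)\<^sup>2) ^ m" if "k p \<noteq> 0" for p
        unfolding f norm_mult[of _ "_ ^ m"] norm_power using that B B1 k_support[OF that, of j] by (intro mult_mono nFh power_mono) auto
      show "0 \<le> (B * B1) * ((T $ j)\<^sup>2) ^ m" using B B1 by simp
    qed
    have "cpx (k p) * g N p = (\<Sum>m<N. s ^ m / fact m * (cpx (k p) * f m p))" for p
      unfolding g_def S_def f sum_distrib_left by (intro sum.cong refl) (simp add: power_mult_distrib del: cvec_nth)
    then have "(LINT p|lborel. cpx (k p) * g N p) = (LINT p|lborel. (\<Sum>m<N. s ^ m / fact m * (cpx (k p) * f m p)))" by simp
    also have "\<dots> = (\<Sum>m<N. s ^ m / fact m * (LINT p|lborel. cpx (k p) * f m p))"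
      by (subst Bochner_Integration.integral_sum) (use fi in \<open>auto intro!: integrable_mult_right simp del: times_divide_eq_left\<close>)
    finally show ?thesis unfolding weighted_integral_def f_def .
  qed
  have "weighted_integral s F (insert j J) \<beta> = (LINT p|lborel. cpx (k p) * G p)"
    unfolding weighted_integral_def G_def h_def using j by (simp add: mult_ac del: cvec_nth)
  then show ?thesis using lim unfolding gN shift_def sums_def[symmetric] by (simp add: sums_iff)
qed

lemma weighted_integral_shifts:
  assumes "powser F a" "distinct js"
  shows "weighted_integral s F (set js) = shifts s js (\<lambda>\<alpha>. moment \<alpha> * a \<alpha>)"
  using assms(2)
proof (induction js)
  case Nil
  show ?case by (simp add: fun_eq_iff weighted_integral_empty[OF assms(1)])
next
  case (Cons j js)
  have "weighted_integral s F (set (j # js)) = shift j s (weighted_integral s F (set js))"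
    using weighted_integral_insert[OF assms(1), of j "set js"] Cons.prems by (simp add: fun_eq_iff)
  then show ?case using Cons by simp
qed

end

primrec exp_mult_coeffs :: "complex \<Rightarrow> 'n list \<Rightarrow> (nat ^ 'n \<Rightarrow> complex) \<Rightarrow> nat ^ 'n \<Rightarrow> complex" where
  "exp_mult_coeffs s [] a = a"
| "exp_mult_coeffs s (j # js) a = exp_mult_coeff j s (exp_mult_coeffs s js a)"

lemma powser_exp_mults:
  assumes "powser F a" "distinct js"
  shows "powser (\<lambda>z. exp (s * (\<Sum>j\<in>set js. (z $ j)\<^sup>2)) * F z) (exp_mult_coeffs s js a)"
  using assms(2)
proof (induction js)
  case Nil show ?case using assms by simp
next
  case (Cons j js)
  then have "powser (\<lambda>z. exp (s * (z $ j)\<^sup>2) * (exp (s * (\<Sum>j\<in>set js. (z $ j)\<^sup>2)) * F z)) (exp_mult_coeffs s (j # js) a)"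
    by (simp add: powser_exp_mult)
  then show ?case using Cons.prems by (simp add: distrib_left exp_add mult.assoc)
qed

lemma bnd_exp_mult_coeffs:
  assumes "bnd e r a" "0 < e" "e < 1/2" "positive_radius r"
  shows "bnd e (\<chi> i. 2 ^ length js * r $ i) (exp_mult_coeffs s js a)"
proof (induction js)
  case Nil show ?case using assms by simp
next
  case (Cons j js)
  from bnd_exp_mult_coeff[OF Cons assms(2,3), of j s] assms(4)
  show ?case by (simp add: positive_radius_def mult.assoc)
qed

section \<open>The adjoint of the short-time Fourier transform\<close>

lemma measurable_hermite_fun [measurable]: "hermite_fun \<alpha> \<in> borel_measurable borel"
  unfolding hermite_fun_eq[abs_def] by measurable

lemma hermite_fun_bound: "\<exists>C. \<forall>x. norm (cpx (hermite_fun \<alpha> (x :: real^'n))) \<le> C * gauss (1/4) x"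
proof -
  have "real_polynomial_function (\<lambda>x :: real^'n. hermite_norm \<alpha> * hermite_prod \<alpha> x)"
    by (intro real_polynomial_function.intros(2,4) real_polynomial_function_hermite_prod)
  from real_polynomial_gauss_bound[OF this, of "1/4" "1/2"] show ?thesis by (simp add: hermite_fun_eq)
qed

lemma integrable_hermite_fun: "integrable lborel (\<lambda>x :: real^'n. cpx (hermite_fun \<alpha> x))"
proof -
  obtain C where C: "\<And>x. norm (cpx (hermite_fun \<alpha> (x :: real^'n))) \<le> C * gauss (1/4) x"
    using hermite_fun_bound by blast
  show ?thesis
    by (rule integrable_norm_le[OF integrable_mult_right[OF integrable_gaussian] _ C]) auto
qed

definition gauss_window :: "real ^ 'n \<Rightarrow> complex" where
  "gauss_window x = cpx (pi powr (- real CARD('n) / 4) * exp (- (norm x)\<^sup>2 / 2))"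

lemma continuous_gauss_window [continuous_intros]:
  "continuous_on S f \<Longrightarrow> continuous_on S (\<lambda>x. gauss_window (f x))"
  unfolding gauss_window_def by (intro continuous_intros) auto

text \<open>From |x - 2y|^2 \<ge> 0 one gets |x|^2 \<le> 2 |x - y|^2 + 2 |y|^2. Gaussian decay in x
  is then uniform for y in a bounded set.\<close>

lemma gauss_window_translate_bound:
  "norm (gauss_window (x - y)) \<le> pi powr (- real CARD('n) / 4) * exp ((norm y)\<^sup>2 / 2) * gauss (1/4) x"
  for x y :: "real ^ 'n"
proof -
  have "0 \<le> (norm (x - 2 *\<^sub>R y))\<^sup>2" by simp
  then have "(norm x)\<^sup>2 \<le> 2 * (norm (x - y))\<^sup>2 + 2 * (norm y)\<^sup>2"
    by (simp add: power2_norm_eq_inner inner_diff_left inner_diff_right inner_commute)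
  then have "- (norm (x - y))\<^sup>2 / 2 \<le> (norm y)\<^sup>2 / 2 + (- (1/4) * (norm x)\<^sup>2)" by simp
  then have "exp (- (norm (x - y))\<^sup>2 / 2) \<le> exp ((norm y)\<^sup>2 / 2) * gauss (1/4) x"
    unfolding exp_add[symmetric] by simp
  then show ?thesis by (simp add: gauss_window_def norm_mult mult.assoc)
qed

lemma inner_vec_sum: "x \<bullet> y = (\<Sum>j\<in>UNIV. x $ j * y $ j)" for x y :: "real ^ 'n"
  by (simp add: inner_vec_def)

text \<open>The Gaussians of window and Hermite function combine to exp(- |x|^2) exp(x \<bullet> y),
  up to exp(- |y|^2/2). With the modulation this is \<open>hermite_gauss\<close> at z = y + i\<eta>,
  and the powers of pi cancel.\<close>

lemma integral_window_hermite:
  fixes y \<eta> :: "real ^ 'n"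
  shows "(LINT x|lborel. gauss_window (x - y) * exp (\<i> * cpx (x \<bullet> \<eta>)) * cpx (hermite_fun \<beta> x)) =
    cpx ((2 ^ mi_size \<beta> * mi_fact \<beta>) powr (- 1 / 2)) * (mi_power (cvec y \<eta>) \<beta> *
      (cpx (exp (- (norm y)\<^sup>2 / 2)) * exp ((\<Sum>j\<in>UNIV. (cvec y \<eta> $ j)\<^sup>2) / 4)))"
proof -
  define K where "K = pi powr (- real CARD('n) / 4) * hermite_norm \<beta>"
  have eq: "gauss_window (x - y) * exp (\<i> * cpx (x \<bullet> \<eta>)) * cpx (hermite_fun \<beta> x) =
     cpx (K * exp (- (norm y)\<^sup>2 / 2)) * hermite_gauss \<beta> (cvec y \<eta>) x" for x
  proof -
    have s: "(\<Sum>i\<in>UNIV. cvec y \<eta> $ i * cpx (x $ i)) = cpx (x \<bullet> y) + \<i> * cpx (x \<bullet> \<eta>)"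
      unfolding inner_vec_sum of_real_sum sum_distrib_left sum.distrib[symmetric]
      by (intro sum.cong refl) (simp add: complex_eq_iff)
    have e: "exp (- (norm (x - y))\<^sup>2 / 2) * exp (- (norm x)\<^sup>2 / 2) = exp (- (norm y)\<^sup>2 / 2) * exp (- (norm x)\<^sup>2) * exp (x \<bullet> y)"
      unfolding exp_add[symmetric]
      by (simp add: power2_norm_eq_inner inner_diff_left inner_diff_right inner_commute field_simps)
    have "gauss_window (x - y) * exp (\<i> * cpx (x \<bullet> \<eta>)) * cpx (hermite_fun \<beta> x) =
       cpx (K * hermite_prod \<beta> x) * cpx (exp (- (norm (x - y))\<^sup>2 / 2) * exp (- (norm x)\<^sup>2 / 2)) * exp (\<i> * cpx (x \<bullet> \<eta>))"
      unfolding gauss_window_def hermite_fun_eq K_def of_real_mult by (simp only: mult_ac)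
    also have "\<dots> = cpx (K * hermite_prod \<beta> x) * cpx (exp (- (norm y)\<^sup>2 / 2) * exp (- (norm x)\<^sup>2)) * exp (cpx (x \<bullet> y) + \<i> * cpx (x \<bullet> \<eta>))"
      unfolding e exp_add exp_of_real[symmetric] of_real_mult by (simp only: mult_ac)
    also have "\<dots> = cpx (K * exp (- (norm y)\<^sup>2 / 2)) * hermite_gauss \<beta> (cvec y \<eta>) x"
      unfolding hermite_gauss_def s of_real_mult by (simp only: mult_ac)
    finally show ?thesis .
  qed
  have Kpi: "K * pi powr (real CARD('n) / 2) = (2 ^ mi_size \<beta> * mi_fact \<beta>) powr (- 1 / 2)"
  proof -
    have "K * pi powr (real CARD('n) / 2) = (pi powr (- real CARD('n) / 4) * pi powr (- real CARD('n) / 4) * pi powr (real CARD('n) / 2)) * (2 ^ mi_size \<beta> * mi_fact \<beta>) powr (- 1 / 2)"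
      unfolding K_def hermite_norm_def by (simp only: mult_ac)
    also have "pi powr (- real CARD('n) / 4) * pi powr (- real CARD('n) / 4) * pi powr (real CARD('n) / 2) = 1"
      unfolding powr_add[symmetric] by simp
    finally show ?thesis by simp
  qed
  show ?thesis
    unfolding eq integral_mult_right_zero integral_hermite_gauss Kpi[symmetric] of_real_mult
    by (simp only: mult_ac)
qed

text \<open>With \<open>z = y + i\<eta>\<close>, the exponent \<open>- i\<langle>y,\<eta>\<rangle> - |y|\<^sup>2/2 + z\<^sup>2/4\<close> is
  \<open>- |z|\<^sup>2/4 + zbar\<^sup>2/8 - z\<^sup>2/8\<close>: a radial factor, a factor that can be absorbed into the
  power series, and a factor that acts on the coefficients through \<open>shift\<close>.\<close>

lemma phase_factor_identity:
  fixes p :: "'n::finite phase"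
  shows "exp (- \<i> * cpx (fst p \<bullet> snd p)) * (cpx (exp (- (norm (fst p))\<^sup>2 / 2)) * exp ((\<Sum>j\<in>UNIV. (zvec p $ j)\<^sup>2) / 4)) =
    cpx (exp (- sq_phase p / 4)) * exp (1/8 * (\<Sum>j\<in>UNIV. (zbar p $ j)\<^sup>2)) * (\<Prod>j\<in>UNIV. exp (- (1/8) * (zvec p $ j)\<^sup>2))"
proof -
  have j: "- \<i> * cpx (fst p $ j * snd p $ j) + (cpx (- (fst p $ j)\<^sup>2 / 2) + (zvec p $ j)\<^sup>2 / 4) =
      cpx (- (cmod (zvec p $ j))\<^sup>2 / 4) + 1/8 * (zbar p $ j)\<^sup>2 + - (1/8) * (zvec p $ j)\<^sup>2" for j
    unfolding cvec_nth cmod_power2 by (simp add: complex_eq_iff power2_eq_square field_simps)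
  have "- \<i> * cpx (fst p \<bullet> snd p) + (cpx (- (norm (fst p))\<^sup>2 / 2) + (\<Sum>j\<in>UNIV. (zvec p $ j)\<^sup>2) / 4) =
     (\<Sum>j\<in>UNIV. - \<i> * cpx (fst p $ j * snd p $ j) + (cpx (- (fst p $ j)\<^sup>2 / 2) + (zvec p $ j)\<^sup>2 / 4))"
    unfolding inner_vec_sum norm_vec_sq
    by (simp add: sum.distrib sum_subtractf sum_distrib_left sum_divide_distrib sum_negf of_real_sum del: cvec_nth)
  also have "\<dots> = cpx (- sq_phase p / 4) + 1/8 * (\<Sum>j\<in>UNIV. (zbar p $ j)\<^sup>2) + (\<Sum>j\<in>UNIV. - (1/8) * (zvec p $ j)\<^sup>2)"
    unfolding j sq_phase_def by (simp add: sum.distrib sum_subtractf sum_distrib_left sum_divide_distrib sum_negf of_real_sum del: cvec_nth)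
  finally have "exp (- \<i> * cpx (fst p \<bullet> snd p) + (cpx (- (norm (fst p))\<^sup>2 / 2) + (\<Sum>j\<in>UNIV. (zvec p $ j)\<^sup>2) / 4)) =
     exp (cpx (- sq_phase p / 4) + 1/8 * (\<Sum>j\<in>UNIV. (zbar p $ j)\<^sup>2) + (\<Sum>j\<in>UNIV. - (1/8) * (zvec p $ j)\<^sup>2))"
    by (rule arg_cong)
  then show ?thesis unfolding exp_add exp_of_real exp_sum[OF finite] .
qed

section \<open>The adjoint applied to weighted power series\<close>

context radial_weight
begin

text \<open>The function F of condition (2), with \<chi> replaced by its representative k.\<close>

definition symb :: "(complex ^ 'n \<Rightarrow> complex) \<Rightarrow> 'n phase \<Rightarrow> complex" where
  "symb F p = F (zbar p) * exp (- \<i> * cpx (fst p \<bullet> snd p)) * cpx (k p)"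

text \<open>Despite the short name, this is the adjoint transform of \<open>symb F\<close>, taken
  over \<open>lborel\<close> so that Fubini applies directly.\<close>

definition stft :: "(complex ^ 'n \<Rightarrow> complex) \<Rightarrow> real ^ 'n \<Rightarrow> complex" where
  "stft F x = (LINT p|lborel. symb F p * gauss_window (x - fst p) * exp (\<i> * cpx (x \<bullet> snd p)))"

lemma symb_measurable:
  assumes "powser F a" shows "symb F \<in> borel_measurable borel"
proof -
  have "(\<lambda>p :: 'n phase. exp (- \<i> * cpx (fst p \<bullet> snd p))) \<in> borel_measurable borel"
    by (intro borel_measurable_continuous_onI continuous_intros)
  moreover have "(\<lambda>p. cpx (k p)) \<in> borel_measurable borel" by measurable
  ultimately show ?thesis unfolding symb_def[abs_def]
    by (intro borel_measurable_times[OF borel_measurable_times] powser_zbar_measurable[OF assms])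
qed

lemma symb_bound:
  assumes "powser F a" obtains C where "0 \<le> C" "\<And>p. norm (symb F p) \<le> C * indicator phase_box p"
proof -
  obtain B where B: "0 \<le> B" "\<And>z. (\<And>j. cmod (z $ j) \<le> T $ j) \<Longrightarrow> norm (F z) \<le> B"
    using powser_partial_sum_bound[OF assms, of T] T_pos by (metis less_imp_le)
  have "norm (symb F p) \<le> (B * M) * indicator phase_box p" for p
  proof (cases "k p = 0")
    case True
    then show ?thesis using B(1) M_nonneg by (simp add: symb_def)
  next
    case False
    have "norm (F (zbar p)) \<le> B" by (rule B(2)) (rule k_support_zbar[OF False])
    then show ?thesis using k_inside[OF False] k_nonneg[of p] k_le[of p] M_nonneg
      using mult_mono[of "norm (F (zbar p))" B "k p" M] B(1) by (simp add: symb_def norm_mult)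
  qed
  then show ?thesis using that[of "B * M"] B(1) M_nonneg by simp
qed

lemma Linfty_symb:
  assumes "powser F a" shows "Linfty (symb F)" "compactly_supported (symb F)"
proof -
  obtain C where C: "0 \<le> C" "\<And>p. norm (symb F p) \<le> C * indicator phase_box p" using symb_bound[OF assms] by blast
  have "norm (symb F p) \<le> C" for p using C(2)[of p] C(1) by (cases "p \<in> phase_box") auto
  then have "AE p in lebesgue. norm (symb F p) \<le> C" by (rule AE_I2)
  moreover have "symb F \<in> borel_measurable lebesgue"
    using symb_measurable[OF assms] by (intro measurable_completion) simp
  ultimately show "Linfty (symb F)" unfolding Linfty_def by blast
  have "symb F p = 0" if "p \<notin> phase_box" for p using C(2)[of p] that by simp
  then show "compactly_supported (symb F)" unfolding compactly_supported_def supported_in_def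
    using compact_phase_box by (intro exI[of _ phase_box]) (auto intro: compact_imp_closed)
qed

lemma STFT_adjoint_eq_stft:
  assumes F: "powser F a" and G: "G \<in> borel_measurable lebesgue" "AE p in lebesgue. G p = symb F p"
  shows "STFT_adjoint gauss_window G = stft F"
proof
  fix x :: "real ^ 'n"
  note [measurable] = symb_measurable[OF F]
  have c: "continuous_on UNIV (\<lambda>p. gauss_window (x - fst p) * exp (\<i> * cpx (x \<bullet> snd p)))"
    by (intro continuous_intros)
  have m: "(\<lambda>p. gauss_window (x - fst p) * exp (\<i> * cpx (x \<bullet> snd p))) \<in> borel_measurable borel"
    using c by (rule borel_measurable_continuous_onI)
  then have ml: "(\<lambda>p. gauss_window (x - fst p) * exp (\<i> * cpx (x \<bullet> snd p))) \<in> borel_measurable lebesgue"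
    by (intro measurable_completion) simp
  have ms: "symb F \<in> borel_measurable lebesgue" by (intro measurable_completion) measurable
  have "STFT_adjoint gauss_window G x = (LINT p|lebesgue. G p * (gauss_window (x - fst p) * exp (\<i> * cpx (x \<bullet> snd p))))"
    unfolding STFT_adjoint_def mult.assoc ..
  also have "\<dots> = (LINT p|lebesgue. symb F p * (gauss_window (x - fst p) * exp (\<i> * cpx (x \<bullet> snd p))))"
    by (rule integral_cong_AE) (use G ml ms in \<open>auto elim!: eventually_mono\<close>)
  also have "\<dots> = (LINT p|lborel. symb F p * (gauss_window (x - fst p) * exp (\<i> * cpx (x \<bullet> snd p))))"
    by (rule integral_completion) (use borel_measurable_times[OF symb_measurable[OF F] m] in simp)
  finally show "STFT_adjoint gauss_window G x = stft F x" unfolding stft_def mult.assoc .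
qed

text \<open>The majorant separates the variables: compact support in p and Gaussian decay in x. This
  serves both Fubini and the square integrability of \<open>stft F\<close>.\<close>

lemma symb_kernel_bound:
  assumes "powser F a"
  obtains C where "0 \<le> C" "\<And>x p. norm (symb F p * gauss_window (x - fst p) * exp (\<i> * cpx (x \<bullet> snd p))) \<le> C * indicator phase_box p * gauss (1/4) x"
proof -
  obtain C where C: "0 \<le> C" "\<And>p. norm (symb F p) \<le> C * indicator phase_box p" using symb_bound[OF assms] by blast
  have "continuous_on UNIV (\<lambda>p::'n phase. cpx (exp ((norm (fst p))\<^sup>2 / 2)))" by (intro continuous_intros) auto
  from continuous_bounded_phase_box[OF this] obtain B where
    B: "0 \<le> B" "\<And>p. p \<in> phase_box \<Longrightarrow> exp ((norm (fst p))\<^sup>2 / 2) \<le> B" by auto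
  define A where "A = pi powr (- real CARD('n) / 4)"
  have A: "A \<ge> 0" by (simp add: A_def)
  have "norm (symb F p * gauss_window (x - fst p) * exp (\<i> * cpx (x \<bullet> snd p))) \<le> (C * A * B) * indicator phase_box p * gauss (1/4) x" for x p
  proof (cases "p \<in> phase_box")
    case True
    have "norm (symb F p * gauss_window (x - fst p) * exp (\<i> * cpx (x \<bullet> snd p))) = norm (symb F p) * norm (gauss_window (x - fst p))"
      by (simp add: norm_mult)
    also have "\<dots> \<le> C * (A * B * gauss (1/4) x)"
    proof (rule mult_mono)
      show "norm (symb F p) \<le> C" using C(2)[of p] True by simp
      have "norm (gauss_window (x - fst p)) \<le> A * exp ((norm (fst p))\<^sup>2 / 2) * gauss (1/4) x"
        unfolding A_def by (rule gauss_window_translate_bound)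
      also have "\<dots> \<le> A * B * gauss (1/4) x" using A B(2)[OF True] by (intro mult_right_mono mult_left_mono) auto
      finally show "norm (gauss_window (x - fst p)) \<le> A * B * gauss (1/4) x" .
    qed (use C in auto)
    finally show ?thesis using True by (simp add: mult.assoc)
  next
    case False
    then show ?thesis using C(2)[of p] by simp
  qed
  then show ?thesis using that[of "C * A * B"] A B C by simp
qed

lemma kernel_measurable:
  assumes "powser F a"
  shows "(\<lambda>q :: (real^'n) \<times> 'n phase. symb F (snd q) * gauss_window (fst q - fst (snd q)) * exp (\<i> * cpx (fst q \<bullet> snd (snd q)))) \<in> borel_measurable borel"
proof -
  have "(\<lambda>q :: (real^'n) \<times> 'n phase. symb F (snd q)) \<in> borel_measurable borel"
    using symb_measurable[OF assms] by (rule measurable_compose[rotated]) (intro borel_measurable_continuous_onI continuous_intros)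
  moreover have "(\<lambda>q :: (real^'n) \<times> 'n phase. gauss_window (fst q - fst (snd q)) * exp (\<i> * cpx (fst q \<bullet> snd (snd q)))) \<in> borel_measurable borel"
    by (intro borel_measurable_continuous_onI continuous_intros)
  ultimately show ?thesis unfolding mult.assoc by (rule borel_measurable_times)
qed

lemma stft_measurable:
  assumes "powser F a" shows "stft F \<in> borel_measurable borel"
proof -
  have "(\<lambda>x. LINT p|lborel. symb F p * gauss_window (x - fst p) * exp (\<i> * cpx (x \<bullet> snd p))) \<in> borel_measurable lborel"
    using kernel_measurable[OF assms]
    by (intro lborel.borel_measurable_lebesgue_integral) (simp add: case_prod_beta' lborel_prod)
  then show ?thesis unfolding stft_def[abs_def] by simp
qed

lemma stft_bound:
  assumes F: "powser F a" obtains C where "\<And>x. norm (stft F x) \<le> C * gauss (1/4) x"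
proof -
  obtain C where C: "0 \<le> C" "\<And>x p. norm (symb F p * gauss_window (x - fst p) * exp (\<i> * cpx (x \<bullet> snd p))) \<le> C * indicator phase_box p * gauss (1/4) x"
    using symb_kernel_bound[OF F] by metis
  have "norm (stft F x) \<le> (C * phase_vol) * gauss (1/4) x" for x
  proof -
    have i: "integrable lborel (\<lambda>p. C * indicator phase_box p * gauss (1/4) x :: real)"
      by (intro integrable_mult_left integrable_indicator_phase_box)
    have c: "continuous_on UNIV (\<lambda>p. gauss_window (x - fst p) * exp (\<i> * cpx (x \<bullet> snd p)))"
      by (intro continuous_intros)
    have m: "(\<lambda>p. symb F p * gauss_window (x - fst p) * exp (\<i> * cpx (x \<bullet> snd p))) \<in> borel_measurable lborel"
      using borel_measurable_times[OF symb_measurable[OF F] borel_measurable_continuous_onI[OF c]] by (simp add: mult.assoc)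
    have "norm (stft F x) \<le> (LINT p|lborel. C * indicator phase_box p * gauss (1/4) x)"
      unfolding stft_def
      by (rule Bochner_Integration.integral_norm_bound_integral[OF integrable_norm_le[OF i m C(2)] i C(2)])
    also have "\<dots> = (C * phase_vol) * gauss (1/4) x" by (simp add: phase_vol_def)
    finally show ?thesis .
  qed
  then show ?thesis using that by blast
qed

lemma stft_hermite:
  assumes F: "powser F a"
  shows "(LINT x|lborel. stft F x * cpx (hermite_fun \<beta> x)) =
    cpx ((2 ^ mi_size \<beta> * mi_fact \<beta>) powr (- 1 / 2)) *
      weighted_integral (- (1/8)) (\<lambda>z. exp (1/8 * (\<Sum>j\<in>UNIV. (z $ j)\<^sup>2)) * F z) UNIV \<beta>"
proof -
  let ?h = "\<lambda>x. cpx (hermite_fun \<beta> x)"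
  obtain C where C: "0 \<le> C" "\<And>x p. norm (symb F p * gauss_window (x - fst p) * exp (\<i> * cpx (x \<bullet> snd p))) \<le> C * indicator phase_box p * gauss (1/4) x"
    using symb_kernel_bound[OF F] by metis
  define f where "f x p = symb F p * gauss_window (x - fst p) * exp (\<i> * cpx (x \<bullet> snd p)) * ?h x" for x p
  have fb: "norm (f x p) \<le> C * indicator phase_box p * norm (?h x)" for x p
  proof -
    \<comment> \<open>The decay of the kernel in x is given up here, since the Hermite function is
      itself integrable.\<close>
    have "gauss (1/4) x \<le> 1" by simp
    then have "C * indicator phase_box p * gauss (1/4) x \<le> C * indicator phase_box p * 1"
      using C(1) by (intro mult_left_mono) auto
    then have "norm (symb F p * gauss_window (x - fst p) * exp (\<i> * cpx (x \<bullet> snd p))) \<le> C * indicator phase_box p"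
      using C(2)[of p x] by linarith
    then show ?thesis unfolding f_def norm_mult[of _ "cpx _"] by (rule mult_right_mono) simp
  qed
  have "(\<lambda>q :: (real^'n) \<times> 'n phase. cpx (hermite_fun \<beta> (fst q))) \<in> borel_measurable (borel \<Otimes>\<^sub>M borel)" by measurable
  then have mh: "(\<lambda>q :: (real^'n) \<times> 'n phase. cpx (hermite_fun \<beta> (fst q))) \<in> borel_measurable borel"
    by (simp only: borel_prod)
  have mf: "case_prod f \<in> borel_measurable (lborel \<Otimes>\<^sub>M lborel)"
    unfolding f_def case_prod_beta' lborel_prod
    using borel_measurable_times[OF kernel_measurable[OF F] mh] by simp
  have mfx: "f x \<in> borel_measurable lborel" for x
    using measurable_compose[OF measurable_Pair1' mf, of x] by simp
  have iB: "integrable lborel (\<lambda>p. C * indicator phase_box p * norm (?h x))" for x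
    by (intro integrable_mult_left integrable_indicator_phase_box)
  have ifx: "integrable lborel (f x)" for x by (rule integrable_norm_le[OF iB mfx fb])
  have intf: "integrable (lborel \<Otimes>\<^sub>M lborel) (case_prod f)"
  proof (rule lborel_pair.Fubini_integrable[OF mf])
    show "AE x in lborel. integrable lborel (\<lambda>y. case_prod f (x, y))" using ifx by simp
    have "integrable lborel (\<lambda>x. C * phase_vol * norm (?h x))"
      by (intro integrable_mult_right integrable_norm integrable_hermite_fun)
    then show "integrable lborel (\<lambda>x. LINT p|lborel. norm (case_prod f (x, p)))"
    proof (rule integrable_norm_le)
      show "(\<lambda>x. LINT p|lborel. norm (case_prod f (x, p))) \<in> borel_measurable lborel"
        using mf by (intro lborel.borel_measurable_lebesgue_integral) (simp add: case_prod_beta')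
      fix x
      have "norm (LINT p|lborel. norm (case_prod f (x, p))) = (LINT p|lborel. norm (f x p))" by simp
      also have "\<dots> \<le> (LINT p|lborel. C * indicator phase_box p * norm (?h x))"
        using fb by (intro integral_mono integrable_norm ifx iB)
      also have "\<dots> = C * phase_vol * norm (?h x)" by (simp add: phase_vol_def)
      finally show "norm (LINT p|lborel. norm (case_prod f (x, p))) \<le> C * phase_vol * norm (?h x)" .
    qed
  qed
  let ?c = "cpx ((2 ^ mi_size \<beta> * mi_fact \<beta>) powr (- 1 / 2))"
  have "(LINT x|lborel. stft F x * ?h x) = (LINT x|lborel. (LINT p|lborel. f x p))"
    unfolding stft_def f_def integral_mult_left_zero ..
  also have "\<dots> = (LINT p|lborel. (LINT x|lborel. f x p))"
    using lborel_pair.Fubini_integral[OF intf] by simp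
  also have "\<dots> = (LINT p|lborel. ?c * (cpx (k p) * (cpx (exp (- sq_phase p / 4)) *
     (exp (1/8 * (\<Sum>j\<in>UNIV. (zbar p $ j)\<^sup>2)) * F (zbar p)) * (\<Prod>j\<in>UNIV. exp (- (1/8) * (zvec p $ j)\<^sup>2)) * mi_power (zvec p) \<beta>)))"
  proof (intro Bochner_Integration.integral_cong refl)
    fix p :: "'n phase"
    have "(LINT x|lborel. f x p) = (LINT x|lborel. symb F p * (gauss_window (x - fst p) * exp (\<i> * cpx (x \<bullet> snd p)) * ?h x))"
      unfolding f_def mult.assoc ..
    also have "\<dots> = symb F p * (?c * (mi_power (zvec p) \<beta> * (cpx (exp (- (norm (fst p))\<^sup>2 / 2)) * exp ((\<Sum>j\<in>UNIV. (zvec p $ j)\<^sup>2) / 4))))"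
      unfolding integral_mult_right_zero integral_window_hermite ..
    also have "\<dots> = (?c * cpx (k p) * F (zbar p) * mi_power (zvec p) \<beta>) *
      (exp (- \<i> * cpx (fst p \<bullet> snd p)) * (cpx (exp (- (norm (fst p))\<^sup>2 / 2)) * exp ((\<Sum>j\<in>UNIV. (zvec p $ j)\<^sup>2) / 4)))"
      unfolding symb_def by (simp only: mult_ac)
    finally show "(LINT x|lborel. f x p) = ?c * (cpx (k p) * (cpx (exp (- sq_phase p / 4)) *
     (exp (1/8 * (\<Sum>j\<in>UNIV. (zbar p $ j)\<^sup>2)) * F (zbar p)) * (\<Prod>j\<in>UNIV. exp (- (1/8) * (zvec p $ j)\<^sup>2)) * mi_power (zvec p) \<beta>))"
      unfolding phase_factor_identity by (simp only: mult_ac)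
  qed
  also have "\<dots> = ?c * weighted_integral (- (1/8)) (\<lambda>z. exp (1/8 * (\<Sum>j\<in>UNIV. (z $ j)\<^sup>2)) * F z) UNIV \<beta>"
    unfolding weighted_integral_def by (rule integral_mult_right_zero)
  finally show ?thesis .
qed

end

text \<open>A finite set of multi-indices lies in a cube, and the sum over a cube factors into
  one-dimensional partial sums; the product of the total sums bounds them all.\<close>

lemma summable_on_mi_product:
  fixes w :: "'n::finite \<Rightarrow> nat \<Rightarrow> real"
  assumes w: "\<And>i n. 0 \<le> w i n" "\<And>i. summable (w i)"
  shows "(\<lambda>\<alpha> :: nat ^ 'n. \<Prod>i\<in>UNIV. w i (\<alpha> $ i)) summable_on UNIV"
proof (rule nonneg_bdd_above_summable_on)
  show "0 \<le> (\<Prod>i\<in>UNIV. w i (\<alpha> $ i))" for \<alpha> :: "nat ^ 'n" by (intro prod_nonneg) (simp add: w)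
  show "bdd_above (sum (\<lambda>\<alpha> :: nat ^ 'n. \<Prod>i\<in>UNIV. w i (\<alpha> $ i)) ` {F. F \<subseteq> UNIV \<and> finite F})"
  proof (rule bdd_aboveI2)
    fix A assume "A \<in> {F :: (nat ^ 'n) set. F \<subseteq> UNIV \<and> finite F}"
    then have A: "finite A" by simp
    define N where "N = (\<Sum>\<alpha>\<in>A. \<Sum>i\<in>UNIV. \<alpha> $ i)"
    have N: "\<alpha> $ i \<le> N" if "\<alpha> \<in> A" for \<alpha> i
    proof -
      have "\<alpha> $ i \<le> (\<Sum>i\<in>UNIV. \<alpha> $ i)" by (rule member_le_sum) auto
      also have "\<dots> \<le> N" unfolding N_def using that A by (intro member_le_sum) auto
      finally show ?thesis .
    qed
    have inj: "inj_on vec_nth A" by (auto simp: inj_on_def vec_nth_inject)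
    have "(\<Sum>\<alpha>\<in>A. \<Prod>i\<in>UNIV. w i (\<alpha> $ i)) = (\<Sum>g\<in>vec_nth ` A. \<Prod>i\<in>UNIV. w i (g i))"
      by (simp add: sum.reindex[OF inj])
    also have "\<dots> \<le> (\<Sum>g\<in>PiE UNIV (\<lambda>_. {..N}). \<Prod>i\<in>UNIV. w i (g i))"
      using N by (intro sum_mono2 finite_PiE) (auto intro!: prod_nonneg w)
    also have "\<dots> = (\<Prod>i\<in>UNIV. \<Sum>n\<le>N. w i n)" by (rule prod_sum_PiE[symmetric]) auto
    also have "\<dots> \<le> (\<Prod>i\<in>UNIV. suminf (w i))"
      using w by (intro prod_mono conjI sum_nonneg sum_le_suminf) auto
    finally show "(\<Sum>\<alpha>\<in>A. \<Prod>i\<in>UNIV. w i (\<alpha> $ i)) \<le> (\<Prod>i\<in>UNIV. suminf (w i))" .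
  qed
qed

text \<open>For e > 0 the factorial decay beats every geometric growth in each coordinate, so the
  series converges at every z.\<close>

lemma bnd_imp_powser:
  fixes a :: "nat ^ 'n \<Rightarrow> complex"
  assumes b: "bnd e r a" and e: "0 < e" and r: "positive_radius r"
  shows "\<exists>F. powser F a"
proof -
  from b obtain C where C: "C > 0" "\<And>\<alpha>. norm (a \<alpha>) \<le> C * (mi_power r \<alpha> * mi_fact \<alpha> powr (- e))" unfolding bnd_def by blast
  have "(\<lambda>\<alpha>. a \<alpha> * mi_power z \<alpha>) summable_on UNIV" for z :: "complex ^ 'n"
  proof -
    define w where "w i n = (r $ i * cmod (z $ i)) ^ n * fact n powr (- e)" for i and n :: nat
    have r': "0 < r $ i" for i using r by (auto simp: positive_radius_def)
    have w: "0 \<le> w i n" for i n using r'[of i] by (simp add: w_def)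
    have sw: "summable (w i)" for i unfolding w_def[abs_def] using r'[of i] e by (intro summable_power_fact_powr) auto
    have "(\<lambda>\<alpha> :: nat ^ 'n. C * (\<Prod>i\<in>UNIV. w i (\<alpha> $ i))) summable_on UNIV"
      by (intro summable_on_cmult_right summable_on_mi_product w sw)
    then have "(\<lambda>\<alpha>. norm (a \<alpha> * mi_power z \<alpha>)) summable_on UNIV"
    proof (rule summable_on_comparison_test)
      fix \<alpha> :: "nat ^ 'n"
      have mf: "mi_fact \<alpha> powr (- e) = (\<Prod>i\<in>UNIV. fact (\<alpha> $ i) powr (- e))"
        unfolding mi_fact_def by (rule prod_powr_distrib)
      have "norm (a \<alpha> * mi_power z \<alpha>) \<le> C * (mi_power r \<alpha> * mi_fact \<alpha> powr (- e)) * mi_power (\<chi> j. cmod (z $ j)) \<alpha>"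
        unfolding norm_mult norm_mi_power by (intro mult_right_mono C mi_power_nonneg) simp
      also have "\<dots> = C * (\<Prod>i\<in>UNIV. w i (\<alpha> $ i))"
        unfolding mf w_def mi_power_def by (simp add: prod.distrib power_mult_distrib mult_ac)
      finally show "norm (a \<alpha> * mi_power z \<alpha>) \<le> C * (\<Prod>i\<in>UNIV. w i (\<alpha> $ i))" .
    qed simp
    then show ?thesis by (simp only: summable_on_iff_abs_summable_on_complex)
  qed
  then have "powser (\<lambda>z. infsum (\<lambda>\<alpha>. a \<alpha> * mi_power z \<alpha>) UNIV) a"
    unfolding powser_def by (blast intro: has_sum_infsum)
  then show ?thesis by blast
qed

section \<open>Coefficient bounds for some or for every radius\<close>

lemma has_power_series_iff_powser:
  "has_power_series G c \<longleftrightarrow> powser G (\<lambda>\<alpha>. c \<alpha> / cpx (sqrt (mi_fact \<alpha>)))"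
  unfolding has_power_series_def powser_def by simp

text \<open>The two cases of the theorem: a coefficient bound for some radius, or for every radius.\<close>

locale radius_class =
  fixes R :: "real \<Rightarrow> (nat ^ 'n \<Rightarrow> complex) \<Rightarrow> bool"
  assumes obtain_radius: "\<And>e u. R e u \<Longrightarrow> \<exists>r. positive_radius r \<and> bnd e r u"
    and rescale: "\<And>e e' q u u'. R e u \<Longrightarrow> positive_radius q \<Longrightarrow>
      (\<And>r. positive_radius r \<Longrightarrow> bnd e r u \<Longrightarrow> bnd e' (\<chi> i. q $ i * r $ i) u') \<Longrightarrow> R e' u'"

lemma positive_radius_times: "positive_radius q \<Longrightarrow> positive_radius r \<Longrightarrow> positive_radius (\<chi> i. q $ i * r $ i)"
  by (simp add: positive_radius_def)

lemma radius_class_some: "radius_class (\<lambda>e u. \<exists>r. positive_radius r \<and> bnd e r u)"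
  by standard (auto intro: positive_radius_times)

lemma radius_class_every: "radius_class (\<lambda>e u. \<forall>r. positive_radius r \<longrightarrow> bnd e r u)"
proof
  fix e e' and q :: "real ^ 'n" and u u'
  assume u: "\<forall>r. positive_radius r \<longrightarrow> bnd e r u" and q: "positive_radius q"
    and imp: "\<And>r. positive_radius r \<Longrightarrow> bnd e r u \<Longrightarrow> bnd e' (\<chi> i. q $ i * r $ i) u'"
  show "\<forall>r. positive_radius r \<longrightarrow> bnd e' r u'"
  proof (intro allI impI)
    fix r :: "real ^ 'n" assume r: "positive_radius r"
    \<comment> \<open>The target radius r is reached by starting from r / q.\<close>
    define s where "s = (\<chi> i. r $ i / q $ i)"
    have "positive_radius s" using q r by (simp add: s_def positive_radius_def)
    moreover have "q $ i \<noteq> 0" for i using q unfolding positive_radius_def by (metis less_irrefl)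
    then have "(\<chi> i. q $ i * s $ i) = r" by (simp add: s_def vec_eq_iff)
    ultimately show "bnd e' r u'" using imp[of s] u by simp
  qed
next
  fix e :: real and u :: "nat ^ 'n \<Rightarrow> complex" assume *: "\<forall>r. positive_radius r \<longrightarrow> bnd e r u"
  have "positive_radius ((\<chi> i. 1) :: real ^ 'n)" by (simp add: positive_radius_def)
  with * show "\<exists>r. positive_radius r \<and> bnd e r u" by blast
qed

context radius_class
begin

lemma mult_le:
  assumes u: "R e u" and w: "positive_radius w" and K: "0 < K"
    and u': "\<And>\<alpha>. norm (u' \<alpha>) \<le> K * (mi_power w \<alpha> * mi_fact \<alpha> powr d) * norm (u \<alpha>)" and e': "e' = e - d"
  shows "R e' u'"
  using u w by (rule rescale) (use bnd_rescale[OF _ w _ K u'] e' in simp)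

lemma exp_mult:
  assumes "R e a" "0 < e" "e < 1/2" shows "R e (exp_mult_coeffs s js a)"
proof (rule rescale[OF assms(1), of "\<chi> i. 2 ^ length js"])
  fix r :: "real ^ 'n" assume "positive_radius r" "bnd e r a"
  then show "bnd e (\<chi> i. (\<chi> i. 2 ^ length js) $ i * r $ i) (exp_mult_coeffs s js a)"
    using bnd_exp_mult_coeffs[OF _ assms(2,3), of r a js s] by simp
qed (simp add: positive_radius_def)

end

section \<open>Borel representatives and equality of distributions\<close>

lemma complex_borel_representative:
  fixes g :: "real ^ 'n \<Rightarrow> complex"
  assumes "g \<in> borel_measurable lebesgue"
  obtains g' where "g' \<in> borel_measurable borel" "AE x in lebesgue. g x = g' x"
proof -
  have "(\<lambda>x. Re (g x)) \<in> borel_measurable (completion lborel)" "(\<lambda>x. Im (g x)) \<in> borel_measurable (completion lborel)"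
    using assms by measurable
  from this[THEN completion_ex_borel_measurable_real]
  obtain u v where uv: "u \<in> borel_measurable lborel" "v \<in> borel_measurable lborel"
    "AE x in lborel. Re (g x) = u x" "AE x in lborel. Im (g x) = v x" by blast
  define g' where "g' x = cpx (u x) + \<i> * cpx (v x)" for x
  have "g' \<in> borel_measurable borel" unfolding g'_def[abs_def] using uv(1,2) by measurable
  moreover have "AE x in lborel. g x = g' x"
    using uv(3,4) by eventually_elim (simp add: g'_def complex_eq_iff)
  then have "AE x in lebesgue. g x = g' x" by (simp add: AE_completion_iff)
  ultimately show ?thesis using that by blast
qed

lemma schwartz_continuous_bounded:
  assumes "\<psi> \<in> schwartz"
  shows "continuous_on UNIV \<psi>" "\<exists>B. \<forall>x. norm (\<psi> x) \<le> B"
proof -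
  have sm: "smooth \<psi>" and bd: "bounded (range (\<lambda>x. mi_power x 0 *\<^sub>R mi_deriv 0 \<psi> x))"
    using assms unfolding schwartz_def by auto
  have "\<psi> differentiable (at x)" for x
    using sm[unfolded smooth_def, rule_format, of "[]" x] by (simp add: iter_partial_def)
  then show "continuous_on UNIV \<psi>"
    by (intro continuous_at_imp_continuous_on ballI differentiable_imp_continuous_within)
  \<comment> \<open>Even for the multi-index 0 the operator \<open>mi_deriv\<close> chooses a list;
    vanishing counts force it to be empty.\<close>
  define js where "js = (SOME js. \<forall>i. count_list js i = (0 :: nat ^ 'a) $ i)"
  have "\<forall>i. count_list js i = (0 :: nat ^ 'a) $ i" unfolding js_def by (rule someI_ex[OF ex_list_of_multi_index])
  then have "js = []" using length_eq_sum_count[of js] by simp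
  then have "mi_deriv (0 :: nat ^ 'a) \<psi> = \<psi>" unfolding mi_deriv_def js_def[symmetric] by (simp add: iter_partial_def)
  moreover have "mi_power x (0 :: nat ^ 'a) = 1" for x :: "real ^ 'a" by (simp add: mi_power_def)
  ultimately show "\<exists>B. \<forall>x. norm (\<psi> x) \<le> B" using bd by (auto simp: bounded_iff)
qed

context radial_weight
begin

lemma hermite_coeff_stft:
  assumes "powser F a" "distinct js" "set js = UNIV"
    and "powser (\<lambda>z. exp (1/8 * (\<Sum>j\<in>UNIV. (z $ j)\<^sup>2)) * F z) a1"
  shows "hermite_coeff (stft F) \<beta> = cpx ((2 ^ mi_size \<beta> * mi_fact \<beta>) powr (- 1 / 2)) *
     shifts (- (1/8)) js (\<lambda>\<alpha>. moment \<alpha> * a1 \<alpha>) \<beta>"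
proof -
  note [measurable] = stft_measurable[OF assms(1)]
  have "hermite_coeff (stft F) \<beta> = (LINT x|lborel. stft F x * cpx (hermite_fun \<beta> x))"
    unfolding hermite_coeff_def complex_cnj_complex_of_real by (rule integral_completion) measurable
  then show ?thesis
    using stft_hermite[OF assms(1), of \<beta>] weighted_integral_shifts[OF assms(4,2), of "- (1/8)"] assms(3) by simp
qed

lemma square_integrable_stft:
  assumes "powser F a" shows "integrable lborel (\<lambda>x. (norm (stft F x))\<^sup>2)" "square_integrable (stft F)"
proof -
  note [measurable] = stft_measurable[OF assms]
  obtain C where C: "\<And>x. norm (stft F x) \<le> C * gauss (1/4) x" using stft_bound[OF assms] by blast
  have i: "integrable lborel (\<lambda>x :: real^'n. C\<^sup>2 * gauss (1/2) x)"
    by (intro integrable_mult_right integrable_gaussian) simp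
  show i2: "integrable lborel (\<lambda>x. (norm (stft F x))\<^sup>2)"
  proof (rule integrable_norm_le[OF i])
    fix x
    have "(norm (stft F x))\<^sup>2 \<le> (C * gauss (1/4) x)\<^sup>2" using C by (intro power_mono) auto
    also have "\<dots> = C\<^sup>2 * gauss (1/2) x" by (simp add: power_mult_distrib exp_double[symmetric])
    finally show "norm ((norm (stft F x))\<^sup>2) \<le> C\<^sup>2 * gauss (1/2) x" by simp
  qed measurable
  then show "square_integrable (stft F)" unfolding square_integrable_def
    by (auto intro!: measurable_completion simp: integrable_completion)
qed

lemma integrable_stft_mult:
  assumes F: "powser F a" and \<psi>: "continuous_on UNIV \<psi>" "\<And>x. norm (\<psi> x) \<le> B"
  shows "integrable lborel (\<lambda>x. stft F x * \<psi> x)"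
proof -
  note [measurable] = stft_measurable[OF assms(1)] borel_measurable_continuous_onI[OF \<psi>(1)]
  obtain C where C: "\<And>x. norm (stft F x) \<le> C * gauss (1/4) x" using stft_bound[OF assms(1)] by blast
  have i: "integrable lborel (\<lambda>x :: real^'n. C * gauss (1/4) x * B)"
    by (intro integrable_mult_right integrable_mult_left integrable_gaussian) simp
  show ?thesis
  proof (rule integrable_norm_le[OF i])
    fix x :: "real ^ 'n"
    have "0 \<le> C * gauss (1/4) x" using C[of x] norm_ge_zero[of "stft F x"] by linarith
    then show "norm (stft F x * \<psi> x) \<le> C * gauss (1/4) x * B"
      unfolding norm_mult using C \<psi>(2) by (intro mult_mono) auto
  qed measurable
qed

text \<open>The difference D of g and \<open>stft F\<close> is square-integrable with vanishing
  Hermite coefficients. Schwartz functions are continuous and bounded, so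
  \<open>hermite_complete\<close> makes the two functionals agree on them.\<close>

lemma represented_by_stft:
  fixes g :: "real ^ 'n \<Rightarrow> complex"
  assumes F: "powser F a" and g: "square_integrable g" "represented_by f g"
    and eq: "\<And>\<alpha>. hermite_coeff (stft F) \<alpha> = hermite_coeff g \<alpha>"
  shows "represented_by f (stft F)"
  unfolding represented_by_def
proof (intro ballI)
  fix \<psi> :: "real ^ 'n \<Rightarrow> complex" assume \<psi>: "\<psi> \<in> schwartz"
  note [measurable] = stft_measurable[OF F]
  obtain B where B: "\<And>x. norm (\<psi> x) \<le> B" using schwartz_continuous_bounded(2)[OF \<psi>] by blast
  note c = schwartz_continuous_bounded(1)[OF \<psi>]
  have [measurable]: "\<psi> \<in> borel_measurable borel" using c by (rule borel_measurable_continuous_onI)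
  have gm: "g \<in> borel_measurable lebesgue" and gi: "integrable lebesgue (\<lambda>x. (norm (g x))\<^sup>2)"
    using g(1) by (auto simp: square_integrable_def)
  obtain g' where g'[measurable]: "g' \<in> borel_measurable borel" and ae: "AE x in lebesgue. g x = g' x"
    using complex_borel_representative[OF gm] by blast
  \<comment> \<open>The function g is merely Lebesgue measurable; integrals against Borel functions
    are carried over to its Borel version \<open>g'\<close> on \<open>lborel\<close>.\<close>
  have transfer: "(LINT x|lebesgue. g x * h x) = (LINT x|lborel. g' x * h x)"
      "integrable lebesgue (\<lambda>x. g x * h x) \<longleftrightarrow> integrable lborel (\<lambda>x. g' x * h x)"
    if h[measurable]: "h \<in> borel_measurable borel" for h :: "real ^ 'n \<Rightarrow> complex"
  proof -
    have hl: "h \<in> borel_measurable lebesgue" and gl: "g' \<in> borel_measurable lebesgue" by (auto intro!: measurable_completion)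
    have "(LINT x|lebesgue. g x * h x) = (LINT x|lebesgue. g' x * h x)"
      using ae gm hl gl by (intro integral_cong_AE) (auto elim!: eventually_mono)
    also have "\<dots> = (LINT x|lborel. g' x * h x)" by (rule integral_completion) measurable
    finally show "(LINT x|lebesgue. g x * h x) = (LINT x|lborel. g' x * h x)" .
    have "integrable lebesgue (\<lambda>x. g x * h x) \<longleftrightarrow> integrable lebesgue (\<lambda>x. g' x * h x)"
      using ae gm hl gl by (intro integrable_cong_AE) (auto elim!: eventually_mono)
    then show "integrable lebesgue (\<lambda>x. g x * h x) \<longleftrightarrow> integrable lborel (\<lambda>x. g' x * h x)"
      by (subst (asm) (2) integrable_completion) measurable
  qed
  have g'i: "integrable lborel (\<lambda>x. (norm (g' x))\<^sup>2)"
  proof -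
    have gl: "g' \<in> borel_measurable lebesgue" by (auto intro!: measurable_completion)
    have "integrable lebesgue (\<lambda>x. (norm (g' x))\<^sup>2)"
      using gi by (rule integrable_cong_AE_imp) (use ae gl in \<open>auto elim!: eventually_mono\<close>)
    then show ?thesis by (subst (asm) integrable_completion) measurable
  qed
  have s\<psi>: "integrable lborel (\<lambda>x. stft F x * \<psi> x)" by (rule integrable_stft_mult[OF F c B])
  have g\<psi>: "integrable lborel (\<lambda>x. g' x * \<psi> x)" and fg: "f \<psi> = (LINT x|lborel. g' x * \<psi> x)"
    using g(2) \<psi> transfer[of \<psi>] by (auto simp: represented_by_def)
  define D where "D x = g' x - stft F x" for x
  have [measurable]: "D \<in> borel_measurable borel" unfolding D_def by measurable
  have Di: "integrable lborel (\<lambda>x. (norm (D x))\<^sup>2)"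
  proof (rule integrable_norm_le)
    show "integrable lborel (\<lambda>x. 2 * (norm (g' x))\<^sup>2 + 2 * (norm (stft F x))\<^sup>2)"
      by (intro Bochner_Integration.integrable_add integrable_mult_right g'i square_integrable_stft[OF F])
    fix x
    have "(norm (D x))\<^sup>2 \<le> (norm (g' x) + norm (stft F x))\<^sup>2" unfolding D_def by (intro power_mono norm_triangle_ineq4) auto
    also have "\<dots> \<le> 2 * (norm (g' x))\<^sup>2 + 2 * (norm (stft F x))\<^sup>2"
      using zero_le_power2[of "norm (g' x) - norm (stft F x)"] by (simp add: power2_sum power2_diff)
    finally show "norm ((norm (D x))\<^sup>2) \<le> 2 * (norm (g' x))\<^sup>2 + 2 * (norm (stft F x))\<^sup>2" by simp
  qed measurable
  have "(LINT x|lborel. D x * \<psi> x) = 0"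
  proof (rule hermite_complete[OF _ Di _ c B])
    show "(LINT x|lborel. D x * cpx (hermite_fun \<alpha> x)) = 0" for \<alpha> :: "nat ^ 'n"
    proof -
      let ?h = "\<lambda>x :: real ^ 'n. cpx (hermite_fun \<alpha> x)"
      obtain C where C: "\<And>x. norm (?h x) \<le> C * gauss (1/4) x" using hermite_fun_bound by blast
      have 1: "integrable lborel (\<lambda>x. g' x * ?h x)" by (rule integrable_L2_mult_gauss[OF _ _ g'i _ C]) auto
      have 2: "integrable lborel (\<lambda>x. stft F x * ?h x)"
        by (rule integrable_L2_mult_gauss[OF _ _ square_integrable_stft(1)[OF F] _ C]) auto
      have "(LINT x|lborel. D x * ?h x) = (LINT x|lborel. g' x * ?h x) - (LINT x|lborel. stft F x * ?h x)"
        unfolding D_def left_diff_distrib by (rule Bochner_Integration.integral_diff[OF 1 2])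
      also have "(LINT x|lborel. g' x * ?h x) = hermite_coeff g \<alpha>"
        unfolding hermite_coeff_def complex_cnj_complex_of_real by (rule transfer(1)[symmetric]) measurable
      also have "(LINT x|lborel. stft F x * ?h x) = hermite_coeff (stft F) \<alpha>"
        unfolding hermite_coeff_def complex_cnj_complex_of_real by (rule integral_completion[symmetric]) measurable
      finally show ?thesis using eq by simp
    qed
    show "integrable lborel (\<lambda>x. D x * \<psi> x)" unfolding D_def left_diff_distrib
      by (rule Bochner_Integration.integrable_diff[OF g\<psi> s\<psi>])
  qed measurable
  then have "(LINT x|lborel. g' x * \<psi> x) = (LINT x|lborel. stft F x * \<psi> x)"
    unfolding D_def left_diff_distrib using Bochner_Integration.integral_diff[OF g\<psi> s\<psi>] by simp
  moreover have "(LINT x|lebesgue. stft F x * \<psi> x) = (LINT x|lborel. stft F x * \<psi> x)" by (rule integral_completion) measurable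
  moreover have "integrable lebesgue (\<lambda>x. stft F x * \<psi> x)" using s\<psi> by (subst integrable_completion) measurable
  ultimately show "integrable lebesgue (\<lambda>x. stft F x * \<psi> x) \<and> f \<psi> = (LINT x|lebesgue. stft F x * \<psi> x)"
    using fg by simp
qed

end

section \<open>The equivalence\<close>

text \<open>Condition (2) fixes F almost everywhere once F_0 is given, so \<open>symb F\<close>
  serves as witness and the adjoint transform of any other candidate is the same function.\<close>

lemma STFT_adjoint_representation_iff:
  fixes \<kappa> :: "complex ^ 'n \<Rightarrow> real"
  assumes k: "radial_weight k M c t T" "AE p in lborel. k p = \<kappa> (zvec p)"
    and A: "\<And>F. F \<in> A \<Longrightarrow> \<exists>a. powser F a"
  shows "STFT_adjoint_representation gauss_window \<kappa> A f \<longleftrightarrow>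
    (\<exists>F\<in>A. represented_by f (radial_weight.stft k F))"
proof -
  interpret radial_weight k M c t T by (rule k)
  have ae: "AE p in lebesgue. F (zbar p) * exp (- \<i> * cpx (fst p \<bullet> snd p)) * cpx (\<kappa> (zvec p)) = symb F p" for F
    using k(2) by (auto simp: AE_completion_iff symb_def elim!: eventually_mono)
  show ?thesis
  proof
    assume "STFT_adjoint_representation gauss_window \<kappa> A f"
    then obtain G F where G: "Linfty G" and F: "F \<in> A" and
      eq: "AE p in lebesgue. G p = F (zbar p) * exp (- \<i> * cpx (fst p \<bullet> snd p)) * cpx (\<kappa> (zvec p))"
      and rep: "represented_by f (STFT_adjoint gauss_window G)"
      unfolding STFT_adjoint_representation_def by blast
    obtain a where a: "powser F a" using A[OF F] by blast
    have "AE p in lebesgue. G p = symb F p" using eq ae[of F] by eventually_elim simp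
    then have "STFT_adjoint gauss_window G = stft F" using G unfolding Linfty_def by (intro STFT_adjoint_eq_stft[OF a]) auto
    then show "\<exists>F\<in>A. represented_by f (stft F)" using rep F by auto
  next
    assume "\<exists>F\<in>A. represented_by f (stft F)"
    then obtain F where F: "F \<in> A" and rep: "represented_by f (stft F)" by blast
    obtain a where a: "powser F a" using A[OF F] by blast
    have "symb F \<in> borel_measurable lebesgue" using Linfty_symb(1)[OF a] by (simp add: Linfty_def)
    then have "STFT_adjoint gauss_window (symb F) = stft F" by (intro STFT_adjoint_eq_stft[OF a]) auto
    then have "represented_by f (STFT_adjoint gauss_window (symb F))" using rep by simp
    moreover have "AE p in lebesgue. symb F p = F (zbar p) * exp (- \<i> * cpx (fst p \<bullet> snd p)) * cpx (\<kappa> (zvec p))"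
      using ae[of F] by eventually_elim simp
    ultimately show "STFT_adjoint_representation gauss_window \<kappa> A f"
      unfolding STFT_adjoint_representation_def using Linfty_symb[OF a] F by blast
  qed
qed

lemma hermite_factor:
  "cpx ((2 ^ mi_size \<beta> * mi_fact \<beta>) powr (- 1 / 2)) = 1 / cpx (sqrt (2 ^ mi_size \<beta> * mi_fact \<beta>))"
  "sqrt (2 ^ mi_size \<beta> * mi_fact \<beta>) = mi_power (\<chi> i. sqrt 2) \<beta> * mi_fact \<beta> powr (1/2)"
  for \<beta> :: "nat ^ 'n"
proof -
  have "0 < 2 ^ mi_size \<beta> * mi_fact \<beta>" using mi_fact_pos[of \<beta>] by simp
  then show "cpx ((2 ^ mi_size \<beta> * mi_fact \<beta>) powr (- 1 / 2)) = 1 / cpx (sqrt (2 ^ mi_size \<beta> * mi_fact \<beta>))"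
    using powr_minus_divide[of "2 ^ mi_size \<beta> * mi_fact \<beta>" "1/2"] by (simp add: powr_half_sqrt)
  have "sqrt (2 ^ mi_size \<beta>) = mi_power (\<chi> i. sqrt 2) \<beta>"
    unfolding real_sqrt_power by (simp add: mi_power_def mi_size_def power_sum)
  then show "sqrt (2 ^ mi_size \<beta> * mi_fact \<beta>) = mi_power (\<chi> i. sqrt 2) \<beta> * mi_fact \<beta> powr (1/2)"
    using mi_fact_pos[of \<beta>] by (simp add: real_sqrt_mult powr_half_sqrt)
qed

lemma mi_power_one: "mi_power ((\<chi> i. 1) :: real ^ 'n) \<alpha> = 1"
  by (simp add: mi_power_def)

locale radial_radius_class = radial_weight k M c t T + radius_class R
  for k :: "'n::finite phase \<Rightarrow> real" and M c :: real and t T :: "real^'n"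
    and R :: "real \<Rightarrow> (nat ^ 'n \<Rightarrow> complex) \<Rightarrow> bool" +
  fixes \<sigma> \<sigma>0 :: real
  assumes sigma: "1 / 2 < \<sigma>" "\<sigma> < 1" "\<sigma>0 = \<sigma> / (2 * \<sigma> - 1)"
begin

text \<open>Decay exponent of the plain Taylor coefficients of F_0 and of the unnormalised Hermite
  coefficients alike.\<close>

definition \<tau> :: real where "\<tau> = (1 - \<sigma>) / (2 * \<sigma>)"

lemma tau: "0 < \<tau>" "\<tau> < 1/2" "1 / (2 * \<sigma>) = \<tau> + 1/2" "- (1 / (2 * \<sigma>0)) = \<tau> - 1/2"
proof -
  have s: "0 < \<sigma>" "0 < 2 * \<sigma> - 1" using sigma by auto
  show "0 < \<tau>" "\<tau> < 1/2" using sigma s by (auto simp: \<tau>_def divide_simps)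
  show "1 / (2 * \<sigma>) = \<tau> + 1/2" using s by (simp add: \<tau>_def field_simps)
  show "- (1 / (2 * \<sigma>0)) = \<tau> - 1/2" using s by (simp add: \<tau>_def sigma(3) field_simps)
qed

lemma moment_coeffs: "R \<tau> a \<Longrightarrow> R \<tau> (\<lambda>\<alpha>. moment \<alpha> * a \<alpha>)"
proof (rule mult_le[of \<tau> a "\<chi> j. (T $ j)\<^sup>2" "M * phase_vol + 1" _ 0])
  show "positive_radius (\<chi> j. (T $ j)\<^sup>2)" unfolding positive_radius_def vec_lambda_beta by (intro allI zero_less_power T_pos)
  have mv: "0 \<le> M * phase_vol" using M_nonneg by (simp add: phase_vol_def)
  then show "0 < M * phase_vol + 1" by simp
  fix \<alpha> :: "nat ^ 'n"
  have "norm (moment \<alpha>) \<le> (M * phase_vol + 1) * mi_power (\<chi> j. (T $ j)\<^sup>2) \<alpha>"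
    using moment_upper[of \<alpha>] mi_power_nonneg[of "\<chi> j. (T $ j)\<^sup>2" \<alpha>] by (simp add: distrib_right)
  then show "norm (moment \<alpha> * a \<alpha>) \<le> (M * phase_vol + 1) * (mi_power (\<chi> j. (T $ j)\<^sup>2) \<alpha> * mi_fact \<alpha> powr 0) * norm (a \<alpha>)"
    using mi_fact_pos[of \<alpha>] by (simp add: norm_mult mult_right_mono)
qed auto

lemma moment_nonzero: "moment \<alpha> \<noteq> 0"
proof -
  obtain C where C: "C > 0" "C * mi_power (\<chi> j. (t $ j / 2)\<^sup>2) \<alpha> \<le> norm (moment \<alpha>)" using moment_lower by blast
  moreover have "0 < mi_power (\<chi> j. (t $ j / 2)\<^sup>2) \<alpha>" using t_pos by (intro mi_power_pos) (simp add: less_imp_neq[symmetric])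
  ultimately have "0 < norm (moment \<alpha>)" using mult_pos_pos[of C "mi_power (\<chi> j. (t $ j / 2)\<^sup>2) \<alpha>"] by linarith
  then show ?thesis by simp
qed

text \<open>Thanks to the geometric lower bound, division by moments is again a change of radius,
  with the reciprocals of (t_j/2)^2.\<close>

lemma moment_divide_coeffs: "R \<tau> u \<Longrightarrow> R \<tau> (\<lambda>\<alpha>. u \<alpha> / moment \<alpha>)"
proof -
  assume u: "R \<tau> u"
  define w where "w = (\<chi> j. (t $ j / 2)\<^sup>2)"
  have w: "0 < w $ j" for j using t_pos[of j] by (simp add: w_def)
  obtain C where C: "C > 0" "\<And>\<alpha>. C * mi_power w \<alpha> \<le> norm (moment \<alpha>)" using moment_lower unfolding w_def by blast
  define v where "v = (\<chi> j. 1 / w $ j)"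
  have v: "mi_power v \<alpha> = 1 / mi_power w \<alpha>" for \<alpha>
    by (simp add: v_def mi_power_def prod_dividef power_divide)
  show ?thesis
  proof (rule mult_le[OF u, of v "1 / C" _ 0])
    show "positive_radius v" using w by (simp add: v_def positive_radius_def)
    show "0 < 1 / C" using C by simp
    fix \<alpha> :: "nat ^ 'n"
    have pos: "0 < C * mi_power w \<alpha>" using C mi_power_pos[of w \<alpha>, OF w] by simp
    have "norm (u \<alpha> / moment \<alpha>) = norm (u \<alpha>) / norm (moment \<alpha>)" by (simp add: norm_divide)
    also have "\<dots> \<le> norm (u \<alpha>) / (C * mi_power w \<alpha>)" using C(1) C(2)[of \<alpha>] mi_power_pos[of w \<alpha>, OF w] moment_nonzero[of \<alpha>] by (intro divide_left_mono mult_pos_pos) auto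
    finally show "norm (u \<alpha> / moment \<alpha>) \<le> 1 / C * (mi_power v \<alpha> * mi_fact \<alpha> powr 0) * norm (u \<alpha>)"
      using mi_fact_pos[of \<alpha>] by (simp add: v)
  qed simp
qed

lemma shifts_coeffs:
  assumes "R \<tau> u" shows "R \<tau> (shifts s js u)"
proof (rule rescale[OF assms, of "\<chi> i. 1"])
  fix r :: "real ^ 'n" assume r: "positive_radius r" "bnd \<tau> r u"
  have "(\<chi> i. ((\<chi> i. 1) :: real ^ 'n) $ i * r $ i) = r" by (simp add: vec_eq_iff)
  then show "bnd \<tau> (\<chi> i. ((\<chi> i. 1) :: real ^ 'n) $ i * r $ i) (shifts s js u)"
    using bnd_shifts[OF r(2) _ r(1)] tau(1) by simp
qed (simp add: positive_radius_def)

lemma hermite_coeff_imp: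
  assumes F: "powser F a" "R \<tau> a"
  shows "R (1 / (2 * \<sigma>)) (hermite_coeff (stft F))"
proof -
  obtain js :: "'n list" where js: "set js = UNIV" "distinct js" using finite_distinct_list[OF finite[of UNIV]] by auto
  define a1 where "a1 = exp_mult_coeffs (1/8) js a"
  have p1: "powser (\<lambda>z. exp (1/8 * (\<Sum>j\<in>UNIV. (z $ j)\<^sup>2)) * F z) a1"
    using powser_exp_mults[OF F(1) js(2), of "1/8"] unfolding a1_def js(1) .
  have "R \<tau> a1" unfolding a1_def by (rule exp_mult[OF F(2) tau(1,2)])
  then have b: "R \<tau> (shifts (- (1/8)) js (\<lambda>\<alpha>. moment \<alpha> * a1 \<alpha>))" (is "R \<tau> ?b")
    by (intro shifts_coeffs moment_coeffs)
  show ?thesis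
  \<comment> \<open>Division by sqrt(2^|\<alpha>| \<alpha>!) raises the exponent from \<tau> to
    \<tau> + 1/2 = 1/(2 \<sigma>) and shrinks the radius by sqrt 2.\<close>
  proof (rule mult_le[OF b, of "\<chi> i. 1 / sqrt 2" 1 _ "- (1/2)"])
    fix \<alpha> :: "nat ^ 'n"
    have mp: "mi_power (\<chi> i. 1 / sqrt 2) \<alpha> = 1 / mi_power (\<chi> i. sqrt 2) \<alpha>"
      by (simp add: mi_power_def prod_dividef power_divide)
    have pos: "0 < mi_power (\<chi> i. sqrt 2) \<alpha>" by (rule mi_power_pos) simp
    show "norm (hermite_coeff (stft F) \<alpha>) \<le> 1 * (mi_power (\<chi> i. 1 / sqrt 2) \<alpha> * mi_fact \<alpha> powr - (1/2)) * norm (?b \<alpha>)"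
      unfolding hermite_coeff_stft[OF F(1) js(2,1) p1] hermite_factor mp powr_minus_divide
      using pos by (simp add: norm_mult norm_divide)
  qed (auto simp: positive_radius_def tau)
qed

text \<open>Every step from F to its Hermite coefficients is undone in the opposite order:
  normalisation, shifts, moments, exponential factor. Each inverse respects the coefficient
  class.\<close>

lemma exists_powser:
  assumes g: "R (1 / (2 * \<sigma>)) (hermite_coeff g)"
  shows "\<exists>F a. powser F a \<and> R \<tau> a \<and> hermite_coeff (stft F) = hermite_coeff g"
proof -
  obtain js :: "'n list" where js: "set js = UNIV" "distinct js" using finite_distinct_list[OF finite[of UNIV]] by auto
  define b where "b \<alpha> = cpx (sqrt (2 ^ mi_size \<alpha> * mi_fact \<alpha>)) * hermite_coeff g \<alpha>" for \<alpha>
  have b: "R \<tau> b"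
  proof (rule mult_le[OF g, of "\<chi> i. sqrt 2" 1 _ "1/2"])
    fix \<alpha> :: "nat ^ 'n"
    have pos: "0 \<le> mi_power (\<chi> i. sqrt 2) \<alpha>" by (rule mi_power_nonneg) simp
    show "norm (b \<alpha>) \<le> 1 * (mi_power (\<chi> i. sqrt 2) \<alpha> * mi_fact \<alpha> powr (1/2)) * norm (hermite_coeff g \<alpha>)"
      unfolding b_def hermite_factor(2) using pos by (simp add: norm_mult)
  qed (auto simp: positive_radius_def tau)
  \<comment> \<open>One explicit radius guarantees convergence of the sums in \<open>shift\<close>,
    on which cancellation of the shifts relies.\<close>
  obtain r where r: "positive_radius r" "bnd \<tau> r b" using obtain_radius[OF b] by blast
  define u where "u = shifts (1/8) (rev js) b"
  have u: "R \<tau> u" unfolding u_def by (rule shifts_coeffs[OF b])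
  have ub: "shifts (- (1/8)) js u = b"
    using shifts_inverse[OF r(2) _ r(1), of "- (1/8)" js] tau by (simp add: u_def)
  define a1 where "a1 \<alpha> = u \<alpha> / moment \<alpha>" for \<alpha>
  have a1: "R \<tau> a1" unfolding a1_def by (rule moment_divide_coeffs[OF u])
  then obtain F1 where F1: "powser F1 a1" using obtain_radius bnd_imp_powser[OF _ tau(1)] by blast
  \<comment> \<open>Dividing by exp(w^2/8) in advance makes the product that occurs in
    \<open>hermite_coeff_stft\<close> equal to F1.\<close>
  define F where "F z = exp (- (1/8) * (\<Sum>j\<in>UNIV. (z $ j)\<^sup>2)) * F1 z" for z
  define a where "a = exp_mult_coeffs (- (1/8)) js a1"
  have F: "powser F a" using powser_exp_mults[OF F1 js(2), of "- (1/8)"] unfolding a_def js(1) F_def[abs_def] .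
  have a: "R \<tau> a" unfolding a_def by (rule exp_mult[OF a1 tau(1,2)])
  have "(\<lambda>z. exp (1/8 * (\<Sum>j\<in>UNIV. (z $ j)\<^sup>2)) * F z) = F1"
    by (auto simp: F_def fun_eq_iff mult.assoc[symmetric] exp_add[symmetric])
  with F1 have p1: "powser (\<lambda>z. exp (1/8 * (\<Sum>j\<in>UNIV. (z $ j)\<^sup>2)) * F z) a1" by simp
  have "(\<lambda>\<alpha>. moment \<alpha> * a1 \<alpha>) = u" using moment_nonzero by (simp add: a1_def fun_eq_iff)
  then have "hermite_coeff (stft F) \<beta> = cpx ((2 ^ mi_size \<beta> * mi_fact \<beta>) powr (- 1 / 2)) * b \<beta>" for \<beta>
    using hermite_coeff_stft[OF F js(2,1) p1, of \<beta>] ub by simp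
  moreover have "cpx (sqrt (2 ^ mi_size \<beta> * mi_fact \<beta>)) \<noteq> 0" for \<beta> :: "nat ^ 'n"
    using mi_fact_pos[of \<beta>] by simp
  ultimately have "hermite_coeff (stft F) = hermite_coeff g"
    unfolding hermite_factor(1) b_def by (simp add: fun_eq_iff)
  with F a show ?thesis by blast
qed

lemma power_series_coeffs:
  assumes "\<And>\<alpha>. C \<alpha> = cpx (sqrt (mi_fact \<alpha>)) * a \<alpha>"
  shows "R (- (1 / (2 * \<sigma>0))) C \<longleftrightarrow> R \<tau> a"
proof -
  have s: "sqrt (mi_fact \<alpha>) = mi_fact \<alpha> powr (1/2)" for \<alpha> :: "nat ^ 'n"
    using mi_fact_pos[of \<alpha>] by (simp add: powr_half_sqrt)
    show ?thesis
  proof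
    assume "R (- (1 / (2 * \<sigma>0))) C"
    then show "R \<tau> a"
    proof (rule mult_le[of _ C "\<chi> i. 1" 1 _ "- (1/2)"])
      fix \<alpha> :: "nat ^ 'n"
      show "norm (a \<alpha>) \<le> 1 * (mi_power (\<chi> i. 1) \<alpha> * mi_fact \<alpha> powr - (1 / 2)) * norm (C \<alpha>)"
        using mi_fact_pos[of \<alpha>] by (simp add: mi_power_one assms s norm_mult powr_minus_divide)
    qed (auto simp: positive_radius_def tau)
  next
    assume "R \<tau> a"
    then show "R (- (1 / (2 * \<sigma>0))) C"
    proof (rule mult_le[of _ a "\<chi> i. 1" 1 _ "1/2"])
      fix \<alpha> :: "nat ^ 'n"
      show "norm (C \<alpha>) \<le> 1 * (mi_power (\<chi> i. 1) \<alpha> * mi_fact \<alpha> powr (1 / 2)) * norm (a \<alpha>)"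
        using mi_fact_pos[of \<alpha>] by (simp add: mi_power_one assms s norm_mult)
    qed (auto simp: positive_radius_def tau)
  qed
qed

lemma representation_iff:
  "(\<exists>g\<in>{g. square_integrable g \<and> R (1 / (2 * \<sigma>)) (hermite_coeff g)}. represented_by f g) \<longleftrightarrow>
    (\<exists>F\<in>{F. \<exists>C. has_power_series F C \<and> R (- (1 / (2 * \<sigma>0))) C}. represented_by f (stft F))"
proof -
  let ?L = "\<exists>g\<in>{g. square_integrable g \<and> R (1 / (2 * \<sigma>)) (hermite_coeff g)}. represented_by f g"
  let ?P = "\<exists>F\<in>{F. \<exists>C. has_power_series F C \<and> R (- (1 / (2 * \<sigma>0))) C}. represented_by f (stft F)"
  have sq: "cpx (sqrt (mi_fact \<alpha>)) \<noteq> 0" for \<alpha> :: "nat ^ 'n" using mi_fact_pos[of \<alpha>] by simp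
  show ?thesis
  proof
    assume "?L"
    then obtain g where g: "square_integrable g" "R (1 / (2 * \<sigma>)) (hermite_coeff g)" "represented_by f g" by blast
    obtain F a where F: "powser F a" "R \<tau> a" "hermite_coeff (stft F) = hermite_coeff g" using exists_powser[OF g(2)] by blast
    define C where "C \<alpha> = cpx (sqrt (mi_fact \<alpha>)) * a \<alpha>" for \<alpha>
    have "R (- (1 / (2 * \<sigma>0))) C" using power_series_coeffs[OF C_def] F(2) by blast
    moreover have "has_power_series F C" unfolding has_power_series_iff_powser C_def using F(1) sq by simp
    moreover have "represented_by f (stft F)" by (rule represented_by_stft[OF F(1) g(1,3)]) (simp add: F(3))
    ultimately show "?P" by blast
  next
    assume "?P"
    then obtain F C where F: "has_power_series F C" "R (- (1 / (2 * \<sigma>0))) C" "represented_by f (stft F)" by blast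
    define a where "a \<alpha> = C \<alpha> / cpx (sqrt (mi_fact \<alpha>))" for \<alpha>
    have p: "powser F a" using F(1) unfolding has_power_series_iff_powser a_def[abs_def] .
    have "R \<tau> a" using power_series_coeffs[of C a] F(2) sq by (simp add: a_def)
    then have "R (1 / (2 * \<sigma>)) (hermite_coeff (stft F))" by (rule hermite_coeff_imp[OF p])
    then show "?L"
      using F(3) square_integrable_stft(2)[OF p] by blast
  qed
qed

end

theorem proposition4p5:
  fixes \<phi> :: "real ^ 'n \<Rightarrow> complex"
    and \<kappa> :: "complex ^ 'n \<Rightarrow> real"
    and \<sigma> \<sigma>0 :: real
    and f :: "(real ^ 'n \<Rightarrow> complex) \<Rightarrow> complex"
  assumes "\<phi> = (\<lambda>x. complex_of_real (pi powr (- real CARD('n) / 4) * exp (- (norm x)\<^sup>2 / 2)))"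
    and "\<kappa> \<in> R_infty"
    and "1 / 2 < \<sigma>" and "\<sigma> < 1"
    and "\<sigma>0 = \<sigma> / (2 * \<sigma> - 1)"
    and "tempered_distribution f"
  shows "((\<exists>g\<in>H_flat \<sigma>. represented_by f g) \<longleftrightarrow>
            STFT_adjoint_representation \<phi> \<kappa> (A'_0_flat \<sigma>0) f) \<and>
         ((\<exists>g\<in>H_0_flat \<sigma>. represented_by f g) \<longleftrightarrow>
            STFT_adjoint_representation \<phi> \<kappa> (A'_flat \<sigma>0) f)"
proof -
  obtain k M c t T where k: "radial_weight k M c t T" "AE p in lborel. k p = \<kappa> (zvec p)"
    using R_infty_radial_weight[OF assms(2)] by blast
  have \<phi>: "\<phi> = gauss_window" unfolding assms(1) gauss_window_def[abs_def] ..
  \<comment> \<open>The subscript 0 changes sides: \<open>H_flat\<close> and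
    \<open>A'_0_flat\<close> both ask for some radius, \<open>H_0_flat\<close> and
    \<open>A'_flat\<close> both for every radius. Each equivalence therefore involves one quantifier
    only.\<close>
  define some where "some e u \<longleftrightarrow> (\<exists>r. positive_radius r \<and> bnd e r u)" for e and u :: "nat ^ 'n \<Rightarrow> complex"
  define every where "every e u \<longleftrightarrow> (\<forall>r. positive_radius r \<longrightarrow> bnd e r u)" for e and u :: "nat ^ 'n \<Rightarrow> complex"
  have H: "H_flat \<sigma> = {g. square_integrable g \<and> some (1 / (2 * \<sigma>)) (hermite_coeff g)}"
      "H_0_flat \<sigma> = {g. square_integrable g \<and> every (1 / (2 * \<sigma>)) (hermite_coeff g)}"
    unfolding H_flat_def H_0_flat_def some_def every_def bnd_def minus_divide_left by simp_all
  have A: "A'_0_flat \<sigma>0 = {F. \<exists>c. has_power_series F c \<and> some (- (1 / (2 * \<sigma>0))) c}"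
      "A'_flat \<sigma>0 = {F. \<exists>c. has_power_series F c \<and> every (- (1 / (2 * \<sigma>0))) c}"
    unfolding A'_0_flat_def A'_flat_def some_def every_def bnd_def minus_minus by simp_all
  have ps: "\<exists>a. powser F a" if "F \<in> A'_0_flat \<sigma>0 \<or> F \<in> A'_flat \<sigma>0" for F :: "complex ^ 'n \<Rightarrow> complex"
    using that unfolding A mem_Collect_eq has_power_series_iff_powser by blast
  have "radius_class some" unfolding some_def[abs_def] by (rule radius_class_some)
  then interpret S: radial_radius_class k M c t T "some" \<sigma> \<sigma>0
    using k(1) assms(3-5) by (simp add: radial_radius_class_def radial_radius_class_axioms_def)
  have "radius_class every" unfolding every_def[abs_def] by (rule radius_class_every)
  then interpret E: radial_radius_class k M c t T every \<sigma> \<sigma>0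
    using k(1) assms(3-5) by (simp add: radial_radius_class_def radial_radius_class_axioms_def)
  show ?thesis unfolding \<phi>
    using S.representation_iff[of f] E.representation_iff[of f]
      STFT_adjoint_representation_iff[OF k, of "A'_0_flat \<sigma>0" f] STFT_adjoint_representation_iff[OF k, of "A'_flat \<sigma>0" f] ps
    unfolding H A by blast
qed

end
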